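(* Let $\Sigma$ be a linear switched system with modes $(A_i,B_i,C_i,D_i)$, $i=1,\dots,\ell$, whose switching signal depends only on time, $\sigma:[0,\infty)\to\{1,\dots,\ell\}$. Let $\Sigma_{\mathrm E}$ be an envelope system for $\Sigma$ built from decompositions $A_1-A_i=S_iM_iT_i^T$, $i=2,\dots,\ell$. Let $W,V\in\mathbb R^{n\times r}$ with $W^TV$ nonsingular, let $\widetilde\Sigma$ be the reduced switched system and $\widetilde\Sigma_{\mathrm E}$ the reduced envelope system obtained by projection with $W,V$ (all defined in the context). Assume that $$\max_{i=2,\dots,\ell}\|M_i\|_2\,\|\Sigma_{\mathrm E}\|_{\mathcal H_\infty}<1 .$$ Then there exists a constant $\eta=\eta(\Sigma_{\mathrm E})>0$, independent of $\widetilde\Sigma_{\mathrm E}$ and of the input, such that for every square-integrable input $\boldsymbol u$ $$\|\boldsymbol y(\boldsymbol u)-\widetilde{\boldsymbol y}(\boldsymbol u)\|_{\mathcal L_2}\le \eta\,\|\Sigma_{\mathrm E}-\widetilde\Sigma_{\mathrm E}\|_{\mathcal H_\infty}\,\|\widetilde{\boldsymbol u}_{\mathrm E}\|_{\mathcal L_2},$$ where $\boldsymbol y(\boldsymbol u)$ and $\widetilde{\boldsymbol y}(\boldsymbol u)$ are the outputs of $\Sigma$ and $\widetilde\Sigma$ for the input $\boldsymbol u$ and the same switching signal $\sigma$ (zero initial states), and $\widetilde{\boldsymbol u}_{\mathrm E}=K(\sigma)\widetilde{\boldsymbol y}_{\mathrm E}+K_0(\sigma)\boldsymbol u$ is the feedback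 input of the reduced envelope system in closed loop, with $\widetilde{\boldsymbol y}_{\mathrm E}$ the corresponding output of $\widetilde\Sigma_{\mathrm E}$.
   Context: **Switched system.** $\Sigma$ is the system $$\dot{\boldsymbol x}(t)=A_\sigma \boldsymbol x(t)+B_\sigma \boldsymbol u(t),\quad \boldsymbol y(t)=C_\sigma \boldsymbol x(t)+D_\sigma \boldsymbol u(t),\quad \boldsymbol x(0)=0,\quad t\ge 0,$$ with $A_i\in\mathbb R^{n\times n}$, $B_i\in\mathbb R^{n\times m}$, $C_i\in\mathbb R^{p\times n}$, $D_i\in\mathbb R^{p\times m}$ for $i=1,\dots,\ell$. The switching signal $\sigma$ is piecewise constant in time (switching times $0=t_0<t_1<\dots<t_s$). **Differences of modes.** For $i=2,\dots,\ell$ put $\Delta_{A,i}=A_1-A_i$, $\Delta_{B,i}=B_1-B_i$, $\Delta_{C,i}=C_1-C_i$, $\Delta_{D,i}=D_1-D_i$. Let $\beta_i=\operatorname{rank}(\Delta_{A,i})$ and fix a decomposition $\Delta_{A,i}=S_iM_iT_i^T$ with $S_i,T_i\in\mathbb R^{n\times\beta_i}$, $M_i\in\mathbb R^{\beta_i\times\beta_i}$. Put $\mathfrak L=\sum_{i=2}^{\ell}\beta_i$, $m_{\mathrm E}=\ell m+\mathfrak L$, $p_{\mathrm E}=\ell p+\mathfrak L$. These decompositions are regarded as part of the data of the envelope system. **Envelope system.** $\Sigma_{\mathrm E}$ is the non-switched linear system $\dot{\boldsymbol x}_{\mathrm E}=A_{\mathrm E}\boldsymbol x_{\mathrm E}+B_{\mathrm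 E}\boldsymbol u_{\mathrm E}$, $\boldsymbol y_{\mathrm E}=C_{\mathrm E}\boldsymbol x_{\mathrm E}+D_{\mathrm E}\boldsymbol u_{\mathrm E}$, $\boldsymbol x_{\mathrm E}(0)=0$, with $$A_{\mathrm E}=A_1\in\mathbb R^{n\times n},\qquad B_{\mathrm E}=\begin{bmatrix}B_1&\Delta_{B,2}&\cdots&\Delta_{B,\ell}&S_2&\cdots&S_\ell\end{bmatrix}\in\mathbb R^{n\times m_{\mathrm E}},$$ $$C_{\mathrm E}^T=\begin{bmatrix}C_1^T&\Delta_{C,2}^T&\cdots&\Delta_{C,\ell}^T&T_2&\cdots&T_\ell\end{bmatrix}\in\mathbb R^{n\times p_{\mathrm E}},$$ $$D_{\mathrm E}=\operatorname{blkdiag}(D_1,-\Delta_{D,2},\dots,-\Delta_{D,\ell},0_{\mathfrak L,\mathfrak L})\in\mathbb R^{p_{\mathrm E}\times m_{\mathrm E}}.$$ **Feedback matrices.** With the Kronecker delta $\delta_{i,\sigma}$, $$K(\sigma)=\operatorname{blkdiag}(0_{\ell m,\ell p},-\delta_{2,\sigma}M_2,\dots,-\delta_{\ell,\sigma}M_\ell)\in\mathbb R^{m_{\mathrm E}\times p_{\mathrm E}},$$ $$K_0(\sigma)=\begin{bmatrix}I_m&-\delta_{2,\sigma}I_m&\cdots&-\delta_{\ell,\sigma}I_m&0_{m,\mathfrak L}\end{bmatrix}^T\in\mathbb R^{m_{\mathrm E}\times m}.$$ **Reduced systems.** $\widetilde\Sigma$ is the switched system with zero initial state and modes $$\widetilde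 A_i=(W^TV)^{-1}W^TA_iV,\quad \widetilde B_i=(W^TV)^{-1}W^TB_i,\quad \widetilde C_i=C_iV,\quad \widetilde D_i=D_i .$$ $\widetilde\Sigma_{\mathrm E}$ is the non-switched linear system with zero initial state and matrices $$\widetilde A_{\mathrm E}=(W^TV)^{-1}W^TA_{\mathrm E}V,\quad \widetilde B_{\mathrm E}=(W^TV)^{-1}W^TB_{\mathrm E},\quad \widetilde C_{\mathrm E}=C_{\mathrm E}V,\quad \widetilde D_{\mathrm E}=D_{\mathrm E}.$$ **Norms.** $\|M\|_2$ is the spectral norm. For a square-integrable $\boldsymbol f$ on the time interval $[0,T]$ under consideration, $\|\boldsymbol f\|_{\mathcal L_2}=(\int_0^T\|\boldsymbol f(t)\|_2^2\,dt)^{1/2}$. The $\mathcal H_\infty$ norm of a (non-switched) linear system is the $\mathcal L_2$–$\mathcal L_2$ induced norm of its input-output map with zero initial state, on $[0,\infty)$; it takes values in $[0,\infty]$. The hypothesis of the theorem includes $\|\Sigma_{\mathrm E}\|_{\mathcal H_\infty}<\infty$. $\Sigma_{\mathrm E}-\widetilde\Sigma_{\mathrm E}$ is the error system mapping $\boldsymbol v$ to $\boldsymbol y_{\mathrm E}(\boldsymbol v)-\widetilde{\boldsymbol y}_{\mathrm E}(\boldsymbol v)$; if its norm is infinite, the bound is regarded as vacuous. *)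

theory Defs
  imports
    "HOL-Analysis.Analysis"
    "Jordan_Normal_Form.DL_Rank"
    "Jordan_Normal_Form.Gauss_Jordan_Elimination"
begin

unbundle no vec_syntax
unbundle no inner_syntax

text \<open>
  Matrices are those of \<open>Jordan_Normal_Form\<close>, with dimensions given by carrier sets: the ranks
  \<open>\<beta>\<^sub>i\<close> and the reduced order \<open>r\<close> must be quantified over, the latter below the existential for \<open>\<eta>\<close>.
\<close>

section \<open>Norms of vectors, matrices and signals\<close>

definition vec_norm2 :: "real Matrix.vec \<Rightarrow> real" where
  "vec_norm2 v = sqrt (v \<bullet> v)"

text \<open>
  The unit ball rather than the unit sphere is used so that the set is nonempty
  also when the matrix has no columns.
\<close>

definition spectral_norm :: "real mat \<Rightarrow> real" where
  "spectral_norm M =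
     (SUP v \<in> {v \<in> carrier_vec (dim_col M). vec_norm2 v \<le> 1}. vec_norm2 (M *\<^sub>v v))"

text \<open>The value is \<open>\<infinity>\<close> if the signal is not square-integrable on the time set \<open>I\<close>.\<close>

definition L2_norm :: "real set \<Rightarrow> (real \<Rightarrow> real Matrix.vec) \<Rightarrow> ennreal" where
  "L2_norm I f =
     (let q = (\<integral>\<^sup>+ t. ennreal ((vec_norm2 (f t))\<^sup>2) \<partial>lebesgue_on I)
      in if q = \<infinity> then \<infinity> else ennreal (sqrt (enn2real q)))"

definition square_integrable :: "nat \<Rightarrow> real set \<Rightarrow> (real \<Rightarrow> real Matrix.vec) \<Rightarrow> bool" where
  "square_integrable d I f \<longleftrightarrow>
     (\<forall>t\<in>I. f t \<in> carrier_vec d) \<and>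
     (\<forall>k<d. (\<lambda>t. f t $ k) \<in> borel_measurable (lebesgue_on I)) \<and>
     L2_norm I f < \<infinity>"

section \<open>Linear and switched linear systems\<close>

record lti =
  sysA :: "real mat"
  sysB :: "real mat"
  sysC :: "real mat"
  sysD :: "real mat"

definition lti_dims :: "nat \<Rightarrow> nat \<Rightarrow> nat \<Rightarrow> lti \<Rightarrow> bool" where
  "lti_dims n m p S \<longleftrightarrow>
     sysA S \<in> carrier_mat n n \<and> sysB S \<in> carrier_mat n m \<and>
     sysC S \<in> carrier_mat p n \<and> sysD S \<in> carrier_mat p m"

text \<open>
  Here \<open>I\<close> is \<open>{0..T}\<close> or \<open>{0..}\<close>, and \<open>S t\<close> is the mode active at time \<open>t\<close>.
  As inputs are merely square-integrable and \<open>S\<close> may jump, the differential equation with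
  \<open>x 0 = 0\<close> is understood in the sense of Caratheodory, i.e. as its integral equation.
\<close>

definition trajectory ::
  "nat \<Rightarrow> real set \<Rightarrow> (real \<Rightarrow> lti) \<Rightarrow>
   (real \<Rightarrow> real Matrix.vec) \<Rightarrow> (real \<Rightarrow> real Matrix.vec) \<Rightarrow> (real \<Rightarrow> real Matrix.vec) \<Rightarrow> bool" where
  "trajectory n I S u x y \<longleftrightarrow>
     (\<forall>t\<in>I. x t \<in> carrier_vec n) \<and>
     (\<forall>t\<in>I. \<forall>k<n.
        integrable (lebesgue_on {0..t}) (\<lambda>s. (sysA (S s) *\<^sub>v x s + sysB (S s) *\<^sub>v u s) $ k) \<and>
        x t $ k =
          integral\<^sup>L (lebesgue_on {0..t}) (\<lambda>s. (sysA (S s) *\<^sub>v x s + sysB (S s) *\<^sub>v u s) $ k)) \<and>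
     (\<forall>t\<in>I. y t = sysC (S t) *\<^sub>v x t + sysD (S t) *\<^sub>v u t)"

text \<open>The values at the switching times themselves are left arbitrary.\<close>

definition switching_signal :: "nat \<Rightarrow> (real \<Rightarrow> nat) \<Rightarrow> bool" where
  "switching_signal l \<sigma> \<longleftrightarrow>
     (\<forall>t\<ge>0. \<sigma> t \<in> {1..l}) \<and>
     (\<exists>(s::nat) (tau :: nat \<Rightarrow> real).
        tau 0 = 0 \<and> (\<forall>k<s. tau k < tau (Suc k)) \<and>
        (\<forall>k<s. \<sigma> constant_on {tau k<..<tau (Suc k)}) \<and> \<sigma> constant_on {tau s<..})"

section \<open>Input-output maps and their induced norms\<close>

text \<open>
  Input-output maps on \<open>{0..}\<close> are represented by their graphs; \<open>d\<close> is the number of inputs.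
\<close>

definition io_map ::
  "lti \<Rightarrow> (real \<Rightarrow> real Matrix.vec) \<Rightarrow> (real \<Rightarrow> real Matrix.vec) \<Rightarrow> bool" where
  "io_map S v y \<longleftrightarrow> (\<exists>x. trajectory (dim_row (sysA S)) {0..} (\<lambda>_. S) v x y)"

definition induced_norm ::
  "nat \<Rightarrow> ((real \<Rightarrow> real Matrix.vec) \<Rightarrow> (real \<Rightarrow> real Matrix.vec) \<Rightarrow> bool) \<Rightarrow> ennreal" where
  "induced_norm d G =
     (SUP (v, y) \<in> {(v, y). square_integrable d {0..} v \<and> L2_norm {0..} v \<noteq> 0 \<and> G v y}.
        L2_norm {0..} y / L2_norm {0..} v)"

definition Hinf_norm :: "lti \<Rightarrow> ennreal" where
  "Hinf_norm S = induced_norm (dim_col (sysB S)) (io_map S)"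

definition Hinf_error :: "lti \<Rightarrow> lti \<Rightarrow> ennreal" where
  "Hinf_error S S' =
     induced_norm (dim_col (sysB S))
       (\<lambda>v e. \<exists>y y'. io_map S v y \<and> io_map S' v y' \<and> e = (\<lambda>t. y t - y' t))"

section \<open>The envelope system\<close>

definition hcat :: "nat \<Rightarrow> real mat list \<Rightarrow> real mat" where
  "hcat nr Ms = transpose_mat (foldr (@\<^sub>r) (map transpose_mat Ms) (0\<^sub>m 0 nr))"

definition beta :: "nat \<Rightarrow> (nat \<Rightarrow> lti) \<Rightarrow> nat \<Rightarrow> nat" where
  "beta n \<Sigma> i = vec_space.rank n (sysA (\<Sigma> 1) - sysA (\<Sigma> i))"

definition decomposition ::
  "nat \<Rightarrow> nat \<Rightarrow> (nat \<Rightarrow> lti) \<Rightarrow>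
   (nat \<Rightarrow> real mat) \<Rightarrow> (nat \<Rightarrow> real mat) \<Rightarrow> (nat \<Rightarrow> real mat) \<Rightarrow> bool" where
  "decomposition n l \<Sigma> S M T \<longleftrightarrow>
     (\<forall>i\<in>{2..l}.
        S i \<in> carrier_mat n (beta n \<Sigma> i) \<and>
        M i \<in> carrier_mat (beta n \<Sigma> i) (beta n \<Sigma> i) \<and>
        T i \<in> carrier_mat n (beta n \<Sigma> i) \<and>
        sysA (\<Sigma> 1) - sysA (\<Sigma> i) = S i * M i * transpose_mat (T i))"

definition rank_sum :: "nat \<Rightarrow> nat \<Rightarrow> (nat \<Rightarrow> lti) \<Rightarrow> nat" where
  "rank_sum n l \<Sigma> = (\<Sum>i=2..l. beta n \<Sigma> i)"

definition envelope ::
  "nat \<Rightarrow> nat \<Rightarrow> (nat \<Rightarrow> lti) \<Rightarrow> (nat \<Rightarrow> real mat) \<Rightarrow> (nat \<Rightarrow> real mat) \<Rightarrow> lti" where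
  "envelope n l \<Sigma> S T = \<lparr>
     sysA = sysA (\<Sigma> 1),
     sysB = hcat n ([sysB (\<Sigma> 1)]
       @ map (\<lambda>i. sysB (\<Sigma> 1) - sysB (\<Sigma> i)) [2..<Suc l]
       @ map S [2..<Suc l]),
     sysC = transpose_mat (hcat n ([transpose_mat (sysC (\<Sigma> 1))]
       @ map (\<lambda>i. transpose_mat (sysC (\<Sigma> 1) - sysC (\<Sigma> i))) [2..<Suc l]
       @ map T [2..<Suc l])),
     sysD = diag_block_mat ([sysD (\<Sigma> 1)]
       @ map (\<lambda>i. - (sysD (\<Sigma> 1) - sysD (\<Sigma> i))) [2..<Suc l]
       @ [0\<^sub>m (rank_sum n l \<Sigma>) (rank_sum n l \<Sigma>)]) \<rparr>"

text \<open>In \<open>feedback_K\<close> and \<open>feedback_K0\<close> the argument \<open>j\<close> is the active mode.\<close>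

definition feedback_K :: "nat \<Rightarrow> nat \<Rightarrow> nat \<Rightarrow> (nat \<Rightarrow> real mat) \<Rightarrow> nat \<Rightarrow> real mat" where
  "feedback_K m p l M j =
     diag_block_mat (0\<^sub>m (l * m) (l * p)
       # map (\<lambda>i. (- of_bool (i = j)) \<cdot>\<^sub>m M i) [2..<Suc l])"

definition feedback_K0 :: "nat \<Rightarrow> nat \<Rightarrow> nat \<Rightarrow> (nat \<Rightarrow> lti) \<Rightarrow> nat \<Rightarrow> real mat" where
  "feedback_K0 n m l \<Sigma> j =
     transpose_mat (hcat m ([1\<^sub>m m]
       @ map (\<lambda>i. (- of_bool (i = j)) \<cdot>\<^sub>m 1\<^sub>m m) [2..<Suc l]
       @ [0\<^sub>m m (rank_sum n l \<Sigma>)]))"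

section \<open>Petrov-Galerkin reduction\<close>

definition reduce :: "real mat \<Rightarrow> real mat \<Rightarrow> lti \<Rightarrow> lti" where
  "reduce W V S =
     (let E = the (mat_inverse (transpose_mat W * V)) in \<lparr>
       sysA = E * (transpose_mat W * sysA S * V),
       sysB = E * (transpose_mat W * sysB S),
       sysC = sysC S * V,
       sysD = sysD S \<rparr>)"

end

theory Submission
  imports Defs
begin

text \<open>
  Feeding \<open>K(\<sigma>) y\<^sub>E + K\<^sub>0(\<sigma>) u\<close> back into the envelope reproduces the state of the switched system, and
  the output of the switched system is a bounded, mode-dependent selection of envelope outputs; as the projection
  acts on all modes alike, the same holds for the reduced systems. The difference \<open>e\<close> of the two closed-loop
  envelope outputs is the response of the envelope to the feedback \<open>K(\<sigma>) e\<close>, of gain at most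
  \<open>\<theta> = max \<parallel>M\<^sub>i\<parallel> \<parallel>\<Sigma>\<^sub>E\<parallel> < 1\<close>, plus the open-loop model error on the reduced feedback input. The small-gain
  argument bounds \<open>e\<close> by \<open>1 / (1 - \<theta>)\<close> times that error. It needs all signals to have finite energy on
  \<open>[0, T]\<close>, and the norms on \<open>[0, \<infinity>)\<close> apply there by causality: the input is extended by zero, the extended
  system has a solution by Picard iteration, and this solution agrees with the given one by Gronwall's argument.
\<close>

section \<open>Linear Volterra equations\<close>

text \<open>Two features of the definitions shape the proof. The supremum in
  \<open>induced_norm\<close> ranges over inputs of nonzero norm only, so inputs vanishing almost
  everywhere are treated apart, by uniqueness of solutions. And a loop equation gives no energy
  bound on its own input: since \<open>K\<close> annihilates the feedthrough term, the feedback is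
  an explicit function of the state and of \<open>u\<close>; the state is continuous, hence of
  finite energy on a bounded interval, and so is the feedback. This allows the loop-gain term to be
  absorbed on the left. All estimates are made for squared norms. In place of the triangle
  inequality, \<open>(a + b)^2 <= a^2 / \<theta> + b^2 / (1 - \<theta>)\<close> is used with a bound
  \<theta> of the loop gain as weight; it again yields \<open>1 / (1 - \<theta>)\<close>. The weight
  must be positive, so \<theta> is the larger of the loop gain and \<open>1 / 2\<close>. The
  constant is \<open>\<eta> = c / (1 - \<theta>)\<close>, where \<open>c\<close> bounds the matrices
  that select the output of the active mode; neither number depends on the reduction, the switching
  signal, the input or the final time.\<close>

lemma lebesgue_integral_power:
  fixes c t :: real
  assumes "0 \<le> t"
  shows "integrable (lebesgue_on {0..t}) (\<lambda>s. c * s ^ j)"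
    and "integral\<^sup>L (lebesgue_on {0..t}) (\<lambda>s. c * s ^ j) = c * t ^ Suc j / real (Suc j)"
proof -
  show int: "integrable (lebesgue_on {0..t}) (\<lambda>s. c * s ^ j)"
    by (intro continuous_imp_integrable_real continuous_intros)
  have "((\<lambda>s. c * s ^ j) has_integral c * t ^ Suc j / real (Suc j) - c * 0 ^ Suc j / real (Suc j)) {0..t}"
  proof (rule fundamental_theorem_of_calculus[OF assms])
    fix s :: real
    have "((\<lambda>s. c * s ^ Suc j / real (Suc j)) has_real_derivative c * s ^ j) (at s within {0..t})"
      by (rule derivative_eq_intros refl | simp del: of_nat_Suc power_Suc)+
    then show "((\<lambda>s. c * s ^ Suc j / real (Suc j)) has_vector_derivative c * s ^ j) (at s within {0..t})"
      by (simp only: has_real_derivative_iff_has_vector_derivative)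
  qed
  then show "integral\<^sup>L (lebesgue_on {0..t}) (\<lambda>s. c * s ^ j) = c * t ^ Suc j / real (Suc j)"
    using lebesgue_integral_eq_integral[OF int] by (simp add: integral_unique del: integral_mult_right)
qed

section \<open>Vanishing of solutions of homogeneous integral inequalities\<close>

lemma AE_lebesgue_on_subset:
  assumes "AE x in lebesgue_on S. P x" and "U \<subseteq> S" and "U \<in> sets lebesgue" and "S \<in> sets lebesgue"
  shows "AE x in lebesgue_on U. P x"
  using assms by (auto simp: AE_restrict_space_iff)

lemma integrable_lebesgue_on_Icc_subset:
  fixes f :: "real \<Rightarrow> real"
  assumes "integrable (lebesgue_on {0..T}) f" and "t \<le> T"
  shows "integrable (lebesgue_on {0..t}) f"
proof -
  have "set_integrable lebesgue {0..T} f"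
    using assms(1) by (simp add: set_integrable_def integrable_restrict_space)
  then have "set_integrable lebesgue {0..t} f"
    by (rule set_integrable_subset) (use assms in auto)
  then show ?thesis
    by (simp add: set_integrable_def integrable_restrict_space)
qed

text \<open>Inserting the inequality into itself \<open>j\<close> times gives
  \<open>M * (L * t) ^ j / fact j\<close>, which tends to \<open>0\<close>. The bound on
  \<open>g\<close> is stated for every common bound \<open>B\<close> of the components, which avoids
  a maximum over the index set, and only almost everywhere, because inputs may differ on a null
  set.\<close>

lemma gronwall_zero:
  fixes z g :: "nat \<Rightarrow> real \<Rightarrow> real" and L T :: real
  assumes int: "\<And>k. k < n \<Longrightarrow> integrable (lebesgue_on {0..T}) (g k)"
    and eq: "\<And>k t. k < n \<Longrightarrow> t \<in> {0..T} \<Longrightarrow> z k t = integral\<^sup>L (lebesgue_on {0..t}) (g k)"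
    and bound: "\<And>k. k < n \<Longrightarrow>
      AE s in lebesgue_on {0..T}. \<forall>B. (\<forall>i<n. \<bar>z i s\<bar> \<le> B) \<longrightarrow> \<bar>g k s\<bar> \<le> L * B"
    and "k < n" and "t \<in> {0..T}"
  shows "z k t = 0"
proof -
  \<comment> \<open>Bounds every component on the whole interval, which starts the induction at
    \<open>j = 0\<close>.\<close>
  define M where "M = (\<Sum>k<n. integral\<^sup>L (lebesgue_on {0..T}) (\<lambda>s. \<bar>g k s\<bar>))"
  have abs_le: "\<bar>z k t\<bar> \<le> integral\<^sup>L (lebesgue_on {0..t}) (\<lambda>s. \<bar>g k s\<bar>)"
    if "k < n" "t \<in> {0..T}" for k t
    using eq[OF that] integral_norm_bound[of "lebesgue_on {0..t}" "g k"] by simp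
  have est: "\<bar>z k t\<bar> \<le> M * (L * t) ^ j / fact j" if "k < n" "t \<in> {0..T}" for k t j
    using that
  proof (induction j arbitrary: k t)
    case 0
    have "\<bar>z k t\<bar> \<le> integral\<^sup>L (lebesgue_on {0..T}) (\<lambda>s. \<bar>g k s\<bar>)"
      using abs_le[OF 0] 0 int[of k]
      by (intro order_trans[OF abs_le integral_mono_lebesgue_on_AE]) auto
    also have "\<dots> \<le> M"
      unfolding M_def using 0 by (intro member_le_sum) auto
    finally show ?case by simp
  next
    case (Suc j)
    \<comment> \<open>With this constant the induction hypothesis multiplied by \<open>L\<close>
      reads \<open>c * s ^ j\<close>, whose integral produces the next factorial.\<close>
    define c where "c = L * (M * L ^ j / fact j)"
    have t: "0 \<le> t" "t \<le> T" using Suc.prems by auto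
    have "\<bar>z k t\<bar> \<le> integral\<^sup>L (lebesgue_on {0..t}) (\<lambda>s. \<bar>g k s\<bar>)"
      by (rule abs_le[OF Suc.prems])
    also have "\<dots> \<le> integral\<^sup>L (lebesgue_on {0..t}) (\<lambda>s. c * s ^ j)"
    proof (rule integral_mono_AE)
      show "integrable (lebesgue_on {0..t}) (\<lambda>s. \<bar>g k s\<bar>)"
        using integrable_lebesgue_on_Icc_subset[OF int t(2)] Suc.prems by auto
      show "integrable (lebesgue_on {0..t}) (\<lambda>s. c * s ^ j)"
        by (rule lebesgue_integral_power[OF t(1)])
      have "AE s in lebesgue_on {0..t}. \<forall>B. (\<forall>i<n. \<bar>z i s\<bar> \<le> B) \<longrightarrow> \<bar>g k s\<bar> \<le> L * B"
        using AE_lebesgue_on_subset[OF bound] t Suc.prems(1) by auto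
      then show "AE s in lebesgue_on {0..t}. \<bar>g k s\<bar> \<le> c * s ^ j"
      proof (rule lebesgue_on_mono)
        fix s assume "s \<in> {0..t}" and *: "\<forall>B. (\<forall>i<n. \<bar>z i s\<bar> \<le> B) \<longrightarrow> \<bar>g k s\<bar> \<le> L * B"
        then have "\<forall>i<n. \<bar>z i s\<bar> \<le> M * (L * s) ^ j / fact j"
          using Suc.IH t by auto
        with * have "\<bar>g k s\<bar> \<le> L * (M * (L * s) ^ j / fact j)" by blast
        then show "\<bar>g k s\<bar> \<le> c * s ^ j"
          by (simp add: c_def power_mult_distrib)
      qed
    qed
    also have "\<dots> = c * t ^ Suc j / real (Suc j)"
      by (rule lebesgue_integral_power[OF t(1)])
    also have "\<dots> = M * (L * t) ^ Suc j / fact (Suc j)"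
      by (simp add: c_def power_mult_distrib field_simps)
    finally show ?case .
  qed
  \<comment> \<open>The bounds are terms of an exponential series, hence tend to
    \<open>0\<close>.\<close>
  have "(\<lambda>j. M * (inverse (fact j) * (L * t) ^ j)) \<longlonglongrightarrow> M * 0"
    by (intro tendsto_mult_left summable_LIMSEQ_zero summable_exp)
  then have "(\<lambda>j. M * (L * t) ^ j / fact j) \<longlonglongrightarrow> 0"
    by (simp add: divide_inverse mult_ac)
  then have "\<bar>z k t\<bar> \<le> 0"
    by (rule tendsto_lowerbound) (use est[OF assms(4,5)] in auto)
  then show ?thesis by simp
qed

section \<open>Solutions by Picard iteration\<close>

text \<open>These are the increments between successive Picard iterates, the terms of the Neumann
  series of the Volterra operator; the iterates themselves are the partial sums over
  \<open>j\<close>.\<close>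

primrec picard :: "nat \<Rightarrow> (nat \<Rightarrow> nat \<Rightarrow> real) \<Rightarrow> (nat \<Rightarrow> real \<Rightarrow> real) \<Rightarrow> nat \<Rightarrow> nat \<Rightarrow> real \<Rightarrow> real" where
  "picard n a h 0 = h"
| "picard n a h (Suc j) = (\<lambda>k t. integral {0..t} (\<lambda>s. \<Sum>i<n. a k i * picard n a h j i s))"

text \<open>Near \<open>t\<close> the half-line coincides with \<open>{0..t + 1}\<close>, so
  continuity can be checked on bounded intervals, where the convergence below is uniform.\<close>

lemma continuous_on_atLeast_iff:
  fixes f :: "real \<Rightarrow> real"
  shows "continuous_on {0..} f \<longleftrightarrow> (\<forall>T. continuous_on {0..T} f)"
proof
  assume *: "\<forall>T. continuous_on {0..T} f"
  have "continuous (at t within {0..}) f" if "0 \<le> t" for t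
  proof -
    have "continuous (at t within {0..t + 1}) f"
      using * that by (auto simp: continuous_on_eq_continuous_within)
    moreover have "at t within {0..t + 1} = at t within {0..}"
      by (rule at_within_nhd[of _ "{..<t + 1}"]) auto
    ultimately show ?thesis by simp
  qed
  then show "continuous_on {0..} f"
    by (simp add: continuous_on_eq_continuous_within)
qed (auto intro: continuous_on_subset)

lemma continuous_on_picard:
  assumes "\<And>k. k < n \<Longrightarrow> continuous_on {0..T} (h k)" and "k < n"
  shows "continuous_on {0..T} (picard n a h j k)"
  using assms(2)
proof (induction j arbitrary: k)
  case (Suc j)
  have "continuous_on {0..T} (\<lambda>s. \<Sum>i<n. a k i * picard n a h j i s)"
    using Suc.IH by (intro continuous_intros) auto
  then show ?case
    by (auto intro: indefinite_integral_continuous_1 integrable_continuous_real)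
qed (use assms in auto)

text \<open>Each step multiplies by the row-sum bound \<open>L\<close> and integrates a power of
  \<open>s\<close>, so the factorials of the exponential series accumulate. The result is the
  majorant for the Weierstrass test.\<close>

lemma picard_bound:
  assumes cont: "\<And>k. k < n \<Longrightarrow> continuous_on {0..T} (h k)"
    and h: "\<And>k t. k < n \<Longrightarrow> t \<in> {0..T} \<Longrightarrow> \<bar>h k t\<bar> \<le> M"
    and a: "\<And>k. k < n \<Longrightarrow> (\<Sum>i<n. \<bar>a k i\<bar>) \<le> L"
    and "k < n" and "t \<in> {0..T}"
  shows "\<bar>picard n a h j k t\<bar> \<le> M * (L * t) ^ j / fact j"
  using assms(4,5)
proof (induction j arbitrary: k t)
  case 0
  then show ?case using h by simp
next
  case (Suc j)
  define c where "c = L * (M * L ^ j / fact j)"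
  have t: "0 \<le> t" "t \<le> T" using Suc.prems by auto
  have int: "(\<lambda>s. \<Sum>i<n. a k i * picard n a h j i s) integrable_on {0..t}"
    using t by (intro integrable_continuous_real continuous_intros
        continuous_on_subset[OF continuous_on_picard[OF cont]]) auto
  have "norm (integral {0..t} (\<lambda>s. \<Sum>i<n. a k i * picard n a h j i s)) \<le> integral {0..t} (\<lambda>s. c * s ^ j)"
  proof (rule integral_norm_bound_integral[OF int])
    show "(\<lambda>s. c * s ^ j) integrable_on {0..t}"
      by (intro integrable_continuous_real continuous_intros)
    fix s assume s: "s \<in> {0..t}"
    have b: "\<bar>picard n a h j i s\<bar> \<le> M * (L * s) ^ j / fact j" if "i < n" for i
      using Suc.IH[OF that] s t by auto
    \<comment> \<open>The majorant is nonnegative because it dominates an absolute value, that of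
      component \<open>k\<close>.\<close>
    then have b0: "0 \<le> M * (L * s) ^ j / fact j" using Suc.prems(1) abs_ge_zero order_trans by blast
    have "norm (\<Sum>i<n. a k i * picard n a h j i s) \<le> (\<Sum>i<n. \<bar>a k i\<bar> * (M * (L * s) ^ j / fact j))"
    proof (rule sum_norm_le)
      fix i assume "i \<in> {..<n}"
      then show "norm (a k i * picard n a h j i s) \<le> \<bar>a k i\<bar> * (M * (L * s) ^ j / fact j)"
        unfolding real_norm_def abs_mult using b by (intro mult_left_mono) auto
    qed
    also have "\<dots> = (\<Sum>i<n. \<bar>a k i\<bar>) * (M * (L * s) ^ j / fact j)"
      by (rule sum_distrib_right[symmetric])
    also have "\<dots> \<le> L * (M * (L * s) ^ j / fact j)"
      using a[OF Suc.prems(1)] b0 by (rule mult_right_mono)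
    finally show "norm (\<Sum>i<n. a k i * picard n a h j i s) \<le> c * s ^ j"
      by (simp add: c_def power_mult_distrib)
  qed
  also have "\<dots> = c * t ^ Suc j / real (Suc j)"
    using lebesgue_integral_eq_integral[OF lebesgue_integral_power(1)[OF t(1), of c j]]
      lebesgue_integral_power(2)[OF t(1), of c j]
    by (metis lmeasurable_interval(1) cbox_interval fmeasurableD lmeasurable_cbox)
  also have "\<dots> = M * (L * t) ^ Suc j / fact (Suc j)"
    by (simp add: c_def power_mult_distrib field_simps)
  finally show ?case by simp
qed

lemma uniform_limit_sum:
  fixes f :: "'i \<Rightarrow> 'a \<Rightarrow> 'b \<Rightarrow> 'c::real_normed_vector"
  assumes "\<And>i. i \<in> I \<Longrightarrow> uniform_limit X (f i) (g i) F"
  shows "uniform_limit X (\<lambda>N x. \<Sum>i\<in>I. f i N x) (\<lambda>x. \<Sum>i\<in>I. g i x) F"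
  using assms
  by (induction I rule: infinite_finite_induct) (auto intro: uniform_limit_intros)

text \<open>The Picard terms sum uniformly on every bounded interval, and integration commutes with
  that limit. The inhomogeneity \<open>h\<close> is meant to be an already integrated input, which
  is continuous even if the input is not.\<close>

lemma linear_volterra_solution:
  fixes h :: "nat \<Rightarrow> real \<Rightarrow> real" and a :: "nat \<Rightarrow> nat \<Rightarrow> real"
  assumes cont: "\<And>k. k < n \<Longrightarrow> continuous_on {0..} (h k)"
  obtains x where "\<And>k. k < n \<Longrightarrow> continuous_on {0..} (x k)"
    and "\<And>k t. k < n \<Longrightarrow> 0 \<le> t \<Longrightarrow> x k t = h k t + integral {0..t} (\<lambda>s. \<Sum>i<n. a k i * x i s)"
proof -
  define x where "x k t = (\<Sum>j. picard n a h j k t)" for k t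
  have contT: "continuous_on {0..T} (h k)" if "k < n" for k T
    using cont[OF that] by (rule continuous_on_subset) auto
  have contp: "continuous_on {0..T} (picard n a h j k)" if "k < n" for j k T
    by (rule continuous_on_picard[OF contT that])
  have unif: "uniform_limit {0..T} (\<lambda>N t. \<Sum>j<N. picard n a h j k t) (x k) sequentially"
    if k: "k < n" for k T
  proof -
    have "\<exists>M. \<forall>t\<in>{0..T}. \<bar>h k t\<bar> \<le> M" if "k < n" for k
      using compact_imp_bounded[OF compact_continuous_image[OF contT[OF that]], of T]
      by (auto simp: bounded_iff)
    then obtain M where M: "\<bar>h k t\<bar> \<le> M k" if "k < n" "t \<in> {0..T}" for k t by metis
    define L where "L = (\<Sum>k<n. \<Sum>i<n. \<bar>a k i\<bar>)"
    define M' where "M' = (\<Sum>k<n. \<bar>M k\<bar>)"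
    have L: "(\<Sum>i<n. \<bar>a k i\<bar>) \<le> L" if "k < n" for k
      unfolding L_def using that by (intro member_le_sum) (auto intro: sum_nonneg)
    have "L \<ge> 0" "M' \<ge> 0" by (auto simp: L_def M'_def intro!: sum_nonneg)
    have M': "\<bar>h k t\<bar> \<le> M'" if "k < n" "t \<in> {0..T}" for k t
    proof -
      have "\<bar>M k\<bar> \<le> M'"
        unfolding M'_def using that by (intro member_le_sum) auto
      then show ?thesis using M[OF that] by simp
    qed
    have "norm (picard n a h j k t) \<le> M' * (inverse (fact j) * (L * T) ^ j)" if t: "t \<in> {0..T}" for j t
    proof -
      have "norm (picard n a h j k t) \<le> M' * (L * t) ^ j / fact j"
        using picard_bound[OF contT M' L k t] by simp
      also have "\<dots> \<le> M' * (L * T) ^ j / fact j"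
        using t \<open>L \<ge> 0\<close> \<open>M' \<ge> 0\<close> by (intro divide_right_mono mult_left_mono power_mono) auto
      finally show ?thesis by (simp add: divide_inverse mult_ac)
    qed
    moreover have "summable (\<lambda>j. M' * (inverse (fact j) * (L * T) ^ j))"
      by (intro summable_mult summable_exp)
    ultimately show ?thesis
      unfolding x_def by (rule Weierstrass_m_test)
  qed
  have contx: "continuous_on {0..T} (x k)" if "k < n" for k T
    by (rule uniform_limit_theorem[OF _ unif[OF that]])
      (auto intro!: always_eventually continuous_intros contp that)
  show ?thesis
  proof
    show "continuous_on {0..} (x k)" if "k < n" for k
      using contx[OF that] by (simp add: continuous_on_atLeast_iff)
    fix k t assume k: "k < n" and t: "(0::real) \<le> t"
    let ?F = "\<lambda>N s. \<Sum>i<n. a k i * (\<Sum>j<N. picard n a h j i s)"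
    have "uniform_limit {0..t} ?F (\<lambda>s. \<Sum>i<n. a k i * x i s) sequentially"
      by (intro uniform_limit_sum bounded_linear.uniform_limit[OF bounded_linear_mult_right] unif) auto
    then obtain I J where I: "\<And>N. (?F N has_integral I N) {0..t}"
      and J: "((\<lambda>s. \<Sum>i<n. a k i * x i s) has_integral J) {0..t}" and IJ: "I \<longlonglongrightarrow> J"
      by (rule uniform_limit_integral) (auto intro!: continuous_intros contp)
    \<comment> \<open>The integral operator maps the terms \<open>0\<close> to \<open>N - 1\<close>
      to the terms \<open>1\<close> to \<open>N\<close>; with \<open>h\<close> as term
      \<open>0\<close> this is the next partial sum, and both sides converge.\<close>
    have step: "(\<Sum>j<Suc N. picard n a h j k t) = h k t + I N" for N
    proof -
      have "(\<lambda>s. \<Sum>i<n. a k i * picard n a h j i s) integrable_on {0..t}" for j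
        by (intro integrable_continuous_real continuous_intros contp) auto
      then have "integral {0..t} (\<lambda>s. \<Sum>j<N. \<Sum>i<n. a k i * picard n a h j i s)
          = (\<Sum>j<N. picard n a h (Suc j) k t)"
        by (subst integral_sum) auto
      moreover have "(\<lambda>s. \<Sum>j<N. \<Sum>i<n. a k i * picard n a h j i s) = ?F N"
        by (subst sum.swap) (simp add: sum_distrib_left)
      ultimately have "I N = (\<Sum>j<N. picard n a h (Suc j) k t)"
        using I[of N] by (simp add: integral_unique del: picard.simps)
      then show ?thesis
        by (subst sum.lessThan_Suc_shift) (simp del: picard.simps(2))
    qed
    have "(\<lambda>N. \<Sum>j<N. picard n a h j k t) \<longlonglongrightarrow> x k t"
      using tendsto_uniform_limitI[OF unif[OF k, of t]] t by simp
    then have "(\<lambda>N. h k t + I N) \<longlonglongrightarrow> x k t"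
      unfolding step[symmetric] by (rule LIMSEQ_Suc)
    moreover have "(\<lambda>N. h k t + I N) \<longlonglongrightarrow> h k t + J"
      by (intro tendsto_intros IJ)
    ultimately have "x k t = h k t + J" by (rule LIMSEQ_unique)
    then show "x k t = h k t + integral {0..t} (\<lambda>s. \<Sum>i<n. a k i * x i s)"
      using J by (simp add: integral_unique)
  qed
qed

section \<open>Energy of vector-valued signals\<close>

lemma index_mult_mat_vec_sum:
  assumes "A \<in> carrier_mat nr nc" and "v \<in> carrier_vec nc" and "k < nr"
  shows "(A *\<^sub>v v) $ k = (\<Sum>i<nc. A $$ (k, i) * v $ i)"
proof -
  have "(A *\<^sub>v v) $ k = row A k \<bullet> v"
    using assms by (intro index_mult_mat_vec) auto
  also have "\<dots> = (\<Sum>i\<in>{0..<nc}. row A k $ i * v $ i)"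
    unfolding scalar_prod_def carrier_vecD[OF assms(2)] ..
  also have "\<dots> = (\<Sum>i<nc. A $$ (k, i) * v $ i)"
    using assms by (intro sum.cong) auto
  finally show ?thesis .
qed

lemma mult_mat_vec_in_carrier [intro]: "A \<in> carrier_mat nr nc \<Longrightarrow> A *\<^sub>v v \<in> carrier_vec nr"
  by (intro carrier_vecI) (simp add: carrier_matD(1))

lemma vec_norm2_nonneg [simp]: "0 \<le> vec_norm2 v"
  by (simp add: vec_norm2_def scalar_prod_def sum_nonneg)

lemma vec_norm2_square: "(vec_norm2 v)\<^sup>2 = v \<bullet> v"
  by (simp add: vec_norm2_def scalar_prod_def sum_nonneg)

lemma vec_norm2_square_sum:
  assumes "v \<in> carrier_vec d"
  shows "(vec_norm2 v)\<^sup>2 = (\<Sum>i<d. (v $ i)\<^sup>2)"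
  unfolding vec_norm2_square scalar_prod_def using assms by (simp add: power2_eq_square lessThan_atLeast0)

lemma abs_index_le_vec_norm2:
  assumes "i < dim_vec v"
  shows "\<bar>v $ i\<bar> \<le> vec_norm2 v"
proof -
  have "(v $ i)\<^sup>2 \<le> (\<Sum>i<dim_vec v. (v $ i)\<^sup>2)"
    using assms by (intro member_le_sum) auto
  also have "\<dots> = (vec_norm2 v)\<^sup>2"
    by (rule vec_norm2_square_sum[symmetric]) simp
  finally show ?thesis
    by (simp add: abs_le_square_iff[symmetric])
qed

lemma vec_norm2_zero [simp]: "vec_norm2 (0\<^sub>v d) = 0"
  by (simp add: vec_norm2_def)

lemma vec_norm2_eq_0:
  assumes "v \<in> carrier_vec d" and "vec_norm2 v = 0"
  shows "v = 0\<^sub>v d"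
proof (rule eq_vecI)
  fix i assume "i < dim_vec (0\<^sub>v d)"
  then show "v $ i = 0\<^sub>v d $ i"
    using abs_index_le_vec_norm2[of i v] assms by simp
qed (use assms in simp)

lemma vec_norm2_smult: "vec_norm2 (c \<cdot>\<^sub>v v) = \<bar>c\<bar> * vec_norm2 v"
proof -
  have "(c \<cdot>\<^sub>v v) \<bullet> (c \<cdot>\<^sub>v v) = c\<^sup>2 * (v \<bullet> v)"
    by (simp add: scalar_prod_def sum_distrib_left power2_eq_square mult_ac)
  then show ?thesis
    by (simp add: vec_norm2_def real_sqrt_mult)
qed

text \<open>After multiplication by \<open>\<theta> * (1 - \<theta>)\<close> the two sides differ by
  the square of \<open>(1 - \<theta>) * a - \<theta> * b\<close>. If the first summand is at most
  \<theta> times the sum in norm, these weights lead to the factor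
  \<open>1 / (1 - \<theta>)^2\<close> for squares, as the triangle inequality would.\<close>

lemma square_add_le_weighted:
  fixes a b \<theta> :: real
  assumes "0 < \<theta>" and "\<theta> < 1"
  shows "(a + b)\<^sup>2 \<le> a\<^sup>2 / \<theta> + b\<^sup>2 / (1 - \<theta>)"
proof -
  have "(1 - \<theta>) * a\<^sup>2 + \<theta> * b\<^sup>2 - \<theta> * (1 - \<theta>) * (a + b)\<^sup>2 = ((1 - \<theta>) * a - \<theta> * b)\<^sup>2"
    by (simp add: power2_eq_square algebra_simps)
  then have "(a + b)\<^sup>2 * (\<theta> * (1 - \<theta>)) \<le> a\<^sup>2 * (1 - \<theta>) + b\<^sup>2 * \<theta>"
    by (metis diff_ge_0_iff_ge mult.commute zero_le_power2)
  then have "(a + b)\<^sup>2 \<le> (a\<^sup>2 * (1 - \<theta>) + b\<^sup>2 * \<theta>) / (\<theta> * (1 - \<theta>))"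
    using assms by (subst pos_le_divide_eq) auto
  also have "\<dots> = a\<^sup>2 / \<theta> + b\<^sup>2 / (1 - \<theta>)"
    using assms by (subst add_frac_eq) auto
  finally show ?thesis .
qed

lemma vec_norm2_add_le_weighted:
  assumes "v \<in> carrier_vec d" and "w \<in> carrier_vec d" and "0 < \<theta>" and "\<theta> < 1"
  shows "(vec_norm2 (v + w))\<^sup>2 \<le> (vec_norm2 v)\<^sup>2 / \<theta> + (vec_norm2 w)\<^sup>2 / (1 - \<theta>)"
proof -
  have "(vec_norm2 (v + w))\<^sup>2 = (\<Sum>i<d. (v $ i + w $ i)\<^sup>2)"
    using assms by (subst vec_norm2_square_sum[of _ d]) auto
  also have "\<dots> \<le> (\<Sum>i<d. (v $ i)\<^sup>2 / \<theta> + (w $ i)\<^sup>2 / (1 - \<theta>))"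
    using assms by (intro sum_mono square_add_le_weighted)
  also have "\<dots> = (vec_norm2 v)\<^sup>2 / \<theta> + (vec_norm2 w)\<^sup>2 / (1 - \<theta>)"
    by (simp only: vec_norm2_square_sum[OF assms(1)] vec_norm2_square_sum[OF assms(2)] sum.distrib sum_divide_distrib)
  finally show ?thesis .
qed

text \<open>A crude bound from absolute row sums; the added \<open>1\<close> keeps the constant
  positive for a zero matrix, as \<open>\<eta> > 0\<close> requires.\<close>

lemma vec_norm2_mult_mat_bounded:
  assumes "A \<in> carrier_mat nr nc"
  obtains c where "c > 0"
    and "\<And>v. v \<in> carrier_vec nc \<Longrightarrow> vec_norm2 (A *\<^sub>v v) \<le> c * vec_norm2 v"
proof
  let ?c = "\<Sum>k<nr. (\<Sum>i<nc. \<bar>A $$ (k, i)\<bar>)\<^sup>2"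
  show "sqrt ?c + 1 > 0" by (simp add: add_nonneg_pos sum_nonneg)
  fix v :: "real Matrix.vec" assume v: "v \<in> carrier_vec nc"
  have "(vec_norm2 (A *\<^sub>v v))\<^sup>2 = (\<Sum>k<nr. ((A *\<^sub>v v) $ k)\<^sup>2)"
    using assms by (intro vec_norm2_square_sum) auto
  also have "\<dots> \<le> (\<Sum>k<nr. ((\<Sum>i<nc. \<bar>A $$ (k, i)\<bar>) * vec_norm2 v)\<^sup>2)"
  proof (intro sum_mono)
    fix k assume "k \<in> {..<nr}"
    then have "\<bar>(A *\<^sub>v v) $ k\<bar> = \<bar>\<Sum>i<nc. A $$ (k, i) * v $ i\<bar>"
      using index_mult_mat_vec_sum[OF assms v] by simp
    also have "\<dots> \<le> (\<Sum>i<nc. \<bar>A $$ (k, i)\<bar> * vec_norm2 v)"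
      using v abs_index_le_vec_norm2[of _ v]
      by (intro order_trans[OF sum_abs] sum_mono) (auto simp: abs_mult intro!: mult_left_mono)
    finally have "\<bar>(A *\<^sub>v v) $ k\<bar> \<le> (\<Sum>i<nc. \<bar>A $$ (k, i)\<bar>) * vec_norm2 v"
      by (simp only: sum_distrib_right)
    then show "((A *\<^sub>v v) $ k)\<^sup>2 \<le> ((\<Sum>i<nc. \<bar>A $$ (k, i)\<bar>) * vec_norm2 v)\<^sup>2"
      by (intro abs_le_square_iff[THEN iffD1]) linarith
  qed
  also have "\<dots> = (sqrt ?c * vec_norm2 v)\<^sup>2"
    by (simp add: power_mult_distrib sum_nonneg flip: sum_distrib_right)
  finally have "vec_norm2 (A *\<^sub>v v) \<le> sqrt ?c * vec_norm2 v"
    by (rule power2_le_imp_le) (simp add: sum_nonneg)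
  then show "vec_norm2 (A *\<^sub>v v) \<le> (sqrt ?c + 1) * vec_norm2 v"
    by (simp add: distrib_right add_increasing2)
qed

text \<open>\<open>spectral_norm\<close> is a real supremum, so it is an upper bound only once the
  set is known to be bounded above; the crude bound supplies this. Rescaling \<open>v\<close> to
  length \<open>1\<close> does the rest, and a vector of norm \<open>0\<close> is left to the crude
  bound as well.\<close>

lemma vec_norm2_mult_mat_le_spectral_norm:
  assumes A: "A \<in> carrier_mat nr nc" and v: "v \<in> carrier_vec nc"
  shows "vec_norm2 (A *\<^sub>v v) \<le> spectral_norm A * vec_norm2 v"
proof (cases "vec_norm2 v = 0")
  case True
  obtain c where c: "c > 0" "\<And>v. v \<in> carrier_vec nc \<Longrightarrow> vec_norm2 (A *\<^sub>v v) \<le> c * vec_norm2 v"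
    using vec_norm2_mult_mat_bounded[OF A] by blast
  from c(2)[OF v] True show ?thesis by simp
next
  case False
  then have pos: "vec_norm2 v > 0" by (simp add: less_le)
  let ?B = "{w \<in> carrier_vec (dim_col A). vec_norm2 w \<le> 1}"
  let ?w = "(1 / vec_norm2 v) \<cdot>\<^sub>v v"
  obtain c where c: "c > 0" "\<And>v. v \<in> carrier_vec nc \<Longrightarrow> vec_norm2 (A *\<^sub>v v) \<le> c * vec_norm2 v"
    using vec_norm2_mult_mat_bounded[OF A] by blast
  have "vec_norm2 (A *\<^sub>v w) \<le> c" if "w \<in> ?B" for w
  proof -
    have "vec_norm2 (A *\<^sub>v w) \<le> c * vec_norm2 w" using that A by (intro c(2)) simp
    also have "\<dots> \<le> c * 1" using that c(1) by (intro mult_left_mono) auto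
    finally show ?thesis by simp
  qed
  then have "bdd_above ((\<lambda>w. vec_norm2 (A *\<^sub>v w)) ` ?B)"
    by (rule bdd_aboveI2)
  moreover have "?w \<in> ?B"
    using A v pos by (auto simp: vec_norm2_smult)
  ultimately have "vec_norm2 (A *\<^sub>v ?w) \<le> spectral_norm A"
    unfolding spectral_norm_def by (intro cSUP_upper)
  moreover have "A *\<^sub>v ?w = (1 / vec_norm2 v) \<cdot>\<^sub>v (A *\<^sub>v v)"
    using A v by (rule mult_mat_vec)
  ultimately have "vec_norm2 (A *\<^sub>v v) / vec_norm2 v \<le> spectral_norm A"
    by (simp add: vec_norm2_smult)
  then show ?thesis
    using pos by (simp only: pos_divide_le_eq)
qed

section \<open>Energies of signals\<close>

text \<open>The squared norm behind \<open>L2_norm\<close>, kept as an integral in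
  \<open>ennreal\<close>: sums and constant factors pass through it without square roots or a case
  for infinity.\<close>

definition energy :: "real set \<Rightarrow> (real \<Rightarrow> real Matrix.vec) \<Rightarrow> ennreal" where
  "energy I f = (\<integral>\<^sup>+ t. ennreal ((vec_norm2 (f t))\<^sup>2) \<partial>lebesgue_on I)"

definition measurable_signal :: "nat \<Rightarrow> real set \<Rightarrow> (real \<Rightarrow> real Matrix.vec) \<Rightarrow> bool" where
  "measurable_signal d I f \<longleftrightarrow>
     (\<forall>t\<in>I. f t \<in> carrier_vec d) \<and> (\<forall>k<d. (\<lambda>t. f t $ k) \<in> borel_measurable (lebesgue_on I))"

lemma square_integrable_iff:
  "square_integrable d I f \<longleftrightarrow> measurable_signal d I f \<and> energy I f < \<infinity>"
  by (auto simp: square_integrable_def measurable_signal_def L2_norm_def energy_def Let_def)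
    (simp_all add: less_top)

lemma square_integrableD:
  assumes "square_integrable d I f"
  shows "measurable_signal d I f" and "energy I f < \<infinity>" and "t \<in> I \<Longrightarrow> f t \<in> carrier_vec d"
  using assms unfolding square_integrable_iff measurable_signal_def by blast+

text \<open>Transfers estimates between norms and energies. The infinite cases need care because
  \<open>0 * \<infinity> = 0\<close> in \<open>ennreal\<close>, which sets \<open>c = 0\<close>
  apart.\<close>

lemma L2_norm_le_iff:
  assumes "0 \<le> c"
  shows "L2_norm I f \<le> ennreal c * L2_norm J g \<longleftrightarrow> energy I f \<le> ennreal (c\<^sup>2) * energy J g"
proof -
  have L2: "L2_norm I f = (if energy I f = \<infinity> then \<infinity> else ennreal (sqrt (enn2real (energy I f))))" for I f
    by (simp add: L2_norm_def energy_def Let_def)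
  show ?thesis
  proof (cases "energy I f" rule: ennreal_cases; cases "energy J g" rule: ennreal_cases)
    fix a b assume ab: "energy I f = ennreal a" "0 \<le> a" "energy J g = ennreal b" "0 \<le> b"
    have "sqrt a \<le> c * sqrt b \<longleftrightarrow> sqrt a \<le> sqrt (c\<^sup>2 * b)"
      using assms by (simp add: real_sqrt_mult)
    then show ?thesis
      using ab assms by (simp add: L2 flip: ennreal_mult)
  next
    fix a assume "energy I f = ennreal a" "0 \<le> a" "energy J g = top_class.top"
    then show ?thesis using assms by (cases "c = 0") (auto simp: L2 ennreal_mult_top)
  next
    fix a assume "energy I f = top_class.top" "0 \<le> a" "energy J g = ennreal a"
    then show ?thesis using assms by (simp add: L2 top_unique flip: ennreal_mult)
  next
    assume "energy I f = top_class.top" "energy J g = top_class.top"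
    then show ?thesis using assms by (cases "c = 0") (auto simp: L2 ennreal_mult_top top_unique)
  qed
qed

lemma L2_norm_eq_0_iff: "L2_norm I f = 0 \<longleftrightarrow> energy I f = 0"
  using L2_norm_le_iff[of 0 I f I f] by simp

lemma measurable_signal_norm:
  assumes "measurable_signal d I f"
  shows "(\<lambda>t. (vec_norm2 (f t))\<^sup>2) \<in> borel_measurable (lebesgue_on I)"
proof -
  have "(\<lambda>t. \<Sum>i<d. (f t $ i)\<^sup>2) \<in> borel_measurable (lebesgue_on I)"
    using assms by (intro borel_measurable_sum borel_measurable_power) (auto simp: measurable_signal_def)
  then show ?thesis
    by (rule measurable_lebesgue_cong[THEN iffD1, rotated])
      (use assms in \<open>auto simp: measurable_signal_def vec_norm2_square_sum\<close>)
qed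

lemma measurable_signal_add:
  assumes "measurable_signal d I f" and "measurable_signal d I g"
  shows "measurable_signal d I (\<lambda>t. f t + g t)"
  unfolding measurable_signal_def
proof (intro conjI ballI allI impI)
  fix k assume k: "k < d"
  have "(\<lambda>t. f t $ k + g t $ k) \<in> borel_measurable (lebesgue_on I)"
    using assms k by (intro borel_measurable_add) (auto simp: measurable_signal_def)
  then show "(\<lambda>t. (f t + g t) $ k) \<in> borel_measurable (lebesgue_on I)"
    by (rule measurable_lebesgue_cong[THEN iffD1, rotated])
      (use assms k in \<open>auto simp: measurable_signal_def\<close>)
qed (use assms in \<open>auto simp: measurable_signal_def\<close>)

lemma measurable_signal_mult_mat:
  assumes f: "measurable_signal d I f" and A: "A \<in> carrier_mat e d"
  shows "measurable_signal e I (\<lambda>t. A *\<^sub>v f t)"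
  unfolding measurable_signal_def
proof (intro conjI ballI allI impI)
  fix k assume k: "k < e"
  have "(\<lambda>t. \<Sum>i<d. A $$ (k, i) * f t $ i) \<in> borel_measurable (lebesgue_on I)"
    using f by (intro borel_measurable_sum borel_measurable_times) (auto simp: measurable_signal_def)
  then show "(\<lambda>t. (A *\<^sub>v f t) $ k) \<in> borel_measurable (lebesgue_on I)"
    by (rule measurable_lebesgue_cong[THEN iffD1, rotated])
      (use f index_mult_mat_vec_sum[OF A _ k] in \<open>auto simp: measurable_signal_def\<close>)
qed (use A in \<open>auto simp: measurable_signal_def\<close>)

text \<open>Mode indices are natural numbers, so only countably many measurable pieces are
  glued.\<close>

lemma measurable_signal_switched:
  fixes \<sigma> :: "real \<Rightarrow> nat"
  assumes "\<sigma> \<in> measurable (lebesgue_on I) (count_space UNIV)"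
    and J: "\<And>t. t \<in> I \<Longrightarrow> \<sigma> t \<in> J"
    and f: "\<And>j. j \<in> J \<Longrightarrow> measurable_signal d I (f j)"
  shows "measurable_signal d I (\<lambda>t. f (\<sigma> t) t)"
  unfolding measurable_signal_def
proof (intro conjI ballI allI impI)
  fix k assume k: "k < d"
  \<comment> \<open>The default \<open>0\<close> outside \<open>J\<close> makes every member of the
    family measurable; on \<open>I\<close> the values of \<sigma> never reach it.\<close>
  have "(\<lambda>t. (\<lambda>j t. if j \<in> J then f j t $ k else 0) (\<sigma> t) t) \<in> borel_measurable (lebesgue_on I)"
  proof (rule measurable_compose_countable[where f = "\<lambda>j t. if j \<in> J then f j t $ k else 0"])
    fix j
    show "(\<lambda>t. if j \<in> J then f j t $ k else 0) \<in> borel_measurable (lebesgue_on I)"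
      using f[of j] k by (cases "j \<in> J") (auto simp: measurable_signal_def)
  qed (rule assms)
  then show "(\<lambda>t. f (\<sigma> t) t $ k) \<in> borel_measurable (lebesgue_on I)"
    by (rule measurable_lebesgue_cong[THEN iffD1, rotated]) (use J in auto)
qed (use assms in \<open>auto simp: measurable_signal_def\<close>)

lemma energy_mono:
  assumes "\<And>t. t \<in> I \<Longrightarrow> vec_norm2 (f t) \<le> c * vec_norm2 (g t)" and "measurable_signal d I g"
  shows "energy I f \<le> ennreal (c\<^sup>2) * energy I g"
proof -
  have "energy I f \<le> (\<integral>\<^sup>+ t. ennreal (c\<^sup>2) * ennreal ((vec_norm2 (g t))\<^sup>2) \<partial>lebesgue_on I)"
    unfolding energy_def
  proof (rule nn_integral_mono)
    fix t assume "t \<in> space (lebesgue_on I)"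
    then have "vec_norm2 (f t) \<le> c * vec_norm2 (g t)" using assms by simp
    then have "(vec_norm2 (f t))\<^sup>2 \<le> c\<^sup>2 * (vec_norm2 (g t))\<^sup>2"
      by (simp add: power_mono flip: power_mult_distrib)
    then show "ennreal ((vec_norm2 (f t))\<^sup>2) \<le> ennreal (c\<^sup>2) * ennreal ((vec_norm2 (g t))\<^sup>2)"
      by (simp flip: ennreal_mult)
  qed
  also have "\<dots> = ennreal (c\<^sup>2) * energy I g"
    unfolding energy_def using measurable_signal_norm[OF assms(2)] by (intro nn_integral_cmult) auto
  finally show ?thesis .
qed

lemma energy_add_le:
  assumes f: "measurable_signal d I f" and g: "measurable_signal d I g" and "0 < \<theta>" and "\<theta> < 1"
  shows "energy I (\<lambda>t. f t + g t) \<le> ennreal (1 / \<theta>) * energy I f + ennreal (1 / (1 - \<theta>)) * energy I g"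
proof -
  have "energy I (\<lambda>t. f t + g t) \<le>
      (\<integral>\<^sup>+ t. ennreal (1 / \<theta>) * ennreal ((vec_norm2 (f t))\<^sup>2)
        + ennreal (1 / (1 - \<theta>)) * ennreal ((vec_norm2 (g t))\<^sup>2) \<partial>lebesgue_on I)"
    unfolding energy_def
  proof (rule nn_integral_mono)
    fix t assume "t \<in> space (lebesgue_on I)"
    then have "(vec_norm2 (f t + g t))\<^sup>2 \<le> 1 / \<theta> * (vec_norm2 (f t))\<^sup>2 + 1 / (1 - \<theta>) * (vec_norm2 (g t))\<^sup>2"
      using vec_norm2_add_le_weighted[of "f t" d "g t" \<theta>] assms by (simp add: measurable_signal_def)
    then show "ennreal ((vec_norm2 (f t + g t))\<^sup>2) \<le> ennreal (1 / \<theta>) * ennreal ((vec_norm2 (f t))\<^sup>2)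
        + ennreal (1 / (1 - \<theta>)) * ennreal ((vec_norm2 (g t))\<^sup>2)"
      using assms by (simp flip: ennreal_mult ennreal_plus)
  qed
  also have "\<dots> = ennreal (1 / \<theta>) * energy I f + ennreal (1 / (1 - \<theta>)) * energy I g"
    unfolding energy_def using measurable_signal_norm[OF f] measurable_signal_norm[OF g]
    by (simp add: nn_integral_add nn_integral_cmult)
  finally show ?thesis .
qed

lemma square_integrable_add:
  assumes "square_integrable d I f" and "square_integrable d I g"
  shows "square_integrable d I (\<lambda>t. f t + g t)"
proof -
  have "energy I (\<lambda>t. f t + g t) \<le> ennreal (1 / (1/2)) * energy I f + ennreal (1 / (1 - 1/2)) * energy I g"
    using assms by (intro energy_add_le) (auto simp: square_integrable_iff)
  also have "\<dots> < \<infinity>"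
    using assms by (auto simp: square_integrable_iff ennreal_mult_less_top)
  finally show ?thesis
    using assms by (auto simp: square_integrable_iff intro: measurable_signal_add)
qed

text \<open>Finiteness of \<open>J\<close> gives one gain for all modes: the sum of the positive
  constants of the single matrices.\<close>

lemma square_integrable_switched_mult_mat:
  fixes \<sigma> :: "real \<Rightarrow> nat"
  assumes f: "square_integrable d I f" and A: "\<And>j. j \<in> J \<Longrightarrow> A j \<in> carrier_mat e d"
    and \<sigma>: "\<sigma> \<in> measurable (lebesgue_on I) (count_space UNIV)"
    and J: "\<And>t. t \<in> I \<Longrightarrow> \<sigma> t \<in> J" "finite J"
  shows "square_integrable e I (\<lambda>t. A (\<sigma> t) *\<^sub>v f t)"
proof -
  have "\<exists>c>0. \<forall>v\<in>carrier_vec d. vec_norm2 (A j *\<^sub>v v) \<le> c * vec_norm2 v" if "j \<in> J" for j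
    using vec_norm2_mult_mat_bounded[OF A[OF that]] by metis
  then obtain c where c: "\<forall>j\<in>J. c j > 0 \<and> (\<forall>v\<in>carrier_vec d. vec_norm2 (A j *\<^sub>v v) \<le> c j * vec_norm2 v)"
    by metis
  have "energy I (\<lambda>t. A (\<sigma> t) *\<^sub>v f t) \<le> ennreal ((\<Sum>j\<in>J. c j)\<^sup>2) * energy I f"
  proof (rule energy_mono)
    fix t assume t: "t \<in> I"
    have "vec_norm2 (A (\<sigma> t) *\<^sub>v f t) \<le> c (\<sigma> t) * vec_norm2 (f t)"
      using c J f t by (auto simp: square_integrable_def)
    also have "\<dots> \<le> (\<Sum>j\<in>J. c j) * vec_norm2 (f t)"
      using c J t by (intro mult_right_mono member_le_sum) (auto simp: less_imp_le)
    finally show "vec_norm2 (A (\<sigma> t) *\<^sub>v f t) \<le> (\<Sum>j\<in>J. c j) * vec_norm2 (f t)" .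
  qed (use f in \<open>auto simp: square_integrable_iff\<close>)
  also have "\<dots> < \<infinity>"
    using f by (auto simp: square_integrable_iff ennreal_mult_less_top)
  finally have "energy I (\<lambda>t. A (\<sigma> t) *\<^sub>v f t) < \<infinity>" .
  moreover have "measurable_signal e I (\<lambda>t. A (\<sigma> t) *\<^sub>v f t)"
  proof (rule measurable_signal_switched[OF \<sigma> J(1), where f = "\<lambda>j t. A j *\<^sub>v f t"])
    fix j assume "j \<in> J"
    then show "measurable_signal e I (\<lambda>t. A j *\<^sub>v f t)"
      by (rule measurable_signal_mult_mat[OF square_integrableD(1)[OF f] A])
  qed
  ultimately show ?thesis
    by (simp add: square_integrable_iff)
qed

lemma square_integrable_mult_mat:
  assumes "square_integrable d I f" and "A \<in> carrier_mat e d"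
  shows "square_integrable e I (\<lambda>t. A *\<^sub>v f t)"
  using square_integrable_switched_mult_mat[OF assms(1), of "{0}" "\<lambda>_. A" e "\<lambda>_. 0"] assms(2) by simp

lemma square_integrable_cong:
  assumes "square_integrable d I f" and eq: "\<And>t. t \<in> I \<Longrightarrow> f t = g t"
  shows "square_integrable d I g"
proof -
  have "energy I f = energy I g"
    unfolding energy_def using eq by (intro nn_integral_cong) simp
  moreover have "measurable_signal d I g"
    unfolding measurable_signal_def
  proof (intro conjI ballI allI impI)
    fix k assume "k < d"
    then have "(\<lambda>t. f t $ k) \<in> borel_measurable (lebesgue_on I)"
      using assms(1) by (simp add: square_integrable_def)
    then show "(\<lambda>t. g t $ k) \<in> borel_measurable (lebesgue_on I)"
      by (rule measurable_lebesgue_cong[THEN iffD1, rotated]) (simp add: eq)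
  qed (use assms(1) eq in \<open>force simp: square_integrable_def\<close>)
  ultimately show ?thesis using assms(1) by (simp add: square_integrable_iff)
qed

lemma square_integrable_diff:
  assumes "square_integrable d I f" and "square_integrable d I g"
  shows "square_integrable d I (\<lambda>t. f t - g t)"
proof (rule square_integrable_cong)
  show "square_integrable d I (\<lambda>t. f t + (- 1\<^sub>m d) *\<^sub>v g t)"
    using assms by (intro square_integrable_add square_integrable_mult_mat) auto
  fix t assume "t \<in> I"
  then have "f t \<in> carrier_vec d" "g t \<in> carrier_vec d"
    using assms by (simp_all add: square_integrable_def)
  then show "f t + (- 1\<^sub>m d) *\<^sub>v g t = f t - g t"
    by (simp add: minus_add_uminus_vec[of "f t" d])
qed

lemma square_integrable_continuous:
  assumes "\<And>t. t \<in> {0..T} \<Longrightarrow> f t \<in> carrier_vec d"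
    and cont: "\<And>k. k < d \<Longrightarrow> continuous_on {0..T} (\<lambda>t. f t $ k)"
  shows "square_integrable d {0..T} f"
proof -
  have "continuous_on {0..T} (\<lambda>t. \<Sum>i<d. (f t $ i)\<^sup>2)"
    using cont by (intro continuous_intros) auto
  then have "continuous_on {0..T} (\<lambda>t. (vec_norm2 (f t))\<^sup>2)"
    by (rule continuous_on_eq) (metis assms(1) vec_norm2_square_sum)
  then have "integrable (lebesgue_on {0..T}) (\<lambda>t. (vec_norm2 (f t))\<^sup>2)"
    by (rule continuous_imp_integrable_real)
  then have "energy {0..T} f < \<infinity>"
    by (simp add: integrable_iff_bounded energy_def)
  moreover have "measurable_signal d {0..T} f"
    using assms by (auto simp: measurable_signal_def intro!: continuous_imp_measurable_on_sets_lebesgue)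
  ultimately show ?thesis by (simp add: square_integrable_iff)
qed

text \<open>On a bounded interval the constant \<open>1\<close> is integrable, and
  \<open>r <= 1 + r^2\<close> follows from \<open>(r - 1/2)^2 >= 0\<close>. This makes the integral
  equation meaningful for square-integrable inputs.\<close>

lemma square_integrable_imp_integrable:
  assumes "square_integrable d {0..T} f" and "k < d"
  shows "integrable (lebesgue_on {0..T}) (\<lambda>t. f t $ k)"
proof (rule Bochner_Integration.integrable_bound)
  have "integrable (lebesgue_on {0..T}) (\<lambda>t. (vec_norm2 (f t))\<^sup>2)"
    using assms measurable_signal_norm[of d "{0..T}" f]
    by (auto simp: integrable_iff_bounded square_integrable_iff energy_def)
  moreover have "integrable (lebesgue_on {0..T}) (\<lambda>t. 1::real)"
    by (rule continuous_imp_integrable_real) auto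
  ultimately show "integrable (lebesgue_on {0..T}) (\<lambda>t. 1 + (vec_norm2 (f t))\<^sup>2)"
    by (rule Bochner_Integration.integrable_add[rotated])
  show "(\<lambda>t. f t $ k) \<in> borel_measurable (lebesgue_on {0..T})"
    using assms by (auto simp: square_integrable_def)
  show "AE t in lebesgue_on {0..T}. norm (f t $ k) \<le> norm (1 + (vec_norm2 (f t))\<^sup>2)"
  proof (rule AE_I2)
    fix t assume "t \<in> space (lebesgue_on {0..T})"
    then have "dim_vec (f t) = d"
      using square_integrableD(3)[OF assms(1)] by simp
    then have "\<bar>f t $ k\<bar> \<le> vec_norm2 (f t)"
      using assms(2) by (intro abs_index_le_vec_norm2) simp
    also have "\<dots> \<le> 1 + (vec_norm2 (f t))\<^sup>2"
      using zero_le_power2[of "vec_norm2 (f t) - 1/2"] by (simp add: power2_eq_square algebra_simps)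
    finally show "norm (f t $ k) \<le> norm (1 + (vec_norm2 (f t))\<^sup>2)" by simp
  qed
qed

section \<open>Restriction and extension of signals in time\<close>

lemma energy_restrict:
  assumes "J \<subseteq> I" and "J \<in> sets lebesgue" and "I \<in> sets lebesgue"
  shows "energy J f \<le> energy I f"
  unfolding energy_def using assms
  by (auto simp: nn_integral_restrict_space indicator_def intro!: nn_integral_mono)

lemma square_integrable_subset:
  assumes "square_integrable d I f" and "J \<subseteq> I" and "J \<in> sets lebesgue" and "I \<in> sets lebesgue"
  shows "square_integrable d J f"
  using assms energy_restrict[of J I f]
  by (auto simp: square_integrable_iff measurable_signal_def intro: measurable_restrict_mono order_le_less_trans)

text \<open>The dimension \<open>d\<close> is an argument because zero vectors carry their
  length.\<close>

definition zero_extend :: "nat \<Rightarrow> real \<Rightarrow> (real \<Rightarrow> real Matrix.vec) \<Rightarrow> real \<Rightarrow> real Matrix.vec" where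
  "zero_extend d T v t = (if t \<in> {0..T} then v t else 0\<^sub>v d)"

lemma energy_zero_extend: "energy {0..} (zero_extend d T v) = energy {0..T} v"
  unfolding energy_def
  by (simp add: nn_integral_restrict_space)
    (auto simp: zero_extend_def indicator_def intro!: nn_integral_cong)

lemma square_integrable_zero_extend:
  assumes "square_integrable d {0..T} v"
  shows "square_integrable d {0..} (zero_extend d T v)"
proof -
  have "(\<lambda>t. zero_extend d T v t $ k) \<in> borel_measurable (lebesgue_on {0..})" if "k < d" for k
  proof -
    have "(\<lambda>t. if t \<in> {0..T} then v t $ k else 0) \<in> borel_measurable (lebesgue_on {0..})"
      using assms that by (subst borel_measurable_if_lebesgue_on) (auto simp: square_integrable_def)
    then show ?thesis
      using that by (simp add: zero_extend_def if_distrib[of "\<lambda>w. w $ k"] cong: if_cong)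
  qed
  then show ?thesis
    using assms by (auto simp: square_integrable_iff energy_zero_extend measurable_signal_def)
      (auto simp: zero_extend_def)
qed

text \<open>The half-line is covered by finitely many sets on which \<sigma> is constant. Since its
  values at the switching times are arbitrary, these times enter as singletons.\<close>

lemma switching_signal_measurable:
  assumes "switching_signal l \<sigma>"
  shows "\<sigma> \<in> measurable (lebesgue_on {0..}) (count_space UNIV)"
proof -
  obtain s :: nat and tau :: "nat \<Rightarrow> real" where tau0: "tau 0 = 0"
    and pieces: "\<And>k. k < s \<Longrightarrow> \<sigma> constant_on {tau k<..<tau (Suc k)}" "\<sigma> constant_on {tau s<..}"
    using assms unfolding switching_signal_def by blast
  define C where "C = (\<lambda>k. {tau k}) ` {..s} \<union> (\<lambda>k. {tau k<..<tau (Suc k)}) ` {..<s} \<union> {{tau s<..}}"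
  have cover: "\<exists>X\<in>C. t \<in> X" if "0 \<le> t" for t
  proof -
    \<comment> \<open>The last switching time not after \<open>t\<close>; one exists because
      \<open>tau 0 = 0\<close>.\<close>
    define k where "k = Max {k. k \<le> s \<and> tau k \<le> t}"
    have fin: "finite {k. k \<le> s \<and> tau k \<le> t}" by simp
    have "k \<in> {k. k \<le> s \<and> tau k \<le> t}"
      unfolding k_def using tau0 that by (intro Max_in[OF fin]) auto
    moreover have "t < tau (Suc k)" if "k < s"
      using that Max_ge[OF fin, of "Suc k"] unfolding k_def[symmetric] by force
    ultimately consider "t = tau k" "k \<le> s" | "k < s" "t \<in> {tau k<..<tau (Suc k)}" | "t > tau s"
      by fastforce
    then show ?thesis
    proof cases
      case 1
      then show ?thesis unfolding C_def by (intro bexI[of _ "{tau k}"]) simp_all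
    next
      case 2
      then show ?thesis unfolding C_def by (intro bexI[of _ "{tau k<..<tau (Suc k)}"]) simp_all
    next
      case 3
      then show ?thesis unfolding C_def by (intro bexI[of _ "{tau s<..}"]) simp_all
    qed
  qed
  have const: "\<sigma> constant_on X" if "X \<in> C" for X
    using that pieces by (auto simp: C_def constant_on_def)
  show ?thesis
  proof (rule measurable_piecewise_restrict[of "(\<lambda>X. X \<inter> {0..}) ` C"])
    show "countable ((\<lambda>X. X \<inter> {0..}) ` C)" by (auto simp: C_def)
    show "space (lebesgue_on {0..}) \<subseteq> \<Union> ((\<lambda>X. X \<inter> {0..}) ` C)" using cover by auto
    fix \<Omega> assume "\<Omega> \<in> (\<lambda>X. X \<inter> {0..}) ` C"
    then obtain X where X: "X \<in> C" "\<Omega> = X \<inter> {0..}" by auto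
    have "X \<in> sets lebesgue" using X(1) by (auto simp: C_def)
    then show "\<Omega> \<inter> space (lebesgue_on {0..}) \<in> sets (lebesgue_on {0..})"
      using X by (auto simp: sets_restrict_space_iff)
    obtain c where "\<And>t. t \<in> X \<Longrightarrow> \<sigma> t = c" using const[OF X(1)] by (auto simp: constant_on_def)
    then show "\<sigma> \<in> measurable (restrict_space (lebesgue_on {0..}) \<Omega>) (count_space UNIV)"
      using X by (subst measurable_cong[where g = "\<lambda>_. c"]) (auto simp: space_restrict_space)
  qed
qed

section \<open>Trajectories and truncated gain bounds\<close>

lemma trajectoryD:
  assumes "trajectory n I S u x y" and "t \<in> I"
  shows "x t \<in> carrier_vec n"
    and "k < n \<Longrightarrow> integrable (lebesgue_on {0..t}) (\<lambda>s. (sysA (S s) *\<^sub>v x s + sysB (S s) *\<^sub>v u s) $ k)"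
    and "k < n \<Longrightarrow> x t $ k =
      integral\<^sup>L (lebesgue_on {0..t}) (\<lambda>s. (sysA (S s) *\<^sub>v x s + sysB (S s) *\<^sub>v u s) $ k)"
    and "y t = sysC (S t) *\<^sub>v x t + sysD (S t) *\<^sub>v u t"
  using assms unfolding trajectory_def by blast+

lemma trajectory_subset:
  assumes "trajectory n I S u x y" and "J \<subseteq> I"
  shows "trajectory n J S u x y"
  using assms unfolding trajectory_def by blast

text \<open>The integral equation involves system and input only through the right-hand side along
  \<open>x\<close>, so another pair with the same right-hand side has the same state. This carries
  trajectories between the switched system and the envelope.\<close>

lemma trajectory_cong:
  assumes tr: "trajectory n I S u x y"
    and I: "\<And>t. t \<in> I \<Longrightarrow> {0..t} \<subseteq> I"
    and rhs: "\<And>t. t \<in> I \<Longrightarrow>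
      sysA (S t) *\<^sub>v x t + sysB (S t) *\<^sub>v u t = sysA (S' t) *\<^sub>v x t + sysB (S' t) *\<^sub>v u' t"
    and out: "\<And>t. t \<in> I \<Longrightarrow> y' t = sysC (S' t) *\<^sub>v x t + sysD (S' t) *\<^sub>v u' t"
  shows "trajectory n I S' u' x y'"
  unfolding trajectory_def
proof (intro conjI ballI allI impI)
  fix t k assume t: "t \<in> I" and k: "k < n"
  have eq: "(sysA (S s) *\<^sub>v x s + sysB (S s) *\<^sub>v u s) $ k = (sysA (S' s) *\<^sub>v x s + sysB (S' s) *\<^sub>v u' s) $ k"
    if "s \<in> space (lebesgue_on {0..t})" for s
    using rhs[of s] I[OF t] that by auto
  show "integrable (lebesgue_on {0..t}) (\<lambda>s. (sysA (S' s) *\<^sub>v x s + sysB (S' s) *\<^sub>v u' s) $ k)"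
    by (rule iffD1[OF Bochner_Integration.integrable_cong[OF refl] trajectoryD(2)[OF tr t k]]) (rule eq)
  show "x t $ k = integral\<^sup>L (lebesgue_on {0..t}) (\<lambda>s. (sysA (S' s) *\<^sub>v x s + sysB (S' s) *\<^sub>v u' s) $ k)"
    unfolding trajectoryD(3)[OF tr t k] by (rule Bochner_Integration.integral_cong[OF refl]) (rule eq)
qed (use out trajectoryD(1)[OF tr] in auto)

text \<open>Superposition, valid because one and the same linear system governs both trajectories;
  it isolates the response to the difference of two inputs.\<close>

lemma trajectory_diff:
  assumes P: "lti_dims n m p P"
    and tr: "trajectory n I (\<lambda>_. P) u x y" and tr': "trajectory n I (\<lambda>_. P) u' x' y'"
    and I: "\<And>t. t \<in> I \<Longrightarrow> {0..t} \<subseteq> I"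
    and u: "\<And>t. t \<in> I \<Longrightarrow> u t \<in> carrier_vec m" and u': "\<And>t. t \<in> I \<Longrightarrow> u' t \<in> carrier_vec m"
  shows "trajectory n I (\<lambda>_. P) (\<lambda>t. u t - u' t) (\<lambda>t. x t - x' t) (\<lambda>t. y t - y' t)"
  unfolding trajectory_def
proof (intro conjI ballI allI impI)
  have lin: "E *\<^sub>v (x t - x' t) + F *\<^sub>v (u t - u' t) = (E *\<^sub>v x t + F *\<^sub>v u t) - (E *\<^sub>v x' t + F *\<^sub>v u' t)"
    if t: "t \<in> I" and EF: "E \<in> carrier_mat q n" "F \<in> carrier_mat q m" for E F q t
  proof -
    note c = trajectoryD(1)[OF tr t] trajectoryD(1)[OF tr' t] u[OF t] u'[OF t]
    show ?thesis
      unfolding mult_minus_distrib_mat_vec[OF EF(1) c(1,2)] mult_minus_distrib_mat_vec[OF EF(2) c(3,4)]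
      using EF by (intro eq_vecI) auto
  qed
  have dims: "sysA P \<in> carrier_mat n n" "sysB P \<in> carrier_mat n m"
    "sysC P \<in> carrier_mat p n" "sysD P \<in> carrier_mat p m"
    using P by (auto simp: lti_dims_def)
  fix t assume t: "t \<in> I"
  show "x t - x' t \<in> carrier_vec n"
    using trajectoryD(1)[OF tr t] trajectoryD(1)[OF tr' t] by simp
  show "y t - y' t = sysC P *\<^sub>v (x t - x' t) + sysD P *\<^sub>v (u t - u' t)"
    using trajectoryD(4)[OF tr t] trajectoryD(4)[OF tr' t] lin[OF t dims(3,4)] by simp
  fix k assume k: "k < n"
  let ?f = "\<lambda>s. (sysA P *\<^sub>v x s + sysB P *\<^sub>v u s) $ k"
  let ?f' = "\<lambda>s. (sysA P *\<^sub>v x' s + sysB P *\<^sub>v u' s) $ k"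
  let ?g = "\<lambda>s. (sysA P *\<^sub>v (x s - x' s) + sysB P *\<^sub>v (u s - u' s)) $ k"
  have eq: "?f s - ?f' s = ?g s" if "s \<in> space (lebesgue_on {0..t})" for s
  proof -
    have "s \<in> I" using that I[OF t] by auto
    from lin[OF this dims(1,2)] show ?thesis using dims k by simp
  qed
  note int = trajectoryD(2)[OF tr t k] trajectoryD(2)[OF tr' t k]
  show "integrable (lebesgue_on {0..t}) ?g"
    by (rule iffD1[OF Bochner_Integration.integrable_cong[OF refl] Bochner_Integration.integrable_diff[OF int]]) (rule eq)
  have "(x t - x' t) $ k = x t $ k - x' t $ k"
    using trajectoryD(1)[OF tr' t] k by simp
  also have "\<dots> = integral\<^sup>L (lebesgue_on {0..t}) (\<lambda>s. ?f s - ?f' s)"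
    using trajectoryD(3)[OF tr t k] trajectoryD(3)[OF tr' t k] Bochner_Integration.integral_diff[OF int] by simp
  also have "\<dots> = integral\<^sup>L (lebesgue_on {0..t}) ?g"
    by (rule Bochner_Integration.integral_cong[OF refl]) (rule eq)
  finally show "(x t - x' t) $ k = integral\<^sup>L (lebesgue_on {0..t}) ?g" .
qed

text \<open>Where the inputs agree they cancel in the difference of the right-hand sides, leaving a
  homogeneous inequality for Gronwall's argument. Finitely many modes give a common constant
  \<open>L\<close>.\<close>

lemma trajectory_unique:
  assumes dims: "\<And>t. t \<in> {0..T} \<Longrightarrow> lti_dims n m p (S t)" and fin: "finite (S ` {0..T})"
    and tr: "trajectory n {0..T} S u x y" and tr': "trajectory n {0..T} S u' x' y'"
    and ae: "AE t in lebesgue_on {0..T}. u t = u' t" and t: "t \<in> {0..T}"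
  shows "x t = x' t"
proof (rule eq_vecI)
  have T: "T \<in> {0..T}" using t by simp
  let ?f = "\<lambda>k s. (sysA (S s) *\<^sub>v x s + sysB (S s) *\<^sub>v u s) $ k"
  let ?f' = "\<lambda>k s. (sysA (S s) *\<^sub>v x' s + sysB (S s) *\<^sub>v u' s) $ k"
  \<comment> \<open>Summing all absolute entries of all modes dominates every row sum of every
    active matrix.\<close>
  define L where "L = (\<Sum>P\<in>S ` {0..T}. \<Sum>k<n. \<Sum>i<n. \<bar>sysA P $$ (k, i)\<bar>)"
  note int = trajectoryD(2)[OF tr] trajectoryD(2)[OF tr']
  have "x t $ k - x' t $ k = 0" if k: "k < n" for k
  proof (rule gronwall_zero[where z = "\<lambda>k t. x t $ k - x' t $ k" and g = "\<lambda>k s. ?f k s - ?f' k s" and L = L])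
    show "integrable (lebesgue_on {0..T}) (\<lambda>s. ?f k s - ?f' k s)" if "k < n" for k
      by (intro Bochner_Integration.integrable_diff int T that)
    show "x t $ k - x' t $ k = integral\<^sup>L (lebesgue_on {0..t}) (\<lambda>s. ?f k s - ?f' k s)"
      if "k < n" "t \<in> {0..T}" for k t
      using trajectoryD(3)[OF tr that(2,1)] trajectoryD(3)[OF tr' that(2,1)]
        Bochner_Integration.integral_diff[OF int[OF that(2,1)]] by simp
    fix k assume k: "k < n"
    show "AE s in lebesgue_on {0..T}. \<forall>B. (\<forall>i<n. \<bar>x s $ i - x' s $ i\<bar> \<le> B) \<longrightarrow> \<bar>?f k s - ?f' k s\<bar> \<le> L * B"
    proof (rule lebesgue_on_mono[OF ae], intro allI impI)
      fix s B assume us: "u s = u' s" and s: "s \<in> {0..T}" and B: "\<forall>i<n. \<bar>x s $ i - x' s $ i\<bar> \<le> B"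
      have A: "sysA (S s) \<in> carrier_mat n n" and B': "sysB (S s) \<in> carrier_mat n m"
        using dims[OF s] by (auto simp: lti_dims_def)
      have "0 \<le> B" using B k abs_ge_zero order_trans by blast
      have "?f k s - ?f' k s = (sysA (S s) *\<^sub>v x s) $ k - (sysA (S s) *\<^sub>v x' s) $ k"
        using us B' k by simp
      also have "\<dots> = (\<Sum>i<n. sysA (S s) $$ (k, i) * (x s $ i - x' s $ i))"
        using index_mult_mat_vec_sum[OF A trajectoryD(1)[OF tr s] k]
          index_mult_mat_vec_sum[OF A trajectoryD(1)[OF tr' s] k]
        by (simp add: right_diff_distrib sum_subtractf)
      finally have "\<bar>?f k s - ?f' k s\<bar> \<le> (\<Sum>i<n. \<bar>sysA (S s) $$ (k, i) * (x s $ i - x' s $ i)\<bar>)"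
        by (simp only: sum_abs)
      also have "\<dots> \<le> (\<Sum>i<n. \<bar>sysA (S s) $$ (k, i)\<bar> * B)"
        unfolding abs_mult using B by (intro sum_mono mult_left_mono) auto
      also have "\<dots> = (\<Sum>i<n. \<bar>sysA (S s) $$ (k, i)\<bar>) * B"
        by (rule sum_distrib_right[symmetric])
      also have "(\<Sum>i<n. \<bar>sysA (S s) $$ (k, i)\<bar>) \<le> (\<Sum>k<n. \<Sum>i<n. \<bar>sysA (S s) $$ (k, i)\<bar>)"
        using k by (intro member_le_sum[where f = "\<lambda>k. \<Sum>i<n. \<bar>sysA (S s) $$ (k, i)\<bar>"]) (auto intro: sum_nonneg)
      also have "\<dots> \<le> L"
        unfolding L_def using s fin
        by (intro member_le_sum[where f = "\<lambda>P. \<Sum>k<n. \<Sum>i<n. \<bar>sysA P $$ (k, i)\<bar>"]) (auto intro!: sum_nonneg)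
      finally show "\<bar>?f k s - ?f' k s\<bar> \<le> L * B"
        using \<open>0 \<le> B\<close> by (simp add: mult_right_mono)
    qed
  qed (use k t in auto)
  then show "x t $ k = x' t $ k" if "k < dim_vec (x' t)" for k
    using that trajectoryD(1)[OF tr' t] by simp
  show "dim_vec (x t) = dim_vec (x' t)"
    using trajectoryD(1)[OF tr t] trajectoryD(1)[OF tr' t] by simp
qed

lemma trajectory_continuous:
  assumes tr: "trajectory n {0..T} S u x y" and k: "k < n"
  shows "continuous_on {0..T} (\<lambda>t. x t $ k)"
proof (cases "0 \<le> T")
  case True
  let ?f = "\<lambda>s. (sysA (S s) *\<^sub>v x s + sysB (S s) *\<^sub>v u s) $ k"
  have int: "integrable (lebesgue_on {0..t}) ?f" if "t \<in> {0..T}" for t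
    by (rule trajectoryD(2)[OF tr that k])
  have "?f integrable_on {0..T}"
    using int[of T] True by (intro integrable_on_lebesgue_on) auto
  then have "continuous_on {0..T} (\<lambda>t. integral {0..t} ?f)"
    by (rule indefinite_integral_continuous_1)
  moreover have "integral {0..t} ?f = x t $ k" if "t \<in> {0..T}" for t
    using trajectoryD(3)[OF tr that k] lebesgue_integral_eq_integral[OF int[OF that]] by simp
  ultimately show ?thesis
    by (rule continuous_on_eq)
qed simp

text \<open>A continuous state has finite energy on a bounded interval; the finiteness of all
  energies in the feedback loop starts here.\<close>

lemma square_integrable_state:
  assumes "trajectory n {0..T} S u x y"
  shows "square_integrable n {0..T} x"
  using trajectoryD(1)[OF assms] trajectory_continuous[OF assms] by (rule square_integrable_continuous)

lemma square_integrable_output: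
  assumes P: "lti_dims n m p P" and tr: "trajectory n {0..T} (\<lambda>_. P) u x y"
    and u: "square_integrable m {0..T} u"
  shows "square_integrable p {0..T} y"
proof (rule square_integrable_cong)
  show "square_integrable p {0..T} (\<lambda>t. sysC P *\<^sub>v x t + sysD P *\<^sub>v u t)"
    using P by (intro square_integrable_add square_integrable_mult_mat[OF square_integrable_state[OF tr]]
        square_integrable_mult_mat[OF u]) (auto simp: lti_dims_def)
qed (rule trajectoryD(4)[OF tr, symmetric])

text \<open>The input enters through its integral, which leaves a Volterra equation with continuous
  inhomogeneity; the Lebesgue and the gauge integral agree on the integrands.\<close>

lemma trajectory_exists:
  assumes P: "lti_dims n m p P" and v: "\<And>T. square_integrable m {0..T} v"
  obtains x y where "trajectory n {0..} (\<lambda>_. P) v x y"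
proof -
  have A: "sysA P \<in> carrier_mat n n" and B: "sysB P \<in> carrier_mat n m"
    using P by (auto simp: lti_dims_def)
  have intB: "integrable (lebesgue_on {0..T}) (\<lambda>s. (sysB P *\<^sub>v v s) $ k)" if "k < n" for k T
    by (rule square_integrable_imp_integrable[OF square_integrable_mult_mat[OF v B] that])
  define h where "h k t = integral {0..t} (\<lambda>s. (sysB P *\<^sub>v v s) $ k)" for k t
  have "continuous_on {0..} (h k)" if "k < n" for k
    unfolding continuous_on_atLeast_iff h_def
    by (intro allI indefinite_integral_continuous_1 integrable_on_lebesgue_on[OF intB[OF that]]) simp
  from linear_volterra_solution[of n h "\<lambda>k i. sysA P $$ (k, i)", OF this]
  obtain x where cont: "\<And>k. k < n \<Longrightarrow> continuous_on {0..} (x k)"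
    and x: "\<And>k t. k < n \<Longrightarrow> 0 \<le> t \<Longrightarrow>
      x k t = h k t + integral {0..t} (\<lambda>s. \<Sum>i<n. sysA P $$ (k, i) * x i s)"
    by metis
  define X where "X t = Matrix.vec n (\<lambda>k. x k t)" for t
  have AX: "(sysA P *\<^sub>v X s) $ k = (\<Sum>i<n. sysA P $$ (k, i) * x i s)" if "k < n" for k s
    using index_mult_mat_vec_sum[OF A _ that, of "X s"] by (simp add: X_def)
  have "trajectory n {0..} (\<lambda>_. P) v X (\<lambda>t. sysC P *\<^sub>v X t + sysD P *\<^sub>v v t)"
    unfolding trajectory_def
  proof (intro conjI ballI allI impI)
    fix t :: real and k assume t: "t \<in> {0..}" and k: "k < n"
    have eq: "(sysA P *\<^sub>v X s + sysB P *\<^sub>v v s) $ k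
        = (\<Sum>i<n. sysA P $$ (k, i) * x i s) + (sysB P *\<^sub>v v s) $ k" for s
      using B k by (simp add: AX[OF k])
    have intA: "integrable (lebesgue_on {0..t}) (\<lambda>s. \<Sum>i<n. sysA P $$ (k, i) * x i s)"
      by (intro continuous_imp_integrable_real continuous_intros continuous_on_subset[OF cont]) auto
    show "integrable (lebesgue_on {0..t}) (\<lambda>s. (sysA P *\<^sub>v X s + sysB P *\<^sub>v v s) $ k)"
      unfolding eq by (intro Bochner_Integration.integrable_add intA intB k)
    have "X t $ k = h k t + integral {0..t} (\<lambda>s. \<Sum>i<n. sysA P $$ (k, i) * x i s)"
      using x[OF k, of t] t k by (simp add: X_def)
    also have "\<dots> = integral\<^sup>L (lebesgue_on {0..t}) (\<lambda>s. (sysA P *\<^sub>v X s + sysB P *\<^sub>v v s) $ k)"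
      unfolding eq Bochner_Integration.integral_add[OF intA intB[OF k]] h_def
      using lebesgue_integral_eq_integral[OF intA] lebesgue_integral_eq_integral[OF intB[OF k], of t] by simp
    finally show "X t $ k = integral\<^sup>L (lebesgue_on {0..t}) (\<lambda>s. (sysA P *\<^sub>v X s + sysB P *\<^sub>v v s) $ k)" .
  qed (simp_all add: X_def)
  then show ?thesis by (rule that)
qed

text \<open>Causality: up to time \<open>T\<close> the extended input is \<open>v\<close>, so the
  solution on the half-line also solves the equation on \<open>{0..T}\<close>, and uniqueness
  identifies its output with any given one.\<close>

lemma trajectory_zero_extend:
  assumes P: "lti_dims n m p P" and v: "square_integrable m {0..T} v"
  obtains x' y' where "trajectory n {0..} (\<lambda>_. P) (zero_extend m T v) x' y'"
    and "trajectory n {0..T} (\<lambda>_. P) v x' y'"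
    and "\<And>x y t. trajectory n {0..T} (\<lambda>_. P) v x y \<Longrightarrow> t \<in> {0..T} \<Longrightarrow> y' t = y t"
proof -
  have "square_integrable m {0..T'} (zero_extend m T v)" for T'
    by (rule square_integrable_subset[OF square_integrable_zero_extend[OF v]]) auto
  then obtain x' y' where tr: "trajectory n {0..} (\<lambda>_. P) (zero_extend m T v) x' y'"
    using trajectory_exists[OF P] by blast
  have tr': "trajectory n {0..T} (\<lambda>_. P) v x' y'"
    by (rule trajectory_cong[OF trajectory_subset[OF tr]])
      (auto simp: zero_extend_def trajectoryD(4)[OF tr])
  have "y' t = y t" if "trajectory n {0..T} (\<lambda>_. P) v x y" "t \<in> {0..T}" for x y t
  proof -
    have "x' t = x t"
      by (rule trajectory_unique[OF P _ tr' that(1) _ that(2)]) (auto simp: image_constant_conv)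
    then show ?thesis
      using trajectoryD(4)[OF tr' that(2)] trajectoryD(4)[OF that] by simp
  qed
  with tr tr' show ?thesis by (rule that)
qed

text \<open>Inputs of zero norm are excluded from the supremum in \<open>induced_norm\<close>, so no
  gain bound covers them. By uniqueness their state is zero, and the output vanishes wherever the
  input does.\<close>

lemma null_input_null_output:
  assumes P: "lti_dims n m p P" and tr: "trajectory n {0..T} (\<lambda>_. P) v x y"
    and ae: "AE t in lebesgue_on {0..T}. v t = 0\<^sub>v m"
  shows "AE t in lebesgue_on {0..T}. y t = 0\<^sub>v p"
proof -
  have dims: "sysA P \<in> carrier_mat n n" "sysB P \<in> carrier_mat n m"
    "sysC P \<in> carrier_mat p n" "sysD P \<in> carrier_mat p m"
    using P by (auto simp: lti_dims_def)
  have zero: "E *\<^sub>v 0\<^sub>v b = 0\<^sub>v a" if "E \<in> carrier_mat a b" for E :: "real mat" and a b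
    using that by (intro eq_vecI) (auto simp: scalar_prod_def)
  have tr0: "trajectory n {0..T} (\<lambda>_. P) (\<lambda>_. 0\<^sub>v m) (\<lambda>_. 0\<^sub>v n) (\<lambda>_. 0\<^sub>v p)"
    unfolding trajectory_def using dims by (simp add: zero)
  show ?thesis
    using ae
  proof (rule lebesgue_on_mono)
    fix t assume t: "t \<in> {0..T}" and v: "v t = 0\<^sub>v m"
    have "x t = 0\<^sub>v n"
      by (rule trajectory_unique[OF P _ tr tr0 ae t]) (auto simp: image_constant_conv)
    then show "y t = 0\<^sub>v p"
      using trajectoryD(4)[OF tr t] v dims by (simp add: zero)
  qed
qed

section \<open>Gain bounds on bounded intervals\<close>

lemma energy_eq_0_iff:
  assumes "measurable_signal d I f"
  shows "energy I f = 0 \<longleftrightarrow> (AE t in lebesgue_on I. f t = 0\<^sub>v d)"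
proof -
  have "energy I f = 0 \<longleftrightarrow> (AE t in lebesgue_on I. ennreal ((vec_norm2 (f t))\<^sup>2) = 0)"
    unfolding energy_def using measurable_signal_norm[OF assms] by (intro nn_integral_0_iff_AE) simp
  also have "\<dots> \<longleftrightarrow> (AE t in lebesgue_on I. f t = 0\<^sub>v d)"
  proof (intro iffI)
    assume "AE t in lebesgue_on I. ennreal ((vec_norm2 (f t))\<^sup>2) = 0"
    then show "AE t in lebesgue_on I. f t = 0\<^sub>v d"
      using assms by (rule_tac lebesgue_on_mono) (auto simp: measurable_signal_def intro!: vec_norm2_eq_0)
  next
    assume "AE t in lebesgue_on I. f t = 0\<^sub>v d"
    then show "AE t in lebesgue_on I. ennreal ((vec_norm2 (f t))\<^sup>2) = 0"
      by (rule lebesgue_on_mono) simp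
  qed
  finally show ?thesis .
qed

text \<open>Division by the norm of the input is reversible, as this norm is neither zero nor
  infinite.\<close>

lemma induced_norm_upper:
  assumes "square_integrable d {0..} v" and "L2_norm {0..} v \<noteq> 0" and "G v y"
  shows "L2_norm {0..} y \<le> induced_norm d G * L2_norm {0..} v"
proof -
  have "L2_norm {0..} y / L2_norm {0..} v \<le> induced_norm d G"
    unfolding induced_norm_def using assms by (intro SUP_upper2[of "(v, y)"]) auto
  moreover have "L2_norm {0..} v \<noteq> \<infinity>"
    using assms(1) by (auto simp: square_integrable_def)
  ultimately show ?thesis
    using assms(2) by (metis divide_le_posI_ennreal ennreal_divide_times ennreal_times_divide
        infinity_ennreal_def le_less_linear mult_divide_eq_ennreal mult_right_mono not_gr_zero zero_le)
qed

lemma L2_norm_mono: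
  assumes "energy I f \<le> energy J g"
  shows "L2_norm I f \<le> L2_norm J g"
  using L2_norm_le_iff[of 1 I f J g] assms by simp

text \<open>Extension by zero preserves the norm of the input, and cutting the output back to
  \<open>{0..T}\<close> can only decrease its norm. The premise on null inputs covers the case left
  out by the supremum.\<close>

lemma induced_norm_truncation:
  assumes v: "square_integrable d {0..T} v" and G: "G (zero_extend d T v) e'"
    and e: "\<And>t. t \<in> {0..T} \<Longrightarrow> e t = e' t"
    and null: "AE t in lebesgue_on {0..T}. v t = 0\<^sub>v d \<Longrightarrow> AE t in lebesgue_on {0..T}. e t = 0\<^sub>v q"
  shows "L2_norm {0..T} e \<le> induced_norm d G * L2_norm {0..T} v"
proof (cases "L2_norm {0..T} v = 0")
  case True
  then have "AE t in lebesgue_on {0..T}. e t = 0\<^sub>v q"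
    using null energy_eq_0_iff[OF square_integrableD(1)[OF v]] by (simp add: L2_norm_eq_0_iff)
  then have "energy {0..T} e = (\<integral>\<^sup>+ t. 0 \<partial>lebesgue_on {0..T})"
    unfolding energy_def by (intro nn_integral_cong_AE) (auto elim!: lebesgue_on_mono)
  then show ?thesis by (simp add: L2_norm_eq_0_iff[THEN iffD2])
next
  case False
  have ext: "L2_norm {0..} (zero_extend d T v) = L2_norm {0..T} v"
    by (intro antisym L2_norm_mono) (simp_all add: energy_zero_extend)
  have "energy {0..T} e = energy {0..T} e'"
    unfolding energy_def using e by (intro nn_integral_cong) simp
  also have "\<dots> \<le> energy {0..} e'"
    by (rule energy_restrict) auto
  finally have "L2_norm {0..T} e \<le> L2_norm {0..} e'"
    by (rule L2_norm_mono)
  also have "\<dots> \<le> induced_norm d G * L2_norm {0..} (zero_extend d T v)"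
    using False by (intro induced_norm_upper square_integrable_zero_extend v G) (simp add: ext)
  finally show ?thesis by (simp add: ext)
qed

lemma Hinf_norm_truncation:
  assumes P: "lti_dims n m p P" and v: "square_integrable m {0..T} v"
    and tr: "trajectory n {0..T} (\<lambda>_. P) v x y"
  shows "L2_norm {0..T} y \<le> Hinf_norm P * L2_norm {0..T} v"
proof -
  obtain x' y' where tr': "trajectory n {0..} (\<lambda>_. P) (zero_extend m T v) x' y'"
    and eq: "\<And>t. t \<in> {0..T} \<Longrightarrow> y' t = y t"
    using trajectory_zero_extend[OF P v] tr by metis
  have dims: "dim_row (sysA P) = n" "dim_col (sysB P) = m"
    using P by (auto simp: lti_dims_def)
  have "io_map P (zero_extend m T v) y'"
    using tr' dims by (auto simp: io_map_def)
  then show ?thesis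
    unfolding Hinf_norm_def dims
    by (rule induced_norm_truncation[OF v _ eq[symmetric] null_input_null_output[OF P tr]])
qed

text \<open>One common zero-extended input drives both systems, and on \<open>{0..T}\<close> the
  difference of the extended outputs is the given error; a null input has null outputs in both
  systems.\<close>

lemma Hinf_error_truncation:
  assumes P: "lti_dims n m p P" and v: "square_integrable m {0..T} v"
    and tr: "trajectory n {0..T} (\<lambda>_. P) v x y"
    and Q: "lti_dims r m p Q" and trQ: "trajectory r {0..T} (\<lambda>_. Q) v z w"
  shows "L2_norm {0..T} (\<lambda>t. y t - w t) \<le> Hinf_error P Q * L2_norm {0..T} v"
proof -
  obtain x' y' where tr': "trajectory n {0..} (\<lambda>_. P) (zero_extend m T v) x' y'"
    and eq: "\<And>t. t \<in> {0..T} \<Longrightarrow> y' t = y t"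
    using trajectory_zero_extend[OF P v] tr by metis
  obtain z' w' where trQ': "trajectory r {0..} (\<lambda>_. Q) (zero_extend m T v) z' w'"
    and eqQ: "\<And>t. t \<in> {0..T} \<Longrightarrow> w' t = w t"
    using trajectory_zero_extend[OF Q v] trQ by metis
  have dims: "dim_row (sysA P) = n" "dim_col (sysB P) = m" "dim_row (sysA Q) = r"
    using P Q by (auto simp: lti_dims_def)
  have "\<exists>a b. io_map P (zero_extend m T v) a \<and> io_map Q (zero_extend m T v) b \<and>
      (\<lambda>t. y' t - w' t) = (\<lambda>t. a t - b t)"
    using tr' trQ' dims by (auto simp: io_map_def)
  then show ?thesis
    unfolding Hinf_error_def dims
  proof (rule induced_norm_truncation[OF v, where q = p])
    fix t assume "t \<in> {0..T}"
    then show "y t - w t = y' t - w' t" using eq eqQ by simp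
  next
    assume ae: "AE t in lebesgue_on {0..T}. v t = 0\<^sub>v m"
    show "AE t in lebesgue_on {0..T}. y t - w t = 0\<^sub>v p"
      using null_input_null_output[OF P tr ae] null_input_null_output[OF Q trQ ae] by eventually_elim simp
  qed
qed

section \<open>Block matrices and vectors\<close>

text \<open>The vector counterpart of \<open>hcat\<close> and \<open>diag_block_mat\<close>:
  envelope inputs and outputs are stacked in the same block order as the matrices.\<close>

definition vconcat :: "real Matrix.vec list \<Rightarrow> real Matrix.vec" where
  "vconcat vs = foldr (@\<^sub>v) vs (0\<^sub>v 0)"

lemma vconcat_simps [simp]:
  "vconcat [] = 0\<^sub>v 0"
  "vconcat (v # vs) = v @\<^sub>v vconcat vs"
  by (simp_all add: vconcat_def)

lemma append_vec_assoc: "(u @\<^sub>v v) @\<^sub>v w = u @\<^sub>v (v @\<^sub>v w)"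
  by (intro eq_vecI) auto

lemma append_vec_vNil_right [simp]: "v @\<^sub>v vNil = v"
  by (intro eq_vecI) auto

lemma vconcat_append: "vconcat (vs @ ws) = vconcat vs @\<^sub>v vconcat ws"
  by (induction vs) (simp_all add: append_vec_assoc)

lemma dim_vconcat: "dim_vec (vconcat vs) = sum_list (map dim_vec vs)"
  by (induction vs) simp_all

lemma mult_mat_zero_vec:
  assumes "A \<in> carrier_mat nr nc"
  shows "A *\<^sub>v 0\<^sub>v nc = 0\<^sub>v nr"
  using assms by (intro eq_vecI) (auto simp: scalar_prod_def)

lemma zero_mat_mult_vec:
  assumes "v \<in> carrier_vec nc"
  shows "0\<^sub>m nr nc *\<^sub>v v = 0\<^sub>v nr"
  using assms by (intro eq_vecI) (auto simp: scalar_prod_def)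

lemma hcat_carrier:
  assumes "\<And>A. A \<in> set As \<Longrightarrow> dim_row A = n"
  shows "hcat n As \<in> carrier_mat n (sum_list (map dim_col As))"
  using assms
proof (induction As)
  case (Cons A As)
  then have "transpose_mat (hcat n As) \<in> carrier_mat (sum_list (map dim_col As)) n"
    by (intro transpose_carrier_mat[THEN iffD2] Cons.IH) simp
  moreover have "transpose_mat A \<in> carrier_mat (dim_col A) n"
    using Cons.prems by auto
  ultimately have "transpose_mat A @\<^sub>r transpose_mat (hcat n As) \<in> carrier_mat (dim_col A + sum_list (map dim_col As)) n"
    by (rule carrier_append_rows[rotated])
  then show ?case by (simp add: hcat_def)
qed (simp add: hcat_def)

lemma hcat_Cons: "hcat n (A # As) = transpose_mat (transpose_mat A @\<^sub>r transpose_mat (hcat n As))"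
  by (simp add: hcat_def)

lemma hcat_Nil: "hcat n [] = 0\<^sub>m n 0"
  by (simp add: hcat_def transpose_mat_def zero_mat_def) (intro eq_matI; simp)

lemma transpose_hcat_mult_vec:
  assumes "\<And>A. A \<in> set As \<Longrightarrow> dim_row A = n" and x: "x \<in> carrier_vec n"
  shows "transpose_mat (hcat n As) *\<^sub>v x = vconcat (map (\<lambda>A. transpose_mat A *\<^sub>v x) As)"
  using assms(1)
proof (induction As)
  case Nil
  show ?case using x by (intro eq_vecI) (simp_all add: hcat_def)
next
  case (Cons A As)
  have "transpose_mat (hcat n As) \<in> carrier_mat (sum_list (map dim_col As)) n"
    using Cons.prems by (intro transpose_carrier_mat[THEN iffD2] hcat_carrier) simp
  moreover have "transpose_mat A \<in> carrier_mat (dim_col A) n"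
    using Cons.prems by auto
  ultimately show ?case
    using mat_mult_append[OF _ _ x] Cons by (simp add: hcat_Cons)
qed

lemma append_cols_mult_vec:
  assumes A: "A \<in> carrier_mat n a" and B: "B \<in> carrier_mat n b"
    and v: "v \<in> carrier_vec a" and w: "w \<in> carrier_vec b"
  shows "transpose_mat (transpose_mat A @\<^sub>r transpose_mat B) *\<^sub>v (v @\<^sub>v w) = A *\<^sub>v v + B *\<^sub>v w"
proof -
  \<comment> \<open>Lower blocks without rows complete the matrix, so that the product rule for four
    blocks applies.\<close>
  have "transpose_mat (transpose_mat A @\<^sub>r transpose_mat B) = four_block_mat A B (0\<^sub>m 0 a) (0\<^sub>m 0 b)"
    using A B by (intro eq_matI) (auto simp: append_rows_def)
  then have "transpose_mat (transpose_mat A @\<^sub>r transpose_mat B) *\<^sub>v (v @\<^sub>v w)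
      = (A *\<^sub>v v + B *\<^sub>v w) @\<^sub>v (0\<^sub>m 0 a *\<^sub>v v + 0\<^sub>m 0 b *\<^sub>v w)"
    using four_block_mat_mult_vec[OF A B zero_carrier_mat zero_carrier_mat v w] by simp
  also have "\<dots> = A *\<^sub>v v + B *\<^sub>v w"
    by (intro eq_vecI) auto
  finally show ?thesis .
qed

lemma hcat_mult_vconcat:
  assumes "list_all2 (\<lambda>A v. A \<in> carrier_mat n (dim_vec v)) As vs"
  shows "hcat n As *\<^sub>v vconcat vs = foldr (+) (map2 (*\<^sub>v) As vs) (0\<^sub>v n)"
  using assms
proof (induction rule: list_all2_induct)
  case Nil
  show ?case by (simp add: hcat_Nil zero_mat_mult_vec)
next
  case (Cons A As v vs)
  have "dim_row B = n" if "B \<in> set As" for B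
    using Cons.hyps(2) that by (auto simp: list_all2_conv_all_nth in_set_conv_nth)
  then have "hcat n As \<in> carrier_mat n (sum_list (map dim_col As))"
    by (rule hcat_carrier)
  moreover have "map dim_col As = map dim_vec vs"
    using Cons.hyps(2) by (auto simp: list_all2_conv_all_nth intro!: nth_equalityI)
  ultimately have "hcat n As \<in> carrier_mat n (dim_vec (vconcat vs))"
    by (simp add: dim_vconcat)
  then show ?case
    using append_cols_mult_vec[OF Cons.hyps(1) _ carrier_vec_dim_vec carrier_vec_dim_vec] Cons.IH
    by (simp add: hcat_Cons)
qed

lemma index_foldr_add_vec:
  assumes "\<And>v. v \<in> set vs \<Longrightarrow> dim_vec v = n" and "k < n"
  shows "foldr (+) vs (0\<^sub>v n) $ k = sum_list (map (\<lambda>v. v $ k) vs)"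
proof -
  have "dim_vec (foldr (+) vs (0\<^sub>v n)) = n \<and> foldr (+) vs (0\<^sub>v n) $ k = sum_list (map (\<lambda>v. v $ k) vs)"
    using assms by (induction vs) auto
  then show ?thesis ..
qed

lemma diag_block_mat_Cons_mult_vec:
  assumes v: "v \<in> carrier_vec (dim_col A)" and w: "w \<in> carrier_vec (sum_list (map dim_col As))"
  shows "diag_block_mat (A # As) *\<^sub>v (v @\<^sub>v w) = A *\<^sub>v v @\<^sub>v (diag_block_mat As *\<^sub>v w)"
proof -
  let ?D = "diag_block_mat As"
  have D: "?D \<in> carrier_mat (dim_row ?D) (dim_col ?D)"
    by (rule carrier_matI) (rule refl)+
  have w': "w \<in> carrier_vec (dim_col ?D)"
    using w by (simp add: dim_diag_block_mat)
  have "diag_block_mat (A # As) *\<^sub>v (v @\<^sub>v w) =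
      (A *\<^sub>v v + 0\<^sub>m (dim_row A) (dim_col ?D) *\<^sub>v w) @\<^sub>v (0\<^sub>m (dim_row ?D) (dim_col A) *\<^sub>v v + ?D *\<^sub>v w)"
    unfolding diag_block_mat.simps Let_def
    by (rule four_block_mat_mult_vec[OF _ zero_carrier_mat zero_carrier_mat D v w']) simp
  also have "\<dots> = A *\<^sub>v v @\<^sub>v (?D *\<^sub>v w)"
    unfolding zero_mat_mult_vec[OF v] zero_mat_mult_vec[OF w']
    by (intro arg_cong2[where f = "(@\<^sub>v)"] right_zero_vec left_zero_vec mult_mat_vec_in_carrier[OF D]
        mult_mat_vec_in_carrier[OF carrier_matI[OF refl refl]])
  finally show ?thesis .
qed

lemma diag_block_mat_mult_vconcat:
  assumes "list_all2 (\<lambda>A v. dim_col A = dim_vec v) As vs"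
  shows "diag_block_mat As *\<^sub>v vconcat vs = vconcat (map2 (*\<^sub>v) As vs)"
  using assms
proof (induction rule: list_all2_induct)
  case Nil
  show ?case by (simp add: zero_mat_mult_vec)
next
  case (Cons A As v vs)
  have "map dim_col As = map dim_vec vs"
    using Cons.hyps(2) by (auto simp: list_all2_conv_all_nth intro!: nth_equalityI)
  then have "diag_block_mat (A # As) *\<^sub>v (v @\<^sub>v vconcat vs) = A *\<^sub>v v @\<^sub>v (diag_block_mat As *\<^sub>v vconcat vs)"
    using Cons.hyps(1) by (intro diag_block_mat_Cons_mult_vec carrier_vecI) (simp_all only: dim_vconcat)
  then show ?case using Cons.IH by simp
qed

lemma vec_split:
  assumes "w \<in> carrier_vec (a + b)"
  obtains w1 w2 where "w1 \<in> carrier_vec a" and "w2 \<in> carrier_vec b" and "w = w1 @\<^sub>v w2"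
  using vec_first_last_append[OF assms, symmetric] vec_first_carrier vec_last_carrier by blast

lemma vec_norm2_append: "(vec_norm2 (v @\<^sub>v w))\<^sup>2 = (vec_norm2 v)\<^sup>2 + (vec_norm2 w)\<^sup>2"
  unfolding vec_norm2_square by (rule scalar_prod_append[OF carrier_vec_dim_vec carrier_vec_dim_vec carrier_vec_dim_vec carrier_vec_dim_vec])

text \<open>The blocks act on disjoint groups of coordinates, so squared norms add up and a common
  gain of the blocks is a gain of the whole.\<close>

lemma vec_norm2_diag_block_mat_le:
  assumes "\<And>A v. A \<in> set As \<Longrightarrow> v \<in> carrier_vec (dim_col A) \<Longrightarrow> vec_norm2 (A *\<^sub>v v) \<le> c * vec_norm2 v"
    and "w \<in> carrier_vec (sum_list (map dim_col As))" and "0 \<le> c"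
  shows "vec_norm2 (diag_block_mat As *\<^sub>v w) \<le> c * vec_norm2 w"
  using assms
proof (induction As arbitrary: w)
  case Nil
  then have w: "w = 0\<^sub>v 0" by auto
  have "vec_norm2 (diag_block_mat [] *\<^sub>v w) = 0"
    unfolding w diag_block_mat.simps zero_mat_mult_vec[OF zero_carrier_vec] by (rule vec_norm2_zero)
  then show ?case using \<open>0 \<le> c\<close> by simp
next
  case (Cons A As)
  then have "w \<in> carrier_vec (dim_col A + sum_list (map dim_col As))" by simp
  then obtain w1 w2 where w: "w1 \<in> carrier_vec (dim_col A)" "w2 \<in> carrier_vec (sum_list (map dim_col As))"
    and eq: "w = w1 @\<^sub>v w2"
    by (rule vec_split)
  have "vec_norm2 (A *\<^sub>v w1) \<le> c * vec_norm2 w1" "vec_norm2 (diag_block_mat As *\<^sub>v w2) \<le> c * vec_norm2 w2"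
    using Cons w by auto
  then have "(vec_norm2 (A *\<^sub>v w1))\<^sup>2 + (vec_norm2 (diag_block_mat As *\<^sub>v w2))\<^sup>2
      \<le> (c * vec_norm2 w1)\<^sup>2 + (c * vec_norm2 w2)\<^sup>2"
    by (intro add_mono power_mono) auto
  also have "\<dots> = (c * vec_norm2 w)\<^sup>2"
    by (simp add: eq vec_norm2_append power_mult_distrib distrib_left)
  finally have "(vec_norm2 (diag_block_mat (A # As) *\<^sub>v w))\<^sup>2 \<le> (c * vec_norm2 w)\<^sup>2"
    by (simp only: eq diag_block_mat_Cons_mult_vec[OF w] vec_norm2_append)
  then show ?case
    by (rule power2_le_imp_le) (simp add: \<open>0 \<le> c\<close>)
qed

lemma smult_mat_mult_vec:
  assumes "A \<in> carrier_mat nr nc" and "v \<in> carrier_vec nc"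
  shows "(c \<cdot>\<^sub>m A) *\<^sub>v v = c \<cdot>\<^sub>v (A *\<^sub>v (v :: real Matrix.vec))"
  using assms by (intro eq_vecI) auto

text \<open>At most one term survives, that of mode \<open>j\<close>. Mode \<open>1\<close> is the
  reference mode and does not occur in \<open>[2..<Suc l]\<close>, hence the value \<open>0\<close>
  for it.\<close>

lemma sum_list_of_bool_upt:
  fixes f :: "nat \<Rightarrow> real"
  assumes "j \<in> {1..l}"
  shows "(\<Sum>i\<leftarrow>[2..<Suc l]. - of_bool (i = j) * f i) = (if j = 1 then 0 else - f j)"
proof -
  have "(\<Sum>i\<leftarrow>[2..<Suc l]. - of_bool (i = j) * f i) = (\<Sum>i\<in>{2..<Suc l}. - of_bool (i = j) * f i)"
    by (simp add: interv_sum_list_conv_sum_set_nat)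
  also have "\<dots> = (\<Sum>i\<in>{2..<Suc l}. if i = j then - f j else 0)"
    by (intro sum.cong) auto
  also have "\<dots> = (if j = 1 then 0 else - f j)"
    using assms by (subst sum.delta) auto
  finally show ?thesis .
qed

section \<open>The envelope system in closed loop\<close>

lemma zero_append_zero_vec: "0\<^sub>v a @\<^sub>v 0\<^sub>v b = 0\<^sub>v (a + b)"
  by (intro eq_vecI) auto

text \<open>The closed-loop identities are purely algebraic, so the gain condition is left out here;
  its bounds are stated where the estimate is made.\<close>

locale switched_envelope =
  fixes n m p l :: nat and \<Sigma> :: "nat \<Rightarrow> lti" and S M T :: "nat \<Rightarrow> real mat"
  assumes l: "l \<ge> 1"
    and dims: "\<And>i. i \<in> {1..l} \<Longrightarrow> lti_dims n m p (\<Sigma> i)"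
    and dec: "decomposition n l \<Sigma> S M T"
begin

abbreviation "E \<equiv> envelope n l \<Sigma> S T"
abbreviation "LL \<equiv> rank_sum n l \<Sigma>"
abbreviation "K \<equiv> feedback_K m p l M"
abbreviation "K0 \<equiv> feedback_K0 n m l \<Sigma>"
text \<open>A constant rather than an abbreviation, so that \<open>[2..<Suc l]\<close> is not
  rewritten when lists of blocks are simplified.\<close>

definition idx :: "nat list" where "idx = [2..<Suc l]"

text \<open>The block row \<open>[I, -\<delta>_2 I, ..., 0]\<close> with blocks of size
  \<open>p\<close>, obtained from \<open>feedback_K0\<close> by putting \<open>p\<close> for
  \<open>m\<close>. It turns a closed-loop envelope output into the output of mode
  \<open>j\<close>.\<close>

definition selector :: "nat \<Rightarrow> real mat" where
  "selector j = transpose_mat (feedback_K0 n p l \<Sigma> j)"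

section \<open>Dimensions of the blocks\<close>

lemma modes:
  assumes "i \<in> {1..l}"
  shows "sysA (\<Sigma> i) \<in> carrier_mat n n" and "sysB (\<Sigma> i) \<in> carrier_mat n m"
    and "sysC (\<Sigma> i) \<in> carrier_mat p n" and "sysD (\<Sigma> i) \<in> carrier_mat p m"
  using dims[OF assms] by (simp_all add: lti_dims_def)

lemma mode1:
  shows "sysA (\<Sigma> 1) \<in> carrier_mat n n" and "sysB (\<Sigma> 1) \<in> carrier_mat n m"
    and "sysC (\<Sigma> 1) \<in> carrier_mat p n" and "sysD (\<Sigma> 1) \<in> carrier_mat p m"
  using modes[of 1] l by simp_all

lemma index_mode: "i \<in> set idx \<Longrightarrow> i \<in> {1..l}"
  by (auto simp: idx_def)

lemma mode_dims [simp]: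
  assumes "i \<in> set idx"
  shows "dim_row (sysB (\<Sigma> i)) = n" "dim_col (sysB (\<Sigma> i)) = m"
    "dim_row (sysC (\<Sigma> i)) = p" "dim_col (sysC (\<Sigma> i)) = n"
    "dim_row (sysD (\<Sigma> i)) = p" "dim_col (sysD (\<Sigma> i)) = m"
  using modes[OF index_mode[OF assms]] by simp_all

lemma decomp:
  assumes "i \<in> set idx"
  shows "S i \<in> carrier_mat n (beta n \<Sigma> i)" and "M i \<in> carrier_mat (beta n \<Sigma> i) (beta n \<Sigma> i)"
    and "T i \<in> carrier_mat n (beta n \<Sigma> i)"
    and "sysA (\<Sigma> 1) - sysA (\<Sigma> i) = S i * M i * transpose_mat (T i)"
proof -
  have "i \<in> {2..l}" using assms by (auto simp: idx_def)
  then show "S i \<in> carrier_mat n (beta n \<Sigma> i)" and "M i \<in> carrier_mat (beta n \<Sigma> i) (beta n \<Sigma> i)"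
    and "T i \<in> carrier_mat n (beta n \<Sigma> i)"
    and "sysA (\<Sigma> 1) - sysA (\<Sigma> i) = S i * M i * transpose_mat (T i)"
    using dec unfolding decomposition_def by blast+
qed

lemma decomp_dims [simp]:
  assumes "i \<in> set idx"
  shows "dim_row (S i) = n" "dim_col (S i) = beta n \<Sigma> i" "dim_row (M i) = beta n \<Sigma> i"
    "dim_col (M i) = beta n \<Sigma> i" "dim_row (T i) = n" "dim_col (T i) = beta n \<Sigma> i"
  using decomp(1-3)[OF assms] by (simp_all del: One_nat_def)

lemma sum_list_beta: "(\<Sum>i\<leftarrow>idx. beta n \<Sigma> i) = LL"
  unfolding rank_sum_def idx_def
  by (simp only: interv_sum_list_conv_sum_set_nat set_upt atLeastLessThanSuc_atLeastAtMost)

text \<open>\<open>idx\<close> has \<open>l - 1\<close> entries; the separate summand belongs to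
  mode \<open>1\<close>.\<close>

lemma sum_list_const: "d + (\<Sum>i\<leftarrow>idx. (d::nat)) = l * d"
  unfolding idx_def using l by (cases l) (simp_all add: sum_list_triv numeral_2_eq_2 del: upt_Suc)

abbreviation "Bs \<equiv> [sysB (\<Sigma> 1)] @ map (\<lambda>i. sysB (\<Sigma> 1) - sysB (\<Sigma> i)) idx @ map S idx"
abbreviation "Cs \<equiv> [transpose_mat (sysC (\<Sigma> 1))] @ map (\<lambda>i. transpose_mat (sysC (\<Sigma> 1) - sysC (\<Sigma> i))) idx @ map T idx"
abbreviation "Ds \<equiv> [sysD (\<Sigma> 1)] @ map (\<lambda>i. - (sysD (\<Sigma> 1) - sysD (\<Sigma> i))) idx @ [0\<^sub>m LL LL]"
abbreviation "K0s d j \<equiv> [1\<^sub>m d :: real mat] @ map (\<lambda>i. (- of_bool (i = j)) \<cdot>\<^sub>m 1\<^sub>m d) idx @ [0\<^sub>m d LL]"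
abbreviation "Ks j \<equiv> map (\<lambda>i. (- of_bool (i = j)) \<cdot>\<^sub>m M i) idx"

lemma dim_row_Bs: "A \<in> set Bs \<Longrightarrow> dim_row A = n"
  using mode1 by auto

lemma dim_row_Cs: "A \<in> set Cs \<Longrightarrow> dim_row A = n"
  using mode1 by auto

lemma dim_row_K0s: "A \<in> set (K0s d j) \<Longrightarrow> dim_row A = d"
  by auto

lemma sum_dim_Bs: "sum_list (map dim_col Bs) = l * m + LL"
  using mode1(2) by (simp add: comp_def sum_list_beta flip: sum_list_const cong: map_cong)

lemma sum_dim_Cs: "sum_list (map dim_col Cs) = l * p + LL"
  using mode1(3) by (simp add: comp_def sum_list_beta flip: sum_list_const cong: map_cong)

lemma sum_dim_K0s: "sum_list (map dim_col (K0s d j)) = l * d + LL"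
  by (simp add: comp_def flip: sum_list_const)

lemma sum_dim_row_Ds: "sum_list (map dim_row Ds) = l * p + LL"
  using mode1(4) by (simp add: comp_def flip: sum_list_const cong: map_cong)

lemma sum_dim_col_Ds: "sum_list (map dim_col Ds) = l * m + LL"
  using mode1(4) by (simp add: comp_def flip: sum_list_const cong: map_cong)

lemma sum_dim_Ks: "sum_list (map dim_row (Ks j)) = LL" "sum_list (map dim_col (Ks j)) = LL"
  by (simp_all add: comp_def sum_list_beta cong: map_cong)

lemma sysA_envelope: "sysA E = sysA (\<Sigma> 1)"
  and sysB_envelope: "sysB E = hcat n Bs"
  and sysC_envelope: "sysC E = transpose_mat (hcat n Cs)"
  and sysD_envelope: "sysD E = diag_block_mat Ds"
  by (simp_all add: envelope_def idx_def)

lemma lti_dims_envelope: "lti_dims n (l * m + LL) (l * p + LL) E"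
proof -
  have "sysB E \<in> carrier_mat n (l * m + LL)"
    unfolding sysB_envelope sum_dim_Bs[symmetric] by (rule hcat_carrier[OF dim_row_Bs])
  moreover have "hcat n Cs \<in> carrier_mat n (l * p + LL)"
    unfolding sum_dim_Cs[symmetric] by (rule hcat_carrier[OF dim_row_Cs])
  moreover have "sysD E \<in> carrier_mat (l * p + LL) (l * m + LL)"
    unfolding sysD_envelope by (intro carrier_matI) (simp_all only: dim_diag_block_mat sum_dim_row_Ds sum_dim_col_Ds)
  ultimately show ?thesis
    unfolding lti_dims_def sysA_envelope sysC_envelope using mode1(1) by simp
qed

lemma feedback_K_carrier: "K j \<in> carrier_mat (l * m + LL) (l * p + LL)"
  unfolding feedback_K_def idx_def[symmetric]
  by (intro carrier_matI) (simp_all only: dim_diag_block_mat list.map sum_list.Cons sum_dim_Ks index_zero_mat)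

lemma hcat_K0s_carrier: "hcat d (K0s d j) \<in> carrier_mat d (l * d + LL)"
  using hcat_carrier[of "K0s d j" d, OF dim_row_K0s] by (simp only: sum_dim_K0s)

lemma feedback_K0_carrier: "K0 j \<in> carrier_mat (l * m + LL) m"
  unfolding feedback_K0_def idx_def[symmetric] using hcat_K0s_carrier by simp

lemma selector_carrier: "selector j \<in> carrier_mat p (l * p + LL)"
  unfolding selector_def feedback_K0_def idx_def[symmetric] transpose_transpose by (rule hcat_K0s_carrier)

section \<open>Algebra of the closed loop\<close>

text \<open>Only the outputs that come from the \<open>T i\<close> are fed back, and only into the
  inputs of the \<open>S i\<close>; the identities below rely on this split.\<close>

lemma feedback_K_mult_append:
  assumes "a \<in> carrier_vec (l * p)" and "b \<in> carrier_vec LL"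
  shows "K j *\<^sub>v (a @\<^sub>v b) = 0\<^sub>v (l * m) @\<^sub>v (diag_block_mat (Ks j) *\<^sub>v b)"
proof -
  have "K j *\<^sub>v (a @\<^sub>v b) = 0\<^sub>m (l * m) (l * p) *\<^sub>v a @\<^sub>v (diag_block_mat (Ks j) *\<^sub>v b)"
    unfolding feedback_K_def idx_def[symmetric] using assms
    by (intro diag_block_mat_Cons_mult_vec) (simp_all only: sum_dim_Ks index_zero_mat)
  then show ?thesis using zero_mat_mult_vec[OF assms(1)] by simp
qed

text \<open>Each block of \<open>K\<close> is \<open>- M i\<close> or zero, hence of gain at most
  \<mu>, and block-diagonal form preserves this bound.\<close>

lemma vec_norm2_feedback_K_le:
  assumes y: "y \<in> carrier_vec (l * p + LL)"
    and \<mu>: "\<And>i. i \<in> {2..l} \<Longrightarrow> spectral_norm (M i) \<le> \<mu>" and "0 \<le> \<mu>"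
  shows "vec_norm2 (K j *\<^sub>v y) \<le> \<mu> * vec_norm2 y"
proof -
  obtain a b where a: "a \<in> carrier_vec (l * p)" and b: "b \<in> carrier_vec LL" and y': "y = a @\<^sub>v b"
    using vec_split[OF y] .
  have "vec_norm2 (diag_block_mat (Ks j) *\<^sub>v b) \<le> \<mu> * vec_norm2 b"
  proof (rule vec_norm2_diag_block_mat_le)
    fix A and v :: "real Matrix.vec" assume A: "A \<in> set (Ks j)" and v: "v \<in> carrier_vec (dim_col A)"
    then obtain i where i: "i \<in> set idx" and A': "A = (- of_bool (i = j)) \<cdot>\<^sub>m M i" by auto
    have v': "v \<in> carrier_vec (beta n \<Sigma> i)" using v A' i by simp
    have "vec_norm2 (A *\<^sub>v v) = \<bar>- of_bool (i = j)\<bar> * vec_norm2 (M i *\<^sub>v v)"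
      unfolding A' smult_mat_mult_vec[OF decomp(2)[OF i] v'] vec_norm2_smult ..
    also have "\<dots> \<le> 1 * vec_norm2 (M i *\<^sub>v v)"
      by (intro mult_right_mono) auto
    also have "\<dots> \<le> spectral_norm (M i) * vec_norm2 v"
      using vec_norm2_mult_mat_le_spectral_norm[OF decomp(2)[OF i] v'] by simp
    also have "\<dots> \<le> \<mu> * vec_norm2 v"
      using \<mu>[of i] i by (intro mult_right_mono) (auto simp: idx_def)
    finally show "vec_norm2 (A *\<^sub>v v) \<le> \<mu> * vec_norm2 v" .
  qed (use b \<open>0 \<le> \<mu>\<close> sum_dim_Ks in \<open>simp_all only:\<close>)
  then have "(vec_norm2 (K j *\<^sub>v y))\<^sup>2 \<le> (\<mu> * vec_norm2 b)\<^sup>2"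
    unfolding y' feedback_K_mult_append[OF a b] vec_norm2_append by (simp add: power_mono)
  also have "\<dots> \<le> (\<mu> * vec_norm2 y)\<^sup>2"
    unfolding power_mult_distrib y' vec_norm2_append by (intro mult_left_mono) simp_all
  finally show ?thesis
    by (rule power2_le_imp_le) (simp add: \<open>0 \<le> \<mu>\<close>)
qed

text \<open>The feedback loop has no algebraic constraint: \<open>K\<close> reads only outputs on which \<open>D\<^sub>E\<close> vanishes.\<close>

lemma feedback_K_mult_sysD:
  assumes w: "w \<in> carrier_vec (l * m + LL)"
  shows "K j *\<^sub>v (sysD E *\<^sub>v w) = 0\<^sub>v (l * m + LL)"
proof -
  let ?Ds = "[sysD (\<Sigma> 1)] @ map (\<lambda>i. - (sysD (\<Sigma> 1) - sysD (\<Sigma> i))) idx"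
  obtain a b where a: "a \<in> carrier_vec (l * m)" and b: "b \<in> carrier_vec LL" and w': "w = a @\<^sub>v b"
    using vec_split[OF w] .
  have dims': "sum_list (map dim_row ?Ds) = l * p" "sum_list (map dim_col ?Ds) = l * m"
    using sum_dim_row_Ds sum_dim_col_Ds by simp_all
  let ?D = "diag_block_mat ?Ds"
  have D: "?D \<in> carrier_mat (l * p) (l * m)"
    by (intro carrier_matI) (simp_all only: dim_diag_block_mat dims')
  have "diag_block_mat Ds = diag_block_mat (?Ds @ [0\<^sub>m LL LL])" by (simp only: append_assoc)
  also have "\<dots> = four_block_mat ?D (0\<^sub>m (l * p) LL) (0\<^sub>m LL (l * m)) (0\<^sub>m LL LL)"
    unfolding diag_block_mat_last by (simp only: Let_def carrier_matD[OF D] index_zero_mat)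
  finally have "sysD E *\<^sub>v w = (?D *\<^sub>v a + 0\<^sub>m (l * p) LL *\<^sub>v b) @\<^sub>v (0\<^sub>m LL (l * m) *\<^sub>v a + 0\<^sub>m LL LL *\<^sub>v b)"
    unfolding w' sysD_envelope
    using four_block_mat_mult_vec[OF D zero_carrier_mat zero_carrier_mat zero_carrier_mat a b] by simp
  also have "\<dots> = (?D *\<^sub>v a) @\<^sub>v 0\<^sub>v LL"
    unfolding zero_mat_mult_vec[OF a] zero_mat_mult_vec[OF b]
    by (intro arg_cong2[where f = "(@\<^sub>v)"] right_zero_vec mult_mat_vec_in_carrier[OF D]) simp_all
  finally have "K j *\<^sub>v (sysD E *\<^sub>v w) = 0\<^sub>v (l * m) @\<^sub>v (diag_block_mat (Ks j) *\<^sub>v 0\<^sub>v LL)"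
    using feedback_K_mult_append[OF mult_mat_vec_in_carrier[OF D] zero_carrier_vec] by simp
  also have "diag_block_mat (Ks j) *\<^sub>v 0\<^sub>v LL = 0\<^sub>v LL"
    by (rule mult_mat_zero_vec) (intro carrier_matI; simp only: dim_diag_block_mat sum_dim_Ks)
  finally show ?thesis by (simp add: zero_append_zero_vec)
qed

lemma sysC_envelope_mult:
  assumes \<xi>: "\<xi> \<in> carrier_vec n"
  shows "sysC E *\<^sub>v \<xi> = vconcat ([sysC (\<Sigma> 1) *\<^sub>v \<xi>] @ map (\<lambda>i. (sysC (\<Sigma> 1) - sysC (\<Sigma> i)) *\<^sub>v \<xi>) idx
    @ map (\<lambda>i. transpose_mat (T i) *\<^sub>v \<xi>) idx)"
  using transpose_hcat_mult_vec[of Cs, OF dim_row_Cs \<xi>] unfolding sysC_envelope by (simp add: comp_def)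

lemma feedback_K0_mult:
  assumes u: "u \<in> carrier_vec m"
  shows "K0 j *\<^sub>v u = vconcat ([u] @ map (\<lambda>i. - of_bool (i = j) \<cdot>\<^sub>v u) idx @ [0\<^sub>v LL])"
proof -
  have "transpose_mat (1\<^sub>m m) *\<^sub>v u = u" "transpose_mat (0\<^sub>m m LL) *\<^sub>v u = 0\<^sub>v LL"
    using u by (simp_all add: zero_mat_mult_vec)
  moreover have "transpose_mat (c \<cdot>\<^sub>m 1\<^sub>m m) *\<^sub>v u = c \<cdot>\<^sub>v u" for c
  proof -
    have "transpose_mat (c \<cdot>\<^sub>m 1\<^sub>m m) = c \<cdot>\<^sub>m (1\<^sub>m m :: real mat)"
      by (intro eq_matI) auto
    then show ?thesis using smult_mat_mult_vec[OF one_carrier_mat u] u by simp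
  qed
  ultimately show ?thesis
    using transpose_hcat_mult_vec[of "K0s m j", OF dim_row_K0s u]
    unfolding feedback_K0_def idx_def[symmetric] by (simp add: comp_def)
qed

lemma dim_vconcat_idx:
  assumes "a \<in> carrier_vec d" and "\<And>i. i \<in> set idx \<Longrightarrow> f i \<in> carrier_vec d"
  shows "vconcat ([a] @ map f idx) \<in> carrier_vec (l * d)"
proof (rule carrier_vecI)
  have "\<And>i. i \<in> set idx \<Longrightarrow> dim_vec (f i) = d"
    using assms(2) by (rule carrier_vecD)
  then show "dim_vec (vconcat ([a] @ map f idx)) = l * d"
    using assms(1) by (simp add: dim_vconcat comp_def flip: sum_list_const cong: map_cong)
qed

lemma dim_vconcat_beta:
  assumes "\<And>i. i \<in> set idx \<Longrightarrow> f i \<in> carrier_vec (beta n \<Sigma> i)"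
  shows "vconcat (map f idx) \<in> carrier_vec LL"
proof (rule carrier_vecI)
  have "\<And>i. i \<in> set idx \<Longrightarrow> dim_vec (f i) = beta n \<Sigma> i"
    using assms by (rule carrier_vecD)
  then show "dim_vec (vconcat (map f idx)) = LL"
    by (simp add: dim_vconcat comp_def sum_list_beta cong: map_cong)
qed

text \<open>\<open>K\<close> fills only the last \<open>LL\<close> coordinates and \<open>K0\<close>
  only the first \<open>l * m\<close>, so the sum is a concatenation. It exhibits the closed-loop
  input without reference to itself.\<close>

lemma feedback_input:
  assumes \<xi>: "\<xi> \<in> carrier_vec n" and u: "u \<in> carrier_vec m"
  shows "K j *\<^sub>v (sysC E *\<^sub>v \<xi>) + K0 j *\<^sub>v u = vconcat ([u] @ map (\<lambda>i. - of_bool (i = j) \<cdot>\<^sub>v u) idx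
    @ map (\<lambda>i. - of_bool (i = j) \<cdot>\<^sub>v (M i *\<^sub>v (transpose_mat (T i) *\<^sub>v \<xi>))) idx)"
proof -
  let ?a = "vconcat ([sysC (\<Sigma> 1) *\<^sub>v \<xi>] @ map (\<lambda>i. (sysC (\<Sigma> 1) - sysC (\<Sigma> i)) *\<^sub>v \<xi>) idx)"
  let ?b = "vconcat (map (\<lambda>i. transpose_mat (T i) *\<^sub>v \<xi>) idx)"
  let ?c = "vconcat ([u] @ map (\<lambda>i. - of_bool (i = j) \<cdot>\<^sub>v u) idx)"
  let ?d = "vconcat (map (\<lambda>i. - of_bool (i = j) \<cdot>\<^sub>v (M i *\<^sub>v (transpose_mat (T i) *\<^sub>v \<xi>))) idx)"
  have Tx: "transpose_mat (T i) *\<^sub>v \<xi> \<in> carrier_vec (beta n \<Sigma> i)" if "i \<in> set idx" for i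
    using that by (intro carrier_vecI) simp
  have a: "?a \<in> carrier_vec (l * p)"
  proof (rule dim_vconcat_idx)
    show "sysC (\<Sigma> 1) *\<^sub>v \<xi> \<in> carrier_vec p" by (rule mult_mat_vec_in_carrier[OF mode1(3)])
  qed (rule carrier_vecI, simp)
  have b: "?b \<in> carrier_vec LL" by (rule dim_vconcat_beta[OF Tx])
  have c: "?c \<in> carrier_vec (l * m)" by (rule dim_vconcat_idx) (use u in simp_all)
  have d: "?d \<in> carrier_vec LL" by (rule dim_vconcat_beta, rule carrier_vecI) simp
  have "list_all2 (\<lambda>A v. dim_col A = dim_vec v) (Ks j) (map (\<lambda>i. transpose_mat (T i) *\<^sub>v \<xi>) idx)"
    by (simp add: list_all2_map1 list_all2_map2 list_all2_same)
  then have "diag_block_mat (Ks j) *\<^sub>v ?b = vconcat (map (\<lambda>i. ((- of_bool (i = j)) \<cdot>\<^sub>m M i) *\<^sub>v (transpose_mat (T i) *\<^sub>v \<xi>)) idx)"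
    by (subst diag_block_mat_mult_vconcat) (simp_all only: map2_map_map)
  also have "\<dots> = ?d"
    by (intro arg_cong[where f = vconcat] map_cong refl smult_mat_mult_vec[OF decomp(2)] Tx)
  finally have "K j *\<^sub>v (sysC E *\<^sub>v \<xi>) = 0\<^sub>v (l * m) @\<^sub>v ?d"
    unfolding sysC_envelope_mult[OF \<xi>]
    using feedback_K_mult_append[OF a b] by (simp add: vconcat_append append_vec_assoc)
  moreover have "K0 j *\<^sub>v u = ?c @\<^sub>v 0\<^sub>v LL"
    unfolding feedback_K0_mult[OF u] by (simp add: vconcat_append append_vec_assoc)
  ultimately have "K j *\<^sub>v (sysC E *\<^sub>v \<xi>) + K0 j *\<^sub>v u = (0\<^sub>v (l * m) + ?c) @\<^sub>v (?d + 0\<^sub>v LL)"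
    using append_vec_add[OF zero_carrier_vec c d zero_carrier_vec] by simp
  also have "\<dots> = ?c @\<^sub>v ?d"
    unfolding left_zero_vec[OF c] right_zero_vec[OF d] ..
  finally show ?thesis
    by (simp add: vconcat_append append_vec_assoc)
qed

lemma sum_list_of_bool_idx:
  fixes f :: "nat \<Rightarrow> real"
  assumes "j \<in> {1..l}"
  shows "(\<Sum>i\<leftarrow>idx. - (of_bool (i = j) * f i)) = (if j = 1 then 0 else - f j)"
  unfolding idx_def using sum_list_of_bool_upt[OF assms, of f] by (simp only: mult_minus_left)

text \<open>Used for the state part and for the feedthrough part of an envelope output. The zero
  block of the selector annihilates \<open>b\<close>.\<close>

lemma selector_mult_vconcat:
  assumes j: "j \<in> {1..l}" and a: "a \<in> carrier_vec p" and f: "\<And>i. i \<in> set idx \<Longrightarrow> f i \<in> carrier_vec p"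
    and b: "b \<in> carrier_vec LL" and k: "k < p"
  shows "(selector j *\<^sub>v vconcat ([a] @ map f idx @ [b])) $ k = a $ k + (if j = 1 then 0 else - f j $ k)"
proof -
  have "list_all2 (\<lambda>A v. A \<in> carrier_mat p (dim_vec v)) (K0s p j) ([a] @ map f idx @ [b])"
    using carrier_vecD[OF a] carrier_vecD[OF b] carrier_vecD[OF f]
    by (auto simp: list_all2_map1 list_all2_map2 list_all2_same intro!: list_all2_appendI)
  then have "selector j *\<^sub>v vconcat ([a] @ map f idx @ [b])
      = foldr (+) (map2 (*\<^sub>v) (K0s p j) ([a] @ map f idx @ [b])) (0\<^sub>v p)"
    unfolding selector_def feedback_K0_def idx_def[symmetric] transpose_transpose by (rule hcat_mult_vconcat)
  also have "map2 (*\<^sub>v) (K0s p j) ([a] @ map f idx @ [b])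
      = [1\<^sub>m p *\<^sub>v a] @ map (\<lambda>i. ((- of_bool (i = j)) \<cdot>\<^sub>m 1\<^sub>m p) *\<^sub>v f i) idx @ [0\<^sub>m p LL *\<^sub>v b]"
    by (simp add: map2_map_map)
  also have "\<dots> = [a] @ map (\<lambda>i. - of_bool (i = j) \<cdot>\<^sub>v f i) idx @ [0\<^sub>v p]"
    using smult_mat_mult_vec[OF one_carrier_mat f] f a zero_mat_mult_vec[OF b] by simp
  also have "foldr (+) \<dots> (0\<^sub>v p) $ k
      = sum_list (map (\<lambda>v. v $ k) ([a] @ map (\<lambda>i. - of_bool (i = j) \<cdot>\<^sub>v f i) idx @ [0\<^sub>v p]))"
    by (rule index_foldr_add_vec[OF _ k]) (use carrier_vecD[OF a] carrier_vecD[OF f] in auto)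
  also have "\<dots> = a $ k + (\<Sum>i\<leftarrow>idx. - (of_bool (i = j) * f i $ k))"
    using k carrier_vecD[OF f] by (simp add: comp_def cong: map_cong)
  finally show ?thesis
    unfolding sum_list_of_bool_idx[OF j] .
qed

lemma envelope_carriers:
  shows "sysB E \<in> carrier_mat n (l * m + LL)" and "sysC E \<in> carrier_mat (l * p + LL) n"
    and "sysD E \<in> carrier_mat (l * p + LL) (l * m + LL)"
  using lti_dims_envelope by (simp_all add: lti_dims_def)

text \<open>Turns the implicit loop equation for \<open>w\<close> into an explicit formula in the
  state and the external input.\<close>

lemma feedback_K_mult_output:
  assumes w: "w \<in> carrier_vec (l * m + LL)"
  shows "K j *\<^sub>v (sysC E *\<^sub>v \<xi> + sysD E *\<^sub>v w) = K j *\<^sub>v (sysC E *\<^sub>v \<xi>)"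
proof -
  note C = mult_mat_vec_in_carrier[OF envelope_carriers(2), of \<xi>]
    and D = mult_mat_vec_in_carrier[OF envelope_carriers(3), of w]
  have "K j *\<^sub>v (sysC E *\<^sub>v \<xi> + sysD E *\<^sub>v w) = K j *\<^sub>v (sysC E *\<^sub>v \<xi>) + 0\<^sub>v (l * m + LL)"
    unfolding mult_add_distrib_mat_vec[OF feedback_K_carrier C D] feedback_K_mult_sysD[OF w] ..
  also have "\<dots> = K j *\<^sub>v (sysC E *\<^sub>v \<xi>)"
    by (rule right_zero_vec[OF mult_mat_vec_in_carrier[OF feedback_K_carrier]])
  finally show ?thesis .
qed

text \<open>The reference mode minus the active difference is the active mode:
  \<open>A_1 \<xi> - S_j M_j T_j^T \<xi> = A_j \<xi>\<close>, and likewise for the other matrices.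
  The vector \<xi> is arbitrary, so that the identities also apply to \<open>V *\<^sub>v x\<close>
  for a reduced state \<open>x\<close>.\<close>

lemma closed_loop:
  assumes j: "j \<in> {1..l}" and \<xi>: "\<xi> \<in> carrier_vec n" and u: "u \<in> carrier_vec m"
    and w: "w \<in> carrier_vec (l * m + LL)" and loop: "w = K j *\<^sub>v (sysC E *\<^sub>v \<xi> + sysD E *\<^sub>v w) + K0 j *\<^sub>v u"
  shows "w = K j *\<^sub>v (sysC E *\<^sub>v \<xi>) + K0 j *\<^sub>v u"
    and "sysA E *\<^sub>v \<xi> + sysB E *\<^sub>v w = sysA (\<Sigma> j) *\<^sub>v \<xi> + sysB (\<Sigma> j) *\<^sub>v u"
    and "selector j *\<^sub>v (sysC E *\<^sub>v \<xi> + sysD E *\<^sub>v w) = sysC (\<Sigma> j) *\<^sub>v \<xi> + sysD (\<Sigma> j) *\<^sub>v u"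
proof -
  note dimsE = envelope_carriers(2,3,1)
  note C = mult_mat_vec_in_carrier[OF dimsE(1), of \<xi>] and D = mult_mat_vec_in_carrier[OF dimsE(2), of w]
  show w1: "w = K j *\<^sub>v (sysC E *\<^sub>v \<xi>) + K0 j *\<^sub>v u"
    using loop feedback_K_mult_output[OF w] by simp
  let ?r = "\<lambda>i. M i *\<^sub>v (transpose_mat (T i) *\<^sub>v \<xi>)"
  let ?\<delta> = "\<lambda>i. - of_bool (i = j) :: real"
  have weq: "w = vconcat ([u] @ map (\<lambda>i. ?\<delta> i \<cdot>\<^sub>v u) idx @ map (\<lambda>i. ?\<delta> i \<cdot>\<^sub>v ?r i) idx)"
    using w1 feedback_input[OF \<xi> u] by simp
  have Sr: "S i *\<^sub>v ?r i = (sysA (\<Sigma> 1) - sysA (\<Sigma> i)) *\<^sub>v \<xi>" if i: "i \<in> set idx" for i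
  proof -
    have Tt: "transpose_mat (T i) \<in> carrier_mat (beta n \<Sigma> i) n"
      using decomp(3)[OF i] by simp
    show ?thesis
      unfolding decomp(4)[OF i] assoc_mult_mat_vec[OF mult_carrier_mat[OF decomp(1,2)[OF i]] Tt \<xi>]
      by (rule assoc_mult_mat_vec[OF decomp(1,2)[OF i] mult_mat_vec_in_carrier[OF Tt], symmetric])
  qed
  show "sysA E *\<^sub>v \<xi> + sysB E *\<^sub>v w = sysA (\<Sigma> j) *\<^sub>v \<xi> + sysB (\<Sigma> j) *\<^sub>v u"
  proof (rule eq_vecI)
    fix k assume "k < dim_vec (sysA (\<Sigma> j) *\<^sub>v \<xi> + sysB (\<Sigma> j) *\<^sub>v u)"
    then have k: "k < n" using modes(2)[OF j] by simp
    let ?ws = "[u] @ map (\<lambda>i. ?\<delta> i \<cdot>\<^sub>v u) idx @ map (\<lambda>i. ?\<delta> i \<cdot>\<^sub>v ?r i) idx"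
    have "list_all2 (\<lambda>A v. A \<in> carrier_mat n (dim_vec v)) Bs ?ws"
      using u mode1(2) decomp(1)
      by (auto simp: list_all2_map1 list_all2_map2 list_all2_same intro!: list_all2_appendI carrier_matI)
    then have "sysB E *\<^sub>v w = foldr (+) (map2 (*\<^sub>v) Bs ?ws) (0\<^sub>v n)"
      unfolding sysB_envelope weq by (rule hcat_mult_vconcat)
    also have "map2 (*\<^sub>v) Bs ?ws = [sysB (\<Sigma> 1) *\<^sub>v u]
        @ map (\<lambda>i. (sysB (\<Sigma> 1) - sysB (\<Sigma> i)) *\<^sub>v (?\<delta> i \<cdot>\<^sub>v u)) idx @ map (\<lambda>i. S i *\<^sub>v (?\<delta> i \<cdot>\<^sub>v ?r i)) idx"
      by (simp add: map2_map_map)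
    also have "foldr (+) \<dots> (0\<^sub>v n) $ k = sum_list (map (\<lambda>v. v $ k) \<dots>)"
      by (rule index_foldr_add_vec[OF _ k]) (use mode1(2) in auto)
    also have "\<dots> = (sysB (\<Sigma> 1) *\<^sub>v u) $ k
        + (\<Sum>i\<leftarrow>idx. ((sysB (\<Sigma> 1) - sysB (\<Sigma> i)) *\<^sub>v (?\<delta> i \<cdot>\<^sub>v u)) $ k) + (\<Sum>i\<leftarrow>idx. (S i *\<^sub>v (?\<delta> i \<cdot>\<^sub>v ?r i)) $ k)"
      by (simp add: comp_def)
    also have "(\<Sum>i\<leftarrow>idx. ((sysB (\<Sigma> 1) - sysB (\<Sigma> i)) *\<^sub>v (?\<delta> i \<cdot>\<^sub>v u)) $ k)
        = (\<Sum>i\<leftarrow>idx. - (of_bool (i = j) * ((sysB (\<Sigma> 1) *\<^sub>v u) $ k - (sysB (\<Sigma> i) *\<^sub>v u) $ k)))"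
    proof (intro arg_cong[where f = sum_list] map_cong refl)
      fix i assume i: "i \<in> set idx"
      have "(sysB (\<Sigma> 1) - sysB (\<Sigma> i)) *\<^sub>v (?\<delta> i \<cdot>\<^sub>v u) = ?\<delta> i \<cdot>\<^sub>v ((sysB (\<Sigma> 1) - sysB (\<Sigma> i)) *\<^sub>v u)"
        using i by (intro mult_mat_vec[OF carrier_matI u]) simp_all
      also have "(sysB (\<Sigma> 1) - sysB (\<Sigma> i)) *\<^sub>v u = sysB (\<Sigma> 1) *\<^sub>v u - sysB (\<Sigma> i) *\<^sub>v u"
        by (rule minus_mult_distrib_mat_vec[OF mode1(2) modes(2)[OF index_mode[OF i]] u])
      finally show "((sysB (\<Sigma> 1) - sysB (\<Sigma> i)) *\<^sub>v (?\<delta> i \<cdot>\<^sub>v u)) $ k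
          = - (of_bool (i = j) * ((sysB (\<Sigma> 1) *\<^sub>v u) $ k - (sysB (\<Sigma> i) *\<^sub>v u) $ k))"
        using i k by simp
    qed
    also have "(\<Sum>i\<leftarrow>idx. (S i *\<^sub>v (?\<delta> i \<cdot>\<^sub>v ?r i)) $ k)
        = (\<Sum>i\<leftarrow>idx. - (of_bool (i = j) * ((sysA (\<Sigma> 1) *\<^sub>v \<xi>) $ k - (sysA (\<Sigma> i) *\<^sub>v \<xi>) $ k)))"
    proof (intro arg_cong[where f = sum_list] map_cong refl)
      fix i assume i: "i \<in> set idx"
      have "S i *\<^sub>v (?\<delta> i \<cdot>\<^sub>v ?r i) = ?\<delta> i \<cdot>\<^sub>v (S i *\<^sub>v ?r i)"
        by (rule mult_mat_vec[OF decomp(1)[OF i] mult_mat_vec_in_carrier[OF decomp(2)[OF i]]])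
      also have "S i *\<^sub>v ?r i = sysA (\<Sigma> 1) *\<^sub>v \<xi> - sysA (\<Sigma> i) *\<^sub>v \<xi>"
        unfolding Sr[OF i] by (rule minus_mult_distrib_mat_vec[OF mode1(1) modes(1)[OF index_mode[OF i]] \<xi>])
      finally show "(S i *\<^sub>v (?\<delta> i \<cdot>\<^sub>v ?r i)) $ k
          = - (of_bool (i = j) * ((sysA (\<Sigma> 1) *\<^sub>v \<xi>) $ k - (sysA (\<Sigma> i) *\<^sub>v \<xi>) $ k))"
        using modes(1)[OF index_mode[OF i]] k by simp
    qed
    finally have B: "(sysB E *\<^sub>v w) $ k = (sysB (\<Sigma> 1) *\<^sub>v u) $ k
        + (if j = 1 then 0 else - ((sysB (\<Sigma> 1) *\<^sub>v u) $ k - (sysB (\<Sigma> j) *\<^sub>v u) $ k))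
        + (if j = 1 then 0 else - ((sysA (\<Sigma> 1) *\<^sub>v \<xi>) $ k - (sysA (\<Sigma> j) *\<^sub>v \<xi>) $ k))"
      unfolding sum_list_of_bool_idx[OF j] .
    have "(sysA E *\<^sub>v \<xi> + sysB E *\<^sub>v w) $ k = (sysA (\<Sigma> 1) *\<^sub>v \<xi>) $ k + (sysB E *\<^sub>v w) $ k"
      unfolding sysA_envelope using k dimsE(3) by (intro index_add_vec) simp
    also have "\<dots> = (sysA (\<Sigma> j) *\<^sub>v \<xi>) $ k + (sysB (\<Sigma> j) *\<^sub>v u) $ k"
      unfolding B by simp
    also have "\<dots> = (sysA (\<Sigma> j) *\<^sub>v \<xi> + sysB (\<Sigma> j) *\<^sub>v u) $ k"
      using k modes(2)[OF j] by (intro index_add_vec[symmetric]) simp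
    finally show "(sysA E *\<^sub>v \<xi> + sysB E *\<^sub>v w) $ k = (sysA (\<Sigma> j) *\<^sub>v \<xi> + sysB (\<Sigma> j) *\<^sub>v u) $ k" .
  qed (use dimsE(3) modes(2)[OF j] in simp)
  show "selector j *\<^sub>v (sysC E *\<^sub>v \<xi> + sysD E *\<^sub>v w) = sysC (\<Sigma> j) *\<^sub>v \<xi> + sysD (\<Sigma> j) *\<^sub>v u"
  proof (rule eq_vecI)
    fix k assume "k < dim_vec (sysC (\<Sigma> j) *\<^sub>v \<xi> + sysD (\<Sigma> j) *\<^sub>v u)"
    then have k: "k < p" using modes(4)[OF j] by simp
    let ?q = "vconcat (map (\<lambda>i. transpose_mat (T i) *\<^sub>v \<xi>) idx)"
    let ?R = "vconcat (map (\<lambda>i. ?\<delta> i \<cdot>\<^sub>v ?r i) idx)"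
    have q: "?q \<in> carrier_vec LL" and R: "?R \<in> carrier_vec LL"
      by (rule dim_vconcat_beta, rule carrier_vecI, simp)+
    have Cx: "sysC E *\<^sub>v \<xi> = vconcat ([sysC (\<Sigma> 1) *\<^sub>v \<xi>] @ map (\<lambda>i. (sysC (\<Sigma> 1) - sysC (\<Sigma> i)) *\<^sub>v \<xi>) idx @ [?q])"
      unfolding sysC_envelope_mult[OF \<xi>] by (simp add: vconcat_append)
    have 1: "(selector j *\<^sub>v (sysC E *\<^sub>v \<xi>)) $ k = (sysC (\<Sigma> 1) *\<^sub>v \<xi>) $ k
        + (if j = 1 then 0 else - ((sysC (\<Sigma> 1) - sysC (\<Sigma> j)) *\<^sub>v \<xi>) $ k)"
      unfolding Cx by (rule selector_mult_vconcat[OF j _ _ q k])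
        (rule mult_mat_vec_in_carrier[OF mode1(3)], rule carrier_vecI, simp)
    have w2: "w = vconcat ([u] @ map (\<lambda>i. ?\<delta> i \<cdot>\<^sub>v u) idx @ [?R])"
      unfolding weq by (simp add: vconcat_append)
    have "list_all2 (\<lambda>A v. dim_col A = dim_vec v) Ds ([u] @ map (\<lambda>i. ?\<delta> i \<cdot>\<^sub>v u) idx @ [?R])"
      using u R mode1(4)
      by (auto simp: list_all2_map1 list_all2_map2 list_all2_same intro!: list_all2_appendI)
    then have "sysD E *\<^sub>v w = vconcat (map2 (*\<^sub>v) Ds ([u] @ map (\<lambda>i. ?\<delta> i \<cdot>\<^sub>v u) idx @ [?R]))"
      unfolding sysD_envelope w2 by (rule diag_block_mat_mult_vconcat)
    also have "map2 (*\<^sub>v) Ds ([u] @ map (\<lambda>i. ?\<delta> i \<cdot>\<^sub>v u) idx @ [?R]) = [sysD (\<Sigma> 1) *\<^sub>v u]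
        @ map (\<lambda>i. - (sysD (\<Sigma> 1) - sysD (\<Sigma> i)) *\<^sub>v (?\<delta> i \<cdot>\<^sub>v u)) idx @ [0\<^sub>m LL LL *\<^sub>v ?R]"
      by (simp add: map2_map_map)
    finally have Dw: "sysD E *\<^sub>v w = vconcat ([sysD (\<Sigma> 1) *\<^sub>v u]
        @ map (\<lambda>i. - (sysD (\<Sigma> 1) - sysD (\<Sigma> i)) *\<^sub>v (?\<delta> i \<cdot>\<^sub>v u)) idx @ [0\<^sub>m LL LL *\<^sub>v ?R])" .
    have 2: "(selector j *\<^sub>v (sysD E *\<^sub>v w)) $ k = (sysD (\<Sigma> 1) *\<^sub>v u) $ k
        + (if j = 1 then 0 else - (- (sysD (\<Sigma> 1) - sysD (\<Sigma> j)) *\<^sub>v (?\<delta> j \<cdot>\<^sub>v u)) $ k)"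
      unfolding Dw by (rule selector_mult_vconcat[OF j _ _ _ k])
        (rule mult_mat_vec_in_carrier[OF mode1(4)], (rule carrier_vecI, simp)+)
    have 3: "((sysC (\<Sigma> 1) - sysC (\<Sigma> j)) *\<^sub>v \<xi>) $ k = (sysC (\<Sigma> 1) *\<^sub>v \<xi>) $ k - (sysC (\<Sigma> j) *\<^sub>v \<xi>) $ k"
      unfolding minus_mult_distrib_mat_vec[OF mode1(3) modes(3)[OF j] \<xi>]
      using k modes(3)[OF j] by simp
    \<comment> \<open>The sign in \<open>D_E\<close> cancels against the sign of the input block, so
      this block contributes the plain difference, which the selector subtracts.\<close>
    have 4: "(- (sysD (\<Sigma> 1) - sysD (\<Sigma> j)) *\<^sub>v (?\<delta> j \<cdot>\<^sub>v u)) $ k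
        = (sysD (\<Sigma> 1) *\<^sub>v u) $ k - (sysD (\<Sigma> j) *\<^sub>v u) $ k"
    proof -
      have D': "sysD (\<Sigma> 1) - sysD (\<Sigma> j) \<in> carrier_mat p m"
        using modes(4)[OF j] by (rule minus_carrier_mat)
      have "- (sysD (\<Sigma> 1) - sysD (\<Sigma> j)) *\<^sub>v (?\<delta> j \<cdot>\<^sub>v u) = - ((sysD (\<Sigma> 1) - sysD (\<Sigma> j)) *\<^sub>v (?\<delta> j \<cdot>\<^sub>v u))"
        using modes(4)[OF j] u by (intro uminus_mult_mat_vec) simp
      also have "(sysD (\<Sigma> 1) - sysD (\<Sigma> j)) *\<^sub>v (?\<delta> j \<cdot>\<^sub>v u) = ?\<delta> j \<cdot>\<^sub>v ((sysD (\<Sigma> 1) - sysD (\<Sigma> j)) *\<^sub>v u)"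
        by (rule mult_mat_vec[OF D' u])
      also have "(sysD (\<Sigma> 1) - sysD (\<Sigma> j)) *\<^sub>v u = sysD (\<Sigma> 1) *\<^sub>v u - sysD (\<Sigma> j) *\<^sub>v u"
        by (rule minus_mult_distrib_mat_vec[OF mode1(4) modes(4)[OF j] u])
      finally show ?thesis
        using k modes(4)[OF j] by simp
    qed
    have "(selector j *\<^sub>v (sysC E *\<^sub>v \<xi> + sysD E *\<^sub>v w)) $ k
        = (selector j *\<^sub>v (sysC E *\<^sub>v \<xi>)) $ k + (selector j *\<^sub>v (sysD E *\<^sub>v w)) $ k"
      unfolding mult_add_distrib_mat_vec[OF selector_carrier C D]
      using k selector_carrier[of j] by (intro index_add_vec) simp
    also have "\<dots> = (sysC (\<Sigma> j) *\<^sub>v \<xi>) $ k + (sysD (\<Sigma> j) *\<^sub>v u) $ k"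
      unfolding 1 2 3 4 by simp
    also have "\<dots> = (sysC (\<Sigma> j) *\<^sub>v \<xi> + sysD (\<Sigma> j) *\<^sub>v u) $ k"
      using k modes(4)[OF j] by (intro index_add_vec[symmetric]) simp
    finally show "(selector j *\<^sub>v (sysC E *\<^sub>v \<xi> + sysD E *\<^sub>v w)) $ k = (sysC (\<Sigma> j) *\<^sub>v \<xi> + sysD (\<Sigma> j) *\<^sub>v u) $ k" .
  qed (use selector_carrier[of j] modes(4)[OF j] in simp)
qed

end

section \<open>Reduced systems and the error bound\<close>

text \<open>\<open>reduce\<close> extracts the inverse with \<open>the\<close>; nonsingularity makes
  the matrix a unit of the matrix ring, so that \<open>mat_inverse\<close> does not return
  \<open>None\<close>.\<close>

lemma the_mat_inverse_carrier:
  assumes A: "(A :: real mat) \<in> carrier_mat r r" and inv: "invertible_mat A"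
  shows "the (mat_inverse A) \<in> carrier_mat r r"
proof -
  obtain B where B: "A * B = 1\<^sub>m (dim_row A)" "B * A = 1\<^sub>m (dim_row B)"
    using inv by (auto simp: invertible_mat_def inverts_mat_def)
  have "dim_row B = r" "dim_col B = r"
    using arg_cong[OF B(1), of dim_col] arg_cong[OF B(2), of dim_col] A by simp_all
  then have "A \<in> Units (ring_mat TYPE(real) r ())"
    using A B by (auto simp: Units_def ring_mat_def intro!: bexI[of _ B])
  then obtain C where "mat_inverse A = Some C"
    using mat_inverse(1)[OF A, where b = "()"] by blast
  then show ?thesis
    using mat_inverse(2)[OF A] by simp
qed

lemma reduce_dims:
  assumes P: "lti_dims n m p P" and W: "W \<in> carrier_mat n r" and V: "V \<in> carrier_mat n r"
    and inv: "invertible_mat (transpose_mat W * V)"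
  shows "lti_dims r m p (reduce W V P)"
proof -
  have "the (mat_inverse (transpose_mat W * V)) \<in> carrier_mat r r"
    using W V inv by (intro the_mat_inverse_carrier) auto
  then show ?thesis
    using P W V unfolding lti_dims_def reduce_def by (auto simp: Let_def)
qed

text \<open>Projection applies the same linear map to the right-hand side at
  \<open>V *\<^sub>v \<xi>\<close>, whatever the system. Equal right-hand sides of a mode and the
  envelope there thus stay equal after reduction.\<close>

lemma reduce_state_eq:
  assumes P: "lti_dims n m p P" and W: "W \<in> carrier_mat n r" and V: "V \<in> carrier_mat n r"
    and inv: "invertible_mat (transpose_mat W * V)"
    and \<xi>: "\<xi> \<in> carrier_vec r" and u: "u \<in> carrier_vec m"
  shows "sysA (reduce W V P) *\<^sub>v \<xi> + sysB (reduce W V P) *\<^sub>v u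
    = the (mat_inverse (transpose_mat W * V)) *\<^sub>v (transpose_mat W *\<^sub>v (sysA P *\<^sub>v (V *\<^sub>v \<xi>) + sysB P *\<^sub>v u))"
proof -
  let ?F = "the (mat_inverse (transpose_mat W * V))"
  have F: "?F \<in> carrier_mat r r"
    using W V inv by (intro the_mat_inverse_carrier) auto
  have W': "transpose_mat W \<in> carrier_mat r n" using W by simp
  have A: "sysA P \<in> carrier_mat n n" and B: "sysB P \<in> carrier_mat n m"
    using P by (simp_all add: lti_dims_def)
  have V\<xi>: "V *\<^sub>v \<xi> \<in> carrier_vec n" by (rule mult_mat_vec_in_carrier[OF V])
  have "sysA (reduce W V P) *\<^sub>v \<xi> = ?F *\<^sub>v (transpose_mat W *\<^sub>v (sysA P *\<^sub>v (V *\<^sub>v \<xi>)))"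
    unfolding reduce_def Let_def lti.simps
      assoc_mult_mat_vec[OF F mult_carrier_mat[OF mult_carrier_mat[OF W' A] V] \<xi>]
      assoc_mult_mat_vec[OF mult_carrier_mat[OF W' A] V \<xi>] assoc_mult_mat_vec[OF W' A V\<xi>] ..
  moreover have "sysB (reduce W V P) *\<^sub>v u = ?F *\<^sub>v (transpose_mat W *\<^sub>v (sysB P *\<^sub>v u))"
    unfolding reduce_def Let_def lti.simps
      assoc_mult_mat_vec[OF F mult_carrier_mat[OF W' B] u] assoc_mult_mat_vec[OF W' B u] ..
  ultimately show ?thesis
    by (simp only: mult_add_distrib_mat_vec[OF F mult_mat_vec_in_carrier[OF W'] mult_mat_vec_in_carrier[OF W']]
        mult_add_distrib_mat_vec[OF W' mult_mat_vec_in_carrier[OF A] mult_mat_vec_in_carrier[OF B]])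
qed

text \<open>Allows the output identity of the closed loop to be used at the lifted state
  \<open>V *\<^sub>v \<xi>\<close>.\<close>

lemma reduce_output_eq:
  assumes P: "lti_dims n m p P" and V: "V \<in> carrier_mat n r" and \<xi>: "\<xi> \<in> carrier_vec r"
  shows "sysC (reduce W V P) *\<^sub>v \<xi> + sysD (reduce W V P) *\<^sub>v u = sysC P *\<^sub>v (V *\<^sub>v \<xi>) + sysD P *\<^sub>v u"
proof -
  have "sysC P \<in> carrier_mat p n" using P by (simp add: lti_dims_def)
  from assoc_mult_mat_vec[OF this V \<xi>] show ?thesis
    by (simp add: reduce_def Let_def)
qed

context switched_envelope
begin

section \<open>Closed-loop trajectories and the small-gain estimate\<close>

text \<open>The explicit feedback does not refer to the envelope input itself, so its energy is
  finite, without circularity, because those of the state \<open>z\<close> and of \<open>u\<close>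
  are.\<close>

lemma square_integrable_feedback_input:
  fixes \<sigma> :: "real \<Rightarrow> nat"
  assumes \<sigma>: "\<sigma> \<in> measurable (lebesgue_on I) (count_space UNIV)" "\<And>t. t \<in> I \<Longrightarrow> \<sigma> t \<in> {1..l}"
    and z: "square_integrable n I z" and u: "square_integrable m I u"
  shows "square_integrable (l * m + LL) I (\<lambda>t. K (\<sigma> t) *\<^sub>v (sysC E *\<^sub>v z t) + K0 (\<sigma> t) *\<^sub>v u t)"
  by (intro square_integrable_add
      square_integrable_switched_mult_mat[OF square_integrable_mult_mat[OF z envelope_carriers(2)] feedback_K_carrier \<sigma>]
      square_integrable_switched_mult_mat[OF u feedback_K0_carrier \<sigma>]) simp_all

text \<open>The state is kept and only input and output of the envelope are constructed: with the
  explicit feedback the envelope has the right-hand side of the active mode along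
  \<open>x\<close>.\<close>

lemma closed_loop_trajectory:
  assumes \<sigma>: "\<sigma> \<in> measurable (lebesgue_on {0..tend}) (count_space UNIV)" "\<And>t. t \<in> {0..tend} \<Longrightarrow> \<sigma> t \<in> {1..l}"
    and u: "square_integrable m {0..tend} u"
    and tr: "trajectory n {0..tend} (\<lambda>t. \<Sigma> (\<sigma> t)) u x y"
  obtains w z where "square_integrable (l * m + LL) {0..tend} w"
    and "trajectory n {0..tend} (\<lambda>_. E) w x z"
    and "\<And>t. t \<in> {0..tend} \<Longrightarrow> w t = K (\<sigma> t) *\<^sub>v z t + K0 (\<sigma> t) *\<^sub>v u t"
    and "\<And>t. t \<in> {0..tend} \<Longrightarrow> y t = selector (\<sigma> t) *\<^sub>v z t"
proof -
  \<comment> \<open>Solved form of the loop equation; \<open>z\<close> is defined from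
    \<open>w\<close>, so using \<open>z\<close> here would be circular.\<close>
  define w where "w t = K (\<sigma> t) *\<^sub>v (sysC E *\<^sub>v x t) + K0 (\<sigma> t) *\<^sub>v u t" for t
  define z where "z t = sysC E *\<^sub>v x t + sysD E *\<^sub>v w t" for t
  have w: "square_integrable (l * m + LL) {0..tend} w"
    unfolding w_def by (rule square_integrable_feedback_input[OF \<sigma> square_integrable_state[OF tr] u])
  have loop: "w t = K (\<sigma> t) *\<^sub>v z t + K0 (\<sigma> t) *\<^sub>v u t" if "t \<in> {0..tend}" for t
    unfolding z_def feedback_K_mult_output[OF square_integrableD(3)[OF w that]] by (rule w_def)
  have cl: "sysA E *\<^sub>v x t + sysB E *\<^sub>v w t = sysA (\<Sigma> (\<sigma> t)) *\<^sub>v x t + sysB (\<Sigma> (\<sigma> t)) *\<^sub>v u t"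
    "selector (\<sigma> t) *\<^sub>v z t = sysC (\<Sigma> (\<sigma> t)) *\<^sub>v x t + sysD (\<Sigma> (\<sigma> t)) *\<^sub>v u t" if t: "t \<in> {0..tend}" for t
    using closed_loop(2,3)[OF \<sigma>(2)[OF t] trajectoryD(1)[OF tr t] square_integrableD(3)[OF u t] square_integrableD(3)[OF w t]]
      loop[OF t] unfolding z_def by blast+
  have "trajectory n {0..tend} (\<lambda>_. E) w x z"
    by (rule trajectory_cong[OF tr]) (auto simp: z_def cl(1))
  moreover have "y t = selector (\<sigma> t) *\<^sub>v z t" if "t \<in> {0..tend}" for t
    using cl(2)[OF that] trajectoryD(4)[OF tr that] by simp
  ultimately show ?thesis using that w loop by blast
qed

text \<open>Here the loop trajectory is given, not constructed. Its state also solves the reduced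
  switched system, with the selected output, and uniqueness identifies it with the state of the
  given switched trajectory.\<close>

lemma reduced_closed_loop:
  assumes \<sigma>: "\<sigma> \<in> measurable (lebesgue_on {0..tend}) (count_space UNIV)" "\<And>t. t \<in> {0..tend} \<Longrightarrow> \<sigma> t \<in> {1..l}"
    and u: "square_integrable m {0..tend} u"
    and W: "W \<in> carrier_mat n r" and V: "V \<in> carrier_mat n r" and inv: "invertible_mat (transpose_mat W * V)"
    and tr: "trajectory r {0..tend} (\<lambda>t. reduce W V (\<Sigma> (\<sigma> t))) u x' y'"
    and trE: "trajectory r {0..tend} (\<lambda>_. reduce W V E) w x z"
    and loop: "\<And>t. t \<in> {0..tend} \<Longrightarrow> w t = K (\<sigma> t) *\<^sub>v z t + K0 (\<sigma> t) *\<^sub>v u t"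
  shows "square_integrable (l * m + LL) {0..tend} w"
    and "t \<in> {0..tend} \<Longrightarrow> y' t = selector (\<sigma> t) *\<^sub>v z t"
proof -
  \<comment> \<open>The dimension of \<open>w\<close> is read off the loop equation, as
    \<open>trajectory\<close> does not prescribe that of its input.\<close>
  have w: "w t \<in> carrier_vec (l * m + LL)" if "t \<in> {0..tend}" for t
    unfolding loop[OF that]
    by (intro add_carrier_vec mult_mat_vec_in_carrier[OF feedback_K_carrier] mult_mat_vec_in_carrier[OF feedback_K0_carrier])
  have Vx: "V *\<^sub>v x t \<in> carrier_vec n" for t by (rule mult_mat_vec_in_carrier[OF V])
  have z: "z t = sysC E *\<^sub>v (V *\<^sub>v x t) + sysD E *\<^sub>v w t" if t: "t \<in> {0..tend}" for t
    using trajectoryD(4)[OF trE t] reduce_output_eq[OF lti_dims_envelope V trajectoryD(1)[OF trE t]] by simp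
  have cl: "w t = K (\<sigma> t) *\<^sub>v (sysC E *\<^sub>v (V *\<^sub>v x t)) + K0 (\<sigma> t) *\<^sub>v u t"
    "sysA E *\<^sub>v (V *\<^sub>v x t) + sysB E *\<^sub>v w t = sysA (\<Sigma> (\<sigma> t)) *\<^sub>v (V *\<^sub>v x t) + sysB (\<Sigma> (\<sigma> t)) *\<^sub>v u t"
    "selector (\<sigma> t) *\<^sub>v z t = sysC (\<Sigma> (\<sigma> t)) *\<^sub>v (V *\<^sub>v x t) + sysD (\<Sigma> (\<sigma> t)) *\<^sub>v u t" if t: "t \<in> {0..tend}" for t
    using closed_loop[OF \<sigma>(2)[OF t] Vx square_integrableD(3)[OF u t] w[OF t]] loop[OF t] unfolding z[OF t] by blast+
  show "square_integrable (l * m + LL) {0..tend} w"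
    by (rule square_integrable_cong[OF square_integrable_feedback_input[OF \<sigma>
          square_integrable_mult_mat[OF square_integrable_state[OF trE] V] u] cl(1)[symmetric]])
  have dimsj: "lti_dims r m p (reduce W V (\<Sigma> (\<sigma> t)))" if "t \<in> {0..tend}" for t
    by (rule reduce_dims[OF dims[OF \<sigma>(2)[OF that]] W V inv])
  have tr2: "trajectory r {0..tend} (\<lambda>t. reduce W V (\<Sigma> (\<sigma> t))) u x (\<lambda>t. selector (\<sigma> t) *\<^sub>v z t)"
  proof (rule trajectory_cong[OF trE])
    fix t assume t: "t \<in> {0..tend}"
    note x = trajectoryD(1)[OF trE t] and ut = square_integrableD(3)[OF u t] and dj = dims[OF \<sigma>(2)[OF t]]
    show "sysA (reduce W V E) *\<^sub>v x t + sysB (reduce W V E) *\<^sub>v w t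
        = sysA (reduce W V (\<Sigma> (\<sigma> t))) *\<^sub>v x t + sysB (reduce W V (\<Sigma> (\<sigma> t))) *\<^sub>v u t"
      unfolding reduce_state_eq[OF lti_dims_envelope W V inv x w[OF t]] reduce_state_eq[OF dj W V inv x ut] cl(2)[OF t] ..
    show "selector (\<sigma> t) *\<^sub>v z t = sysC (reduce W V (\<Sigma> (\<sigma> t))) *\<^sub>v x t + sysD (reduce W V (\<Sigma> (\<sigma> t))) *\<^sub>v u t"
      unfolding reduce_output_eq[OF dj V x] by (rule cl(3)[OF t])
  qed auto
  have fin: "finite ((\<lambda>t. reduce W V (\<Sigma> (\<sigma> t))) ` {0..tend})"
    by (rule finite_subset[of _ "(\<lambda>j. reduce W V (\<Sigma> j)) ` {1..l}"]) (use \<sigma>(2) in blast, simp)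
  show "y' t = selector (\<sigma> t) *\<^sub>v z t" if t: "t \<in> {0..tend}"
  proof -
    have "x' t = x t"
      by (rule trajectory_unique[OF dimsj fin tr tr2 _ t]) simp_all
    then show ?thesis
      using trajectoryD(4)[OF tr t] trajectoryD(4)[OF tr2 t] by simp
  qed
qed

text \<open>The response \<open>yw\<close> of the full envelope to the reduced feedback
  \<open>w'\<close> splits the error: \<open>z - yw\<close> is the response to
  \<open>w - w'\<close>, in which \<open>u\<close> cancels, and \<open>yw - z'\<close> is the
  open-loop error on \<open>w'\<close>.\<close>

lemma small_gain:
  assumes \<sigma>: "\<sigma> \<in> measurable (lebesgue_on {0..tend}) (count_space UNIV)"
    and R: "lti_dims r (l * m + LL) (l * p + LL) R"
    and w: "square_integrable (l * m + LL) {0..tend} w" and tr: "trajectory n {0..tend} (\<lambda>_. E) w x z"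
    and w': "square_integrable (l * m + LL) {0..tend} w'" and tr': "trajectory r {0..tend} (\<lambda>_. R) w' x' z'"
    and loop: "\<And>t. t \<in> {0..tend} \<Longrightarrow> w t = K (\<sigma> t) *\<^sub>v z t + K0 (\<sigma> t) *\<^sub>v u t"
    and loop': "\<And>t. t \<in> {0..tend} \<Longrightarrow> w' t = K (\<sigma> t) *\<^sub>v z' t + K0 (\<sigma> t) *\<^sub>v u t"
    and \<mu>: "\<And>i. i \<in> {2..l} \<Longrightarrow> spectral_norm (M i) \<le> \<mu>" "0 \<le> \<mu>"
    and \<gamma>: "Hinf_norm E = ennreal \<gamma>" "0 \<le> \<gamma>"
    and \<epsilon>: "Hinf_error E R = ennreal \<epsilon>" "0 \<le> \<epsilon>"
    and \<theta>: "\<mu> * \<gamma> \<le> \<theta>" "0 < \<theta>" "\<theta> < 1"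
  shows "square_integrable (l * p + LL) {0..tend} (\<lambda>t. z t - z' t)"
    and "energy {0..tend} (\<lambda>t. z t - z' t) \<le> ennreal ((\<epsilon> / (1 - \<theta>))\<^sup>2) * energy {0..tend} w'"
proof -
  let ?I = "{0..tend}"
  have z: "square_integrable (l * p + LL) ?I z" by (rule square_integrable_output[OF lti_dims_envelope tr w])
  have z': "square_integrable (l * p + LL) ?I z'" by (rule square_integrable_output[OF R tr' w'])
  show e: "square_integrable (l * p + LL) ?I (\<lambda>t. z t - z' t)"
    by (rule square_integrable_diff[OF z z'])
  note d = square_integrable_diff[OF w w']
  have dle: "energy ?I (\<lambda>t. w t - w' t) \<le> ennreal (\<mu>\<^sup>2) * energy ?I (\<lambda>t. z t - z' t)"
  proof (rule energy_mono[OF _ square_integrableD(1)[OF e]])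
    fix t assume t: "t \<in> ?I"
    have "w t - w' t = K (\<sigma> t) *\<^sub>v z t - K (\<sigma> t) *\<^sub>v z' t"
      unfolding loop[OF t] loop'[OF t]
      using carrier_matD(1)[OF feedback_K_carrier] carrier_matD(1)[OF feedback_K0_carrier]
      by (intro eq_vecI) simp_all
    also have "\<dots> = K (\<sigma> t) *\<^sub>v (z t - z' t)"
      by (rule mult_minus_distrib_mat_vec[OF feedback_K_carrier square_integrableD(3)[OF z t] square_integrableD(3)[OF z' t], symmetric])
    finally show "vec_norm2 (w t - w' t) \<le> \<mu> * vec_norm2 (z t - z' t)"
      using vec_norm2_feedback_K_le[OF square_integrableD(3)[OF e t] \<mu>] by simp
  qed
  obtain xw yw where trw: "trajectory n ?I (\<lambda>_. E) w' xw yw"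
    using trajectory_zero_extend[OF lti_dims_envelope w'] by metis
  have yw: "square_integrable (l * p + LL) ?I yw" by (rule square_integrable_output[OF lti_dims_envelope trw w'])
  have trd: "trajectory n ?I (\<lambda>_. E) (\<lambda>t. w t - w' t) (\<lambda>t. x t - xw t) (\<lambda>t. z t - yw t)"
    by (rule trajectory_diff[OF lti_dims_envelope tr trw _ square_integrableD(3)[OF w] square_integrableD(3)[OF w']]) auto
  have g: "energy ?I (\<lambda>t. z t - yw t) \<le> ennreal (\<gamma>\<^sup>2) * energy ?I (\<lambda>t. w t - w' t)"
    using Hinf_norm_truncation[OF lti_dims_envelope d trd] unfolding \<gamma>(1) L2_norm_le_iff[OF \<gamma>(2)] .
  have eps: "energy ?I (\<lambda>t. yw t - z' t) \<le> ennreal (\<epsilon>\<^sup>2) * energy ?I w'"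
    using Hinf_error_truncation[OF lti_dims_envelope w' trw R tr'] unfolding \<epsilon>(1) L2_norm_le_iff[OF \<epsilon>(2)] .
  have "energy ?I (\<lambda>t. z t - z' t) = energy ?I (\<lambda>t. (z t - yw t) + (yw t - z' t))"
    unfolding energy_def
  proof (intro nn_integral_cong)
    fix t assume "t \<in> space (lebesgue_on ?I)"
    then have t: "t \<in> ?I" by simp
    have "z t - z' t = (z t - yw t) + (yw t - z' t)"
      using carrier_vecD[OF square_integrableD(3)[OF z t]] carrier_vecD[OF square_integrableD(3)[OF z' t]]
        carrier_vecD[OF square_integrableD(3)[OF yw t]]
      by (intro eq_vecI) simp_all
    then show "ennreal ((vec_norm2 (z t - z' t))\<^sup>2) = ennreal ((vec_norm2 ((z t - yw t) + (yw t - z' t)))\<^sup>2)"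
      by simp
  qed
  also have "\<dots> \<le> ennreal (1 / \<theta>) * energy ?I (\<lambda>t. z t - yw t) + ennreal (1 / (1 - \<theta>)) * energy ?I (\<lambda>t. yw t - z' t)"
    by (rule energy_add_le[OF square_integrableD(1)[OF square_integrable_diff[OF z yw]]
          square_integrableD(1)[OF square_integrable_diff[OF yw z']] \<theta>(2,3)])
  finally have sum: "energy ?I (\<lambda>t. z t - z' t)
      \<le> ennreal (1 / \<theta>) * energy ?I (\<lambda>t. z t - yw t) + ennreal (1 / (1 - \<theta>)) * energy ?I (\<lambda>t. yw t - z' t)" .
  \<comment> \<open>All energies are finite, so the remaining argument is real arithmetic; with an
    infinite \<open>q\<close> the term \<open>\<theta> * q\<close> could not be moved to the
    left.\<close>
  obtain q where q: "energy ?I (\<lambda>t. z t - z' t) = ennreal q" "0 \<le> q"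
    using square_integrableD(2)[OF e] by (cases "energy ?I (\<lambda>t. z t - z' t)") auto
  obtain s where s: "energy ?I w' = ennreal s" "0 \<le> s"
    using square_integrableD(2)[OF w'] by (cases "energy ?I w'") auto
  obtain a where a: "energy ?I (\<lambda>t. w t - w' t) = ennreal a" "0 \<le> a"
    using square_integrableD(2)[OF d] by (cases "energy ?I (\<lambda>t. w t - w' t)") auto
  obtain b where b: "energy ?I (\<lambda>t. z t - yw t) = ennreal b" "0 \<le> b"
    using square_integrableD(2)[OF square_integrable_diff[OF z yw]] by (cases "energy ?I (\<lambda>t. z t - yw t)") auto
  obtain c where c: "energy ?I (\<lambda>t. yw t - z' t) = ennreal c" "0 \<le> c"
    using square_integrableD(2)[OF square_integrable_diff[OF yw z']] by (cases "energy ?I (\<lambda>t. yw t - z' t)") auto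
  have "a \<le> \<mu>\<^sup>2 * q"
    using dle q a by (simp flip: ennreal_mult)
  moreover have "b \<le> \<gamma>\<^sup>2 * a"
    using g a b by (simp flip: ennreal_mult)
  moreover have ceps: "c \<le> \<epsilon>\<^sup>2 * s"
    using eps c s by (simp flip: ennreal_mult)
  moreover have qbc: "q \<le> b / \<theta> + c / (1 - \<theta>)"
    using sum \<theta> unfolding q(1) b(1) c(1) by (simp add: q b c flip: ennreal_mult ennreal_plus)
  ultimately have "b \<le> \<gamma>\<^sup>2 * (\<mu>\<^sup>2 * q)"
    by (meson mult_left_mono order_trans zero_le_power2)
  also have "\<dots> = (\<mu> * \<gamma>)\<^sup>2 * q"
    by (simp add: power_mult_distrib)
  also have "\<dots> \<le> \<theta>\<^sup>2 * q"
    using \<theta>(1) \<mu>(2) \<gamma>(2) q(2) by (intro mult_right_mono power_mono) auto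
  \<comment> \<open>The squared gain, divided by the weight \<theta>, leaves the factor
    \<open>\<theta> < 1\<close>, which the left side absorbs.\<close>
  finally have "b / \<theta> \<le> \<theta> * q"
    using \<theta>(2) by (simp add: divide_le_eq power2_eq_square mult_ac)
  then have "(1 - \<theta>) * q \<le> \<epsilon>\<^sup>2 * s / (1 - \<theta>)"
    using qbc divide_right_mono[OF ceps, of "1 - \<theta>"] \<theta>(3) by (simp add: left_diff_distrib)
  then have "q \<le> \<epsilon>\<^sup>2 * s / (1 - \<theta>) / (1 - \<theta>)"
    using \<theta>(3) by (subst pos_le_divide_eq) (simp_all add: mult.commute)
  also have "\<dots> = (\<epsilon> / (1 - \<theta>))\<^sup>2 * s"
    by (simp add: power2_eq_square)
  finally show "energy ?I (\<lambda>t. z t - z' t) \<le> ennreal ((\<epsilon> / (1 - \<theta>))\<^sup>2) * energy ?I w'"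
    unfolding q(1) s(1) using s(2) by (simp flip: ennreal_mult)
qed

end

theorem theorem3p8:
  fixes n m p l :: nat
    and \<Sigma> :: "nat \<Rightarrow> lti"
    and S M T :: "nat \<Rightarrow> real mat"
  assumes "l \<ge> 1"
    and "\<And>i. i \<in> {1..l} \<Longrightarrow> lti_dims n m p (\<Sigma> i)"
    and "decomposition n l \<Sigma> S M T"
    and "Hinf_norm (envelope n l \<Sigma> S T) < \<infinity>"
    and "(SUP i\<in>{2..l}. ennreal (spectral_norm (M i))) * Hinf_norm (envelope n l \<Sigma> S T) < 1"
  shows "\<exists>\<eta>::real. \<eta> > 0 \<and>
    (\<forall>(r::nat) W V \<sigma> (tend::real) u x y x' y' u\<^sub>E x\<^sub>E y\<^sub>E.
       W \<in> carrier_mat n r \<longrightarrow> V \<in> carrier_mat n r \<longrightarrow>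
       invertible_mat (transpose_mat W * V) \<longrightarrow>
       switching_signal l \<sigma> \<longrightarrow>
       tend > 0 \<longrightarrow>
       square_integrable m {0..tend} u \<longrightarrow>
       trajectory n {0..tend} (\<lambda>t. \<Sigma> (\<sigma> t)) u x y \<longrightarrow>
       trajectory r {0..tend} (\<lambda>t. reduce W V (\<Sigma> (\<sigma> t))) u x' y' \<longrightarrow>
       trajectory r {0..tend} (\<lambda>_. reduce W V (envelope n l \<Sigma> S T)) u\<^sub>E x\<^sub>E y\<^sub>E \<longrightarrow>
       (\<forall>t\<in>{0..tend}.
          u\<^sub>E t = feedback_K m p l M (\<sigma> t) *\<^sub>v y\<^sub>E t + feedback_K0 n m l \<Sigma> (\<sigma> t) *\<^sub>v u t) \<longrightarrow>
       Hinf_error (envelope n l \<Sigma> S T) (reduce W V (envelope n l \<Sigma> S T)) < \<infinity> \<longrightarrow>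
       L2_norm {0..tend} (\<lambda>t. y t - y' t)
         \<le> ennreal \<eta> * Hinf_error (envelope n l \<Sigma> S T) (reduce W V (envelope n l \<Sigma> S T))
             * L2_norm {0..tend} u\<^sub>E)"
proof -
  interpret switched_envelope n m p l \<Sigma> S M T
    using assms(1-3) by unfold_locales
  obtain \<gamma> where \<gamma>: "Hinf_norm E = ennreal \<gamma>" "0 \<le> \<gamma>"
    using assms(4) by (cases "Hinf_norm E") auto
  let ?sup = "SUP i\<in>{2..l}. ennreal (spectral_norm (M i))"
  \<comment> \<open>A finite sum bounds the supremum. For \<open>l = 1\<close> the index set is
    empty and the supremum in \<open>ennreal\<close> is \<open>0\<close>.\<close>
  have "?sup \<le> ennreal (\<Sum>i\<in>{2..l}. \<bar>spectral_norm (M i)\<bar>)"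
  proof (rule SUP_least, rule ennreal_leI)
    fix i assume i: "i \<in> {2..l}"
    have "\<bar>spectral_norm (M i)\<bar> \<le> (\<Sum>i\<in>{2..l}. \<bar>spectral_norm (M i)\<bar>)"
      using i by (intro member_le_sum) auto
    then show "spectral_norm (M i) \<le> (\<Sum>i\<in>{2..l}. \<bar>spectral_norm (M i)\<bar>)" by linarith
  qed
  also have "\<dots> < top_class.top" by simp
  finally obtain \<mu> where \<mu>: "?sup = ennreal \<mu>" "0 \<le> \<mu>"
    by (cases ?sup) auto
  have M_le: "spectral_norm (M i) \<le> \<mu>" if "i \<in> {2..l}" for i
    using SUP_upper[OF that, of "\<lambda>i. ennreal (spectral_norm (M i))"] \<mu> by simp
  have "\<mu> * \<gamma> < 1"
    using assms(5) unfolding \<mu>(1) \<gamma>(1) ennreal_mult[OF \<mu>(2) \<gamma>(2), symmetric] by (simp add: ennreal_less_one_iff)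
  \<comment> \<open>Dividing by the weight requires \<open>\<theta> > 0\<close>, but
    \<open>\<mu> * \<gamma>\<close> may be \<open>0\<close>, for instance when all modes share one
    \<open>A\<close>.\<close>
  define \<theta> where "\<theta> = max (\<mu> * \<gamma>) (1 / 2)"
  have \<theta>: "\<mu> * \<gamma> \<le> \<theta>" "0 < \<theta>" "\<theta> < 1"
    using \<open>\<mu> * \<gamma> < 1\<close> by (auto simp: \<theta>_def)
  have "\<exists>c>0. \<forall>v\<in>carrier_vec (l * p + LL). vec_norm2 (selector j *\<^sub>v v) \<le> c * vec_norm2 v" for j
    using vec_norm2_mult_mat_bounded[OF selector_carrier] by metis
  then obtain cs where cs: "\<And>j. cs j > 0"
    "\<And>j v. v \<in> carrier_vec (l * p + LL) \<Longrightarrow> vec_norm2 (selector j *\<^sub>v v) \<le> cs j * vec_norm2 v"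
    by metis
  \<comment> \<open>One gain for the selectors of all modes; \<open>l >= 1\<close> makes the sum
    positive.\<close>
  define c where "c = (\<Sum>j\<in>{1..l}. cs j)"
  have "c > 0" unfolding c_def using l cs(1) by (intro sum_pos) auto
  have c: "vec_norm2 (selector j *\<^sub>v v) \<le> c * vec_norm2 v"
    if "j \<in> {1..l}" "v \<in> carrier_vec (l * p + LL)" for j v
  proof -
    have "cs j \<le> c"
      unfolding c_def using that(1) cs(1) by (intro member_le_sum) (auto simp: less_imp_le)
    then show ?thesis
      using cs(2)[OF that(2), of j] by (meson mult_right_mono order_trans vec_norm2_nonneg)
  qed
  show ?thesis
  \<comment> \<open>Both parts of the witness are fixed before the reduction, the switching signal
    and the input: \<open>c\<close> comes from the selectors, \<open>1 / (1 - \<theta>)\<close> from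
    the small-gain estimate.\<close>
  proof (intro exI[of _ "c / (1 - \<theta>)"] conjI allI impI)
    show "0 < c / (1 - \<theta>)" using \<open>c > 0\<close> \<theta>(3) by simp
    fix r W V \<sigma> and tend :: real and u x y x' y' w' xE z'
    assume W: "W \<in> carrier_mat n r" and V: "V \<in> carrier_mat n r" and inv: "invertible_mat (transpose_mat W * V)"
      and sw: "switching_signal l \<sigma>" and "tend > 0" and u: "square_integrable m {0..tend} u"
      and tr: "trajectory n {0..tend} (\<lambda>t. \<Sigma> (\<sigma> t)) u x y"
      and tr': "trajectory r {0..tend} (\<lambda>t. reduce W V (\<Sigma> (\<sigma> t))) u x' y'"
      and trE: "trajectory r {0..tend} (\<lambda>_. reduce W V E) w' xE z'"
      and loop': "\<forall>t\<in>{0..tend}. w' t = K (\<sigma> t) *\<^sub>v z' t + K0 (\<sigma> t) *\<^sub>v u t"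
      and fin: "Hinf_error E (reduce W V E) < \<infinity>"
    have \<sigma>: "\<sigma> \<in> measurable (lebesgue_on {0..tend}) (count_space UNIV)"
      by (rule measurable_restrict_mono[OF switching_signal_measurable[OF sw]]) auto
    have \<sigma>l: "\<sigma> t \<in> {1..l}" if "t \<in> {0..tend}" for t
      using sw that by (simp add: switching_signal_def)
    obtain \<epsilon> where \<epsilon>: "Hinf_error E (reduce W V E) = ennreal \<epsilon>" "0 \<le> \<epsilon>"
      using fin by (cases "Hinf_error E (reduce W V E)") auto
    obtain w z where w: "square_integrable (l * m + LL) {0..tend} w"
      and trz: "trajectory n {0..tend} (\<lambda>_. E) w x z"
      and loop: "\<And>t. t \<in> {0..tend} \<Longrightarrow> w t = K (\<sigma> t) *\<^sub>v z t + K0 (\<sigma> t) *\<^sub>v u t"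
      and y: "\<And>t. t \<in> {0..tend} \<Longrightarrow> y t = selector (\<sigma> t) *\<^sub>v z t"
      using closed_loop_trajectory[OF \<sigma> \<sigma>l u tr] by blast
    have w': "square_integrable (l * m + LL) {0..tend} w'"
      by (rule reduced_closed_loop(1)[OF \<sigma> \<sigma>l u W V inv tr' trE bspec[OF loop']])
    have y': "y' t = selector (\<sigma> t) *\<^sub>v z' t" if "t \<in> {0..tend}" for t
      by (rule reduced_closed_loop(2)[OF \<sigma> \<sigma>l u W V inv tr' trE bspec[OF loop'] that])
    have R: "lti_dims r (l * m + LL) (l * p + LL) (reduce W V E)"
      by (rule reduce_dims[OF lti_dims_envelope W V inv])
    have e: "square_integrable (l * p + LL) {0..tend} (\<lambda>t. z t - z' t)"
      by (rule small_gain(1)[OF \<sigma> R w trz w' trE loop bspec[OF loop'] M_le \<mu>(2) \<gamma> \<epsilon> \<theta>])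
    have e_le: "energy {0..tend} (\<lambda>t. z t - z' t) \<le> ennreal ((\<epsilon> / (1 - \<theta>))\<^sup>2) * energy {0..tend} w'"
      by (rule small_gain(2)[OF \<sigma> R w trz w' trE loop bspec[OF loop'] M_le \<mu>(2) \<gamma> \<epsilon> \<theta>])
    have z: "square_integrable (l * p + LL) {0..tend} z"
      by (rule square_integrable_output[OF lti_dims_envelope trz w])
    have z': "square_integrable (l * p + LL) {0..tend} z'"
      by (rule square_integrable_output[OF R trE w'])
    \<comment> \<open>At each time both outputs are taken with the same selector, so the output
      error is the selected envelope error.\<close>
    have "energy {0..tend} (\<lambda>t. y t - y' t) \<le> ennreal (c\<^sup>2) * energy {0..tend} (\<lambda>t. z t - z' t)"
    proof (rule energy_mono[OF _ square_integrableD(1)[OF e]])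
      fix t assume t: "t \<in> {0..tend}"
      have "y t - y' t = selector (\<sigma> t) *\<^sub>v (z t - z' t)"
        unfolding y[OF t] y'[OF t]
        by (rule mult_minus_distrib_mat_vec[OF selector_carrier square_integrableD(3)[OF z t]
              square_integrableD(3)[OF z' t], symmetric])
      then show "vec_norm2 (y t - y' t) \<le> c * vec_norm2 (z t - z' t)"
        using c[OF \<sigma>l[OF t] square_integrableD(3)[OF e t]] by simp
    qed
    also have "\<dots> \<le> ennreal (c\<^sup>2) * (ennreal ((\<epsilon> / (1 - \<theta>))\<^sup>2) * energy {0..tend} w')"
      by (rule mult_left_mono[OF e_le]) simp
    also have "\<dots> = ennreal ((c / (1 - \<theta>) * \<epsilon>)\<^sup>2) * energy {0..tend} w'"
      by (simp add: power_mult_distrib power_divide mult_ac flip: ennreal_mult mult.assoc)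
    finally have "L2_norm {0..tend} (\<lambda>t. y t - y' t) \<le> ennreal (c / (1 - \<theta>) * \<epsilon>) * L2_norm {0..tend} w'"
      using \<open>c > 0\<close> \<theta>(3) \<epsilon>(2) by (subst L2_norm_le_iff) simp_all
    then show "L2_norm {0..tend} (\<lambda>t. y t - y' t)
        \<le> ennreal (c / (1 - \<theta>)) * Hinf_error E (reduce W V E) * L2_norm {0..tend} w'"
      unfolding \<epsilon>(1) using \<open>c > 0\<close> \<theta>(3) \<epsilon>(2) by (subst (asm) ennreal_mult) simp_all
  qed
qed

end
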